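(* Let $\mathbb{J}\subset\mathbb{R}$ be an open interval and $\{\mathcal P(x)=(P_i(x))_i:x\in\mathbb{J}\}$ a family of flags of $\mathbb{R}^n$ such that the number $r$ of components of $\mathcal P(x)$ is independent of $x\in\mathbb{J}$ and, for all $1\le i\le r$, the map $P_i(\cdot):\mathbb{J}\to M(n)$ is continuous (so all $\mathcal P(x)$ have the same type $\mathrm I=(q_i)_{1\le i\le r}$). Fix $x_0\in\mathbb{J}$ and $Q_0\in O(n)$ with $\pi^{\mathrm I}(Q_0)=\mathcal P(x_0)$. Let $\mathbb{J}_{\mathcal H}^0$ be the connected component of $x_0$ in $\{x\in\mathbb{J}:P_i(x)\notin\mathrm{Cut}(P_i(x_0)),\ 1\le i\le r\}$ and, for $x\in\mathbb{J}_{\mathcal H}^0$, let $\mathcal{Q}_{\mathcal H}(x)\in O(n)$ be the orthogonal matrix with $q_i$-blocks $$\left(\mathcal{Q}_{\mathcal H}(x)\right)^{(i)}=\mathcal{H}^{\pi^i}_{(P_i(x_0),P_i(x))}\left(Q_0^{(i)}\right),\qquad1\le i\le r.$$ Then, for all $x\in\mathbb{J}_{\mathcal H}^0$ and $1\le i\le r$, among all $q_i$-frames generating the range of $P_i(x)$ (i.e. all $W\in\mathrm{St}_{q_i}$ with $WW^T=P_i(x)$), $\left(\mathcal{Q}_{\mathcal H}(x)\right)^{(i)}$ minimizes the geodesic distance in $(\mathrm{St}_{q_i},g^{\mathrm{St}})$ to $Q_0^{(i)}$.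
   Context: A flag of type $\mathrm I=(q_i)_{1\le i\le r}$ ($r\ge2$, $q_i\ge1$, $\sum_iq_i=n$) is a tuple $(P_i)_{1\le i\le r}$ of orthogonal projectors of $\mathbb{R}^n$ with $\mathrm{rank}(P_i)=q_i$ and $P_iP_j=0$ for $i\ne j$. $M(n)$ is the set of $n\times n$ real matrices. $G_q$ is the set of rank-$q$ orthogonal projectors of $\mathbb{R}^n$. With $P_0^i=\mathrm{Diag}[0_{q_1},\dots,I_{q_i},\dots,0_{q_r}]$, $\pi^{\mathrm I}(Q)=(QP_0^iQ^T)_i$ for $Q\in O(n)$; $Q=(Q^{(1)}\ \dots\ Q^{(r)})$ is the partition into consecutive column blocks $Q^{(i)}\in\mathbb{R}^{n\times q_i}$. $\mathrm{St}_q=\{U\in\mathbb{R}^{n\times q}:U^TU=I_q\}$ has the Euclidean metric $g^{\mathrm{St}}_U(D_1,D_2)=\mathrm{tr}(D_1^TD_2)$. $\pi^{SG}_q:\mathrm{St}_q\to G_q$, $U\mapsto UU^T$, is a Riemannian submersion, where $G_q$ has the metric $\frac12\mathrm{tr}(\Delta\Delta')$; $\pi^i=\pi^{SG}_{q_i}$; the horizontal lift at $U$ of $\Delta\in T_PG_q$ is $\Delta^\sharp_U=\Delta U$. $\mathrm{Cut}(P)$ is the cut locus of $P$ in $G_q$: for $P=UU^T$, $\mathrm{Cut}(P)=\{YY^T:Y\in\mathrm{St}_q,\ \mathrm{rank}(U^TY)<q\}$. For $R\in G_q\setminus\mathrm{Cut}(P)$ and $UU^T=P$, the holonomy map is $\mathcal{H}^{\pi^{SG}_q}_{(P,R)}(U)=\mathrm{Exp}^{\mathrm{St}_q}_U\left((\mathrm{Log}^{G_q}_P(R))^\sharp_U\right)$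 (Riemannian exponential and logarithm), the endpoint of the horizontal lift through $U$ of the unique minimal geodesic from $P$ to $R$. *)

theory Defs
  imports "HOL-Analysis.Analysis" "Jordan_Normal_Form.DL_Rank"
begin

text \<open>Matrices are those of \<^theory>\<open>Jordan_Normal_Form.Matrix\<close>, whose dimensions are natural numbers:
  the widths \<open>q\<^sub>i\<close> of the frames vary inside one statement. That type has no
  topology, so continuity and differentiability are entrywise. Components of flags and types
  are indexed from \<open>0\<close>.\<close>

definition mat_trace :: "real mat \<Rightarrow> real" where
  "mat_trace A = (\<Sum>i<dim_row A. A $$ (i, i))"

text \<open>The constant \<^const>\<open>orthogonal_mat\<close> does not require columns of norm \<open>1\<close>, hence the next
  definition.\<close>

definition orthogonal_group :: "nat \<Rightarrow> real mat set" where
  "orthogonal_group n = {Q \<in> carrier_mat n n. transpose_mat Q * Q = 1\<^sub>m n}"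

definition stiefel :: "nat \<Rightarrow> nat \<Rightarrow> real mat set" where
  "stiefel n q = {U \<in> carrier_mat n q. transpose_mat U * U = 1\<^sub>m q}"

definition grassmann :: "nat \<Rightarrow> nat \<Rightarrow> real mat set" where
  "grassmann n q =
     {P \<in> carrier_mat n n. transpose_mat P = P \<and> P * P = P \<and> vec_space.rank n P = q}"


section \<open>Flags\<close>

definition is_flag :: "nat \<Rightarrow> nat list \<Rightarrow> real mat list \<Rightarrow> bool" where
  "is_flag n qs Ps \<longleftrightarrow>
     2 \<le> length qs \<and> (\<forall>q\<in>set qs. 1 \<le> q) \<and> sum_list qs = n \<and>
     length Ps = length qs \<and>
     (\<forall>i<length qs. Ps ! i \<in> grassmann n (qs ! i)) \<and>
     (\<forall>i<length qs. \<forall>j<length qs. i \<noteq> j \<longrightarrow> Ps ! i * Ps ! j = 0\<^sub>m n n)"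

definition standard_projector :: "nat list \<Rightarrow> nat \<Rightarrow> real mat" where
  "standard_projector qs i =
     diag_block_mat
       (map (\<lambda>k. if k = i then 1\<^sub>m (qs ! k) else 0\<^sub>m (qs ! k) (qs ! k)) [0..<length qs])"

definition flag_of :: "nat list \<Rightarrow> real mat \<Rightarrow> real mat list" where
  "flag_of qs Q =
     map (\<lambda>i. Q * standard_projector qs i * transpose_mat Q) [0..<length qs]"

definition col_block :: "nat list \<Rightarrow> real mat \<Rightarrow> nat \<Rightarrow> real mat" where
  "col_block qs Q i =
     mat (dim_row Q) (qs ! i) (\<lambda>(a, b). Q $$ (a, sum_list (take i qs) + b))"


section \<open>Submanifolds of a matrix space\<close>

text \<open>Below, \<open>M\<close> is a submanifold of the space of \<open>a \<times> b\<close> matrices, and \<open>g\<close> is a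
  symmetric bilinear form that is positive definite on a linear subspace containing \<open>M\<close>. The
  Riemannian metric of \<open>M\<close> is the one induced by \<open>g\<close>.\<close>

definition has_mat_derivative ::
  "nat \<Rightarrow> nat \<Rightarrow> (real \<Rightarrow> real mat) \<Rightarrow> real mat \<Rightarrow> real filter \<Rightarrow> bool" where
  "has_mat_derivative a b \<gamma> D F \<longleftrightarrow> D \<in> carrier_mat a b \<and>
     (\<forall>i<a. \<forall>j<b. ((\<lambda>t. \<gamma> t $$ (i, j)) has_real_derivative D $$ (i, j)) F)"

definition velocity :: "nat \<Rightarrow> nat \<Rightarrow> (real \<Rightarrow> real mat) \<Rightarrow> real \<Rightarrow> real mat" where
  "velocity a b \<gamma> t =
     mat a b (\<lambda>(i, j). vector_derivative (\<lambda>s. \<gamma> s $$ (i, j)) (at t))"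

definition tangent_space :: "nat \<Rightarrow> nat \<Rightarrow> real mat set \<Rightarrow> real mat \<Rightarrow> real mat set" where
  "tangent_space a b M p =
     {D. \<exists>\<gamma> \<epsilon>. 0 < \<epsilon> \<and> (\<forall>t\<in>{-\<epsilon><..<\<epsilon>}. \<gamma> t \<in> M) \<and>
        (\<forall>i<a. \<forall>j<b. (\<lambda>t. \<gamma> t $$ (i, j)) C1_differentiable_on {-\<epsilon><..<\<epsilon>}) \<and>
        \<gamma> 0 = p \<and> has_mat_derivative a b \<gamma> D (at 0)}"

definition admissible_curve ::
  "nat \<Rightarrow> nat \<Rightarrow> real mat set \<Rightarrow> real mat \<Rightarrow> real mat \<Rightarrow> (real \<Rightarrow> real mat) \<Rightarrow> bool" where
  "admissible_curve a b M p q \<gamma> \<longleftrightarrow>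
     (\<forall>t\<in>{0..1}. \<gamma> t \<in> M) \<and> \<gamma> 0 = p \<and> \<gamma> 1 = q \<and>
     (\<forall>i<a. \<forall>j<b. (\<lambda>t. \<gamma> t $$ (i, j)) piecewise_C1_differentiable_on {0..1})"

text \<open>The library's piecewise \<open>C\<^sup>1\<close> condition allows an unbounded derivative near the
  breakpoints. The nonnegative integral gives such a curve infinite length if its speed is not
  integrable, whereas the Henstock--Kurzweil or Bochner integral would return \<open>0\<close>.\<close>

definition curve_length ::
  "nat \<Rightarrow> nat \<Rightarrow> (real mat \<Rightarrow> real mat \<Rightarrow> real) \<Rightarrow> (real \<Rightarrow> real mat) \<Rightarrow> ennreal" where
  "curve_length a b g \<gamma> =
     (\<integral>\<^sup>+t\<in>{0..1}. ennreal (sqrt (g (velocity a b \<gamma> t) (velocity a b \<gamma> t))) \<partial>lborel)"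

definition geodesic_dist ::
  "nat \<Rightarrow> nat \<Rightarrow> real mat set \<Rightarrow> (real mat \<Rightarrow> real mat \<Rightarrow> real) \<Rightarrow>
     real mat \<Rightarrow> real mat \<Rightarrow> ennreal" where
  "geodesic_dist a b M g p q =
     (INF \<gamma>\<in>Collect (admissible_curve a b M p q). curve_length a b g \<gamma>)"

text \<open>The Levi-Civita connection of the induced metric is the tangential part of the ambient
  derivative, so a curve in \<open>M\<close> is a geodesic iff its acceleration is normal to \<open>M\<close>.\<close>

definition is_geodesic ::
  "nat \<Rightarrow> nat \<Rightarrow> real mat set \<Rightarrow> (real mat \<Rightarrow> real mat \<Rightarrow> real) \<Rightarrow>
     (real \<Rightarrow> real mat) \<Rightarrow> (real \<Rightarrow> real mat) \<Rightarrow> bool" where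
  "is_geodesic a b M g \<gamma> \<gamma>' \<longleftrightarrow>
     (\<exists>\<gamma>''. \<forall>t\<in>{0..1}. \<gamma> t \<in> M \<and>
        has_mat_derivative a b \<gamma> (\<gamma>' t) (at t within {0..1}) \<and>
        has_mat_derivative a b \<gamma>' (\<gamma>'' t) (at t within {0..1}) \<and>
        (\<forall>D\<in>tangent_space a b M (\<gamma> t). g (\<gamma>'' t) D = 0))"

definition riem_exp ::
  "nat \<Rightarrow> nat \<Rightarrow> real mat set \<Rightarrow> (real mat \<Rightarrow> real mat \<Rightarrow> real) \<Rightarrow>
     real mat \<Rightarrow> real mat \<Rightarrow> real mat" where
  "riem_exp a b M g p v =
     (THE q. \<exists>\<gamma> \<gamma>'. is_geodesic a b M g \<gamma> \<gamma>' \<and> \<gamma> 0 = p \<and> \<gamma>' 0 = v \<and> \<gamma> 1 = q)"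

text \<open>The logarithm of \<open>q\<close> at \<open>p\<close> is the initial velocity of the minimal geodesic from \<open>p\<close> to
  \<open>q\<close>. The choice operator selects the only candidate whenever that geodesic is unique, which is
  the case for \<open>q\<close> outside the cut locus of \<open>p\<close>.\<close>

definition riem_log ::
  "nat \<Rightarrow> nat \<Rightarrow> real mat set \<Rightarrow> (real mat \<Rightarrow> real mat \<Rightarrow> real) \<Rightarrow>
     real mat \<Rightarrow> real mat \<Rightarrow> real mat" where
  "riem_log a b M g p q =
     (SOME v. v \<in> tangent_space a b M p \<and> riem_exp a b M g p v = q \<and>
        ennreal (sqrt (g v v)) = geodesic_dist a b M g p q)"


section \<open>Stiefel manifold, Grassmannian and holonomy\<close>

definition stiefel_metric :: "real mat \<Rightarrow> real mat \<Rightarrow> real" where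
  "stiefel_metric D1 D2 = mat_trace (transpose_mat D1 * D2)"

text \<open>This form is positive definite on symmetric matrices, and the Grassmannian is a
  submanifold of the space of symmetric matrices.\<close>

definition grassmann_metric :: "real mat \<Rightarrow> real mat \<Rightarrow> real" where
  "grassmann_metric D1 D2 = mat_trace (D1 * D2) / 2"

definition stiefel_dist :: "nat \<Rightarrow> nat \<Rightarrow> real mat \<Rightarrow> real mat \<Rightarrow> ennreal" where
  "stiefel_dist n q = geodesic_dist n q (stiefel n q) stiefel_metric"

definition stiefel_exp :: "nat \<Rightarrow> nat \<Rightarrow> real mat \<Rightarrow> real mat \<Rightarrow> real mat" where
  "stiefel_exp n q = riem_exp n q (stiefel n q) stiefel_metric"

definition grassmann_log :: "nat \<Rightarrow> nat \<Rightarrow> real mat \<Rightarrow> real mat \<Rightarrow> real mat" where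
  "grassmann_log n q = riem_log n n (grassmann n q) grassmann_metric"

text \<open>The rank condition does not depend on the frame \<open>U\<close> chosen for \<open>P\<close>: two frames of \<open>P\<close>
  differ by right multiplication with an orthogonal \<open>q \<times> q\<close> matrix.\<close>

definition grassmann_cut :: "nat \<Rightarrow> nat \<Rightarrow> real mat \<Rightarrow> real mat set" where
  "grassmann_cut n q P =
     {Y * transpose_mat Y |U Y.
        U \<in> stiefel n q \<and> U * transpose_mat U = P \<and> Y \<in> stiefel n q \<and>
        vec_space.rank q (transpose_mat U * Y) < q}"

definition horizontal_lift :: "real mat \<Rightarrow> real mat \<Rightarrow> real mat" where
  "horizontal_lift U \<Delta> = \<Delta> * U"

definition holonomy :: "nat \<Rightarrow> nat \<Rightarrow> real mat \<Rightarrow> real mat \<Rightarrow> real mat \<Rightarrow> real mat" where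
  "holonomy n q P R U =
     stiefel_exp n q U (horizontal_lift U (grassmann_log n q P R))"

definition holonomy_interval ::
  "nat \<Rightarrow> nat list \<Rightarrow> real set \<Rightarrow> (real \<Rightarrow> real mat list) \<Rightarrow> real \<Rightarrow> real set" where
  "holonomy_interval n qs J P x0 =
     connected_component_set
       {x \<in> J. \<forall>i<length qs. P x ! i \<notin> grassmann_cut n (qs ! i) (P x0 ! i)} x0"

text \<open>The blocks determine the matrix because the widths \<open>qs\<close> of a flag type add up to \<open>n\<close>.\<close>

definition holonomy_matrix ::
  "nat \<Rightarrow> nat list \<Rightarrow> (real \<Rightarrow> real mat list) \<Rightarrow> real \<Rightarrow> real mat \<Rightarrow> real \<Rightarrow> real mat" where
  "holonomy_matrix n qs P x0 Q0 x =
     (THE Q. Q \<in> orthogonal_group n \<and>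
        (\<forall>i<length qs. col_block qs Q i =
           holonomy n (qs ! i) (P x0 ! i) (P x ! i) (col_block qs Q0 i)))"

end

theory Submission
  imports Defs "Jordan_Normal_Form.Spectral_Radius"
begin

text \<open>The map \<open>U \<mapsto> U U\<^sup>T\<close> does not increase lengths, so every frame \<open>W\<close> with \<open>W W\<^sup>T = R\<close> satisfies
  \<open>dist (U, W) \<ge> dist (U U\<^sup>T, R)\<close>; the holonomy image of \<open>U\<close> attains this bound, being the endpoint of
  the horizontal lift of a minimal geodesic.

  Geodesics are unique because conserved momenta turn the geodesic equations into linear equations
  \<open>X' = A X - X B\<close> with skew-symmetric \<open>A\<close> and \<open>B\<close>; the horizontal ones are written down with sines and
  cosines after diagonalizing \<open>K\<^sup>T K\<close> for the initial velocity \<open>K\<close>.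

  Outside the cut locus the principal angles \<open>t\<^sub>i\<close> between \<open>P\<close> and \<open>R\<close> are less than \<open>\<pi>/2\<close>, and the
  explicit geodesic has length \<open>sqrt (\<Sum>i. t\<^sub>i\<^sup>2)\<close>. It is minimal: let \<open>p\<close> be a partial sum of the series
  of \<open>(arcsin (sqrt x))\<^sup>2\<close>. Then \<open>p - p'\<^sup>2 x (1 - x)\<close> has nonnegative coefficients, so by the
  Cauchy--Schwarz inequality \<open>sqrt (tr (p (P - P R P)))\<close> grows at most with unit speed when \<open>R\<close> moves
  along a curve starting at \<open>P\<close>. At the endpoint this quantity tends to \<open>sqrt (\<Sum>i. t\<^sub>i\<^sup>2)\<close>. Using
  polynomials in \<open>P - P R P\<close> avoids differentiating eigenvalues and lets the curve cross the cut locus.\<close>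

text \<open>The function (arcsin (sqrt x))^2 is forced: y = y'^2 x (1 - x) is the condition that
  sqrt y grows with unit speed in t when x = sin^2 t, and truncating the power series disturbs this
  equation in the harmless direction only. Every N thus bounds all lengths from below, and the sharp
  bound appears in the limit. The main obstacle is the definition of \<open>riem_log\<close>: it
  chooses a vector by a property that mentions \<open>geodesic_dist\<close>, an infimum over all
  admissible curves. Nothing can be said about \<open>holonomy\<close> before the distance from P to
  R has been computed exactly, so minimality in the Grassmannian has to be settled first. The rank
  condition in \<open>grassmann_cut\<close> enters through the strict positivity of the cosines of
  the principal angles: the principal vectors of R are obtained by dividing by them, and sin t < 1
  makes the remainder of the series tend to 0.\<close>

section \<open>Matrix algebra\<close>

text \<open>The premises of these rules are equations between dimensions, which the simplifier can
  discharge; the library's carrier premises leave the inner dimensions undetermined.\<close>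

named_theorems mat_algebra

lemma mat_mult_assoc [mat_algebra]: "dim_col A = dim_row B \<Longrightarrow> dim_col B = dim_row C \<Longrightarrow> (A * B) * C = A * (B * C :: real mat)"
  by (rule assoc_mult_mat[of _ "dim_row A" "dim_col A" _ "dim_col B" _ "dim_col C"]) auto

lemma mult_one_right [mat_algebra]: "dim_col A = n \<Longrightarrow> A * 1\<^sub>m n = (A :: real mat)"
  by (rule right_mult_one_mat[of _ "dim_row A"]) auto

lemma mult_one_left [mat_algebra]: "dim_row A = n \<Longrightarrow> 1\<^sub>m n * A = (A :: real mat)"
  by (rule left_mult_one_mat[of _ _ "dim_col A"]) auto

lemma mult_zero_right [mat_algebra]: "dim_col A = n \<Longrightarrow> A * 0\<^sub>m n k = (0\<^sub>m (dim_row A) k :: real mat)"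
  by (rule eq_matI) (auto simp: scalar_prod_def)

lemma mult_zero_left [mat_algebra]: "dim_row A = n \<Longrightarrow> 0\<^sub>m k n * A = (0\<^sub>m k (dim_col A) :: real mat)"
  by (rule eq_matI) (auto simp: scalar_prod_def)

lemma add_zero_left [mat_algebra]: "dim_row A = n \<Longrightarrow> dim_col A = k \<Longrightarrow> 0\<^sub>m n k + A = (A :: real mat)"
  by (rule eq_matI) auto

lemma add_zero_right [mat_algebra]: "dim_row A = n \<Longrightarrow> dim_col A = k \<Longrightarrow> A + 0\<^sub>m n k = (A :: real mat)"
  by (rule eq_matI) auto

lemma dim_mat_diag [simp]: "dim_row (mat_diag n d) = n" "dim_col (mat_diag n d) = n"
  by (simp_all add: mat_diag_def)

lemma mult_add_right [mat_algebra]: "dim_col A = dim_row B \<Longrightarrow> dim_row C = dim_row B \<Longrightarrow> dim_col C = dim_col B \<Longrightarrow>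
  A * (B + C) = A * B + A * (C :: real mat)"
  by (rule mult_add_distrib_mat[of _ "dim_row A" "dim_col A" _ "dim_col B"]) auto

lemma mult_add_left [mat_algebra]: "dim_col A = dim_row C \<Longrightarrow> dim_row B = dim_row A \<Longrightarrow> dim_col B = dim_col A \<Longrightarrow>
  (A + B) * C = A * C + B * (C :: real mat)"
  by (rule add_mult_distrib_mat[of _ "dim_row A" "dim_col A" _ _ "dim_col C"]) auto

lemma mult_minus_right [mat_algebra]: "dim_col A = dim_row B \<Longrightarrow> dim_row C = dim_row B \<Longrightarrow> dim_col C = dim_col B \<Longrightarrow>
  A * (B - C) = A * B - A * (C :: real mat)"
  by (rule mult_minus_distrib_mat[of _ "dim_row A" "dim_col A" _ "dim_col B"]) auto

lemma mult_minus_left [mat_algebra]: "dim_col A = dim_row C \<Longrightarrow> dim_row B = dim_row A \<Longrightarrow> dim_col B = dim_col A \<Longrightarrow>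
  (A - B) * C = A * C - B * (C :: real mat)"
  by (rule minus_mult_distrib_mat[of _ "dim_row A" "dim_col A" _ _ "dim_col C"]) auto

lemma mult_smult_right [mat_algebra]: "dim_col A = dim_row B \<Longrightarrow> A * (k \<cdot>\<^sub>m B) = k \<cdot>\<^sub>m (A * B :: real mat)"
  by (rule mult_smult_distrib[of _ "dim_row A" "dim_col A" _ "dim_col B"]) auto

lemma mult_smult_left [mat_algebra]: "dim_col A = dim_row B \<Longrightarrow> (k \<cdot>\<^sub>m A) * B = k \<cdot>\<^sub>m (A * B :: real mat)"
  by (rule mult_smult_assoc_mat[of _ "dim_row A" "dim_col A" _ "dim_col B"]) auto

lemma mult_uminus_right [mat_algebra]: "dim_col A = dim_row B \<Longrightarrow> A * (- B) = - (A * B :: real mat)"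
  by (rule eq_matI) (auto simp: scalar_prod_def sum_negf)

lemma mult_uminus_left [mat_algebra]: "dim_col A = dim_row B \<Longrightarrow> (- A) * B = - (A * B :: real mat)"
  by (rule eq_matI) (auto simp: scalar_prod_def sum_negf)

lemma transpose_mult' [mat_algebra]: "dim_col A = dim_row B \<Longrightarrow> transpose_mat (A * B) = transpose_mat B * transpose_mat (A :: real mat)"
  by (rule transpose_mult[of _ "dim_row A" "dim_col A" _ "dim_col B"]) auto

lemma transpose_add' [mat_algebra]: "dim_row A = dim_row B \<Longrightarrow> dim_col A = dim_col B \<Longrightarrow>
  transpose_mat (A + B) = transpose_mat A + transpose_mat (B :: real mat)"
  by (rule eq_matI) auto

lemma transpose_minus' [mat_algebra]: "dim_row A = dim_row B \<Longrightarrow> dim_col A = dim_col B \<Longrightarrow>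
  transpose_mat (A - B) = transpose_mat A - transpose_mat (B :: real mat)"
  by (rule eq_matI) auto

lemma transpose_uminus' [mat_algebra]: "transpose_mat (- A) = - transpose_mat (A :: real mat)"
  by (rule eq_matI) auto

lemma transpose_smult' [mat_algebra]: "transpose_mat (k \<cdot>\<^sub>m A) = k \<cdot>\<^sub>m transpose_mat (A :: real mat)"
  by (rule eq_matI) auto

text \<open>The rules of \<open>mat_algebra\<close> associate products to the right, which hides a
  factor \<open>A * B\<close> whenever something follows it. This form rewrites a known product in
  front of a tail.\<close>

lemma mult_left_eq: "A * B = D \<Longrightarrow> dim_col A = dim_row B \<Longrightarrow> dim_col B = dim_row C \<Longrightarrow> A * (B * C) = D * (C :: real mat)"
  by (simp add: mat_mult_assoc[symmetric])

section \<open>The trace and the Frobenius inner product\<close>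

lemma mat_trace_add: "dim_row A = dim_row B \<Longrightarrow> dim_col A = dim_row A \<Longrightarrow> dim_col B = dim_row B \<Longrightarrow>
  mat_trace (A + B) = mat_trace A + mat_trace B"
  by (simp add: mat_trace_def sum.distrib)

lemma mat_trace_minus: "dim_row A = dim_row B \<Longrightarrow> dim_col A = dim_row A \<Longrightarrow> dim_col B = dim_row B \<Longrightarrow>
  mat_trace (A - B) = mat_trace A - mat_trace B"
  by (simp add: mat_trace_def sum_subtractf)

lemma mat_trace_uminus: "dim_col A = dim_row A \<Longrightarrow> mat_trace (- A) = - mat_trace A"
  by (simp add: mat_trace_def sum_negf)

lemma mat_trace_smult: "dim_col A = dim_row A \<Longrightarrow> mat_trace (k \<cdot>\<^sub>m A) = k * mat_trace A"
  by (simp add: mat_trace_def sum_distrib_left)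

lemma mat_trace_zero: "mat_trace (0\<^sub>m n n) = 0"
  by (simp add: mat_trace_def)

lemma mat_trace_one: "mat_trace (1\<^sub>m n) = n"
  by (simp add: mat_trace_def)

lemmas mat_trace_simps = mat_trace_add mat_trace_minus mat_trace_uminus mat_trace_smult mat_trace_zero mat_trace_one

text \<open>A plain sum replaces the scalar product of a row and a column produced by
  \<open>index_mult_mat(1)\<close>; that rule is removed from the simpset wherever entries of
  products should stay folded or be opened in this form.\<close>

lemma mat_mult_index: "i < dim_row A \<Longrightarrow> j < dim_col B \<Longrightarrow> dim_col A = dim_row B \<Longrightarrow>
  (A * B) $$ (i, j) = (\<Sum>k<dim_row B. A $$ (i, k) * (B :: real mat) $$ (k, j))"
  by (simp add: scalar_prod_def atLeast0LessThan)

lemma mat_trace_mult: "dim_col A = dim_row B \<Longrightarrow> dim_row A = dim_col B \<Longrightarrow>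
  mat_trace (A * B) = (\<Sum>i<dim_row A. \<Sum>k<dim_col A. A $$ (i, k) * B $$ (k, i))"
  by (simp add: mat_trace_def mat_mult_index del: index_mult_mat(1))

lemma mat_trace_comm: "dim_col A = dim_row B \<Longrightarrow> dim_row A = dim_col B \<Longrightarrow> mat_trace (A * B) = mat_trace (B * A)"
  by (simp add: mat_trace_mult) (subst sum.swap, simp add: mult.commute)

lemma mat_trace_transpose: "dim_col A = dim_row A \<Longrightarrow> mat_trace (transpose_mat A) = mat_trace A"
  by (simp add: mat_trace_def)

text \<open>Summing over pairs turns a matrix into a finite vector, so that positivity and the
  Cauchy--Schwarz inequality for finite sums apply directly.\<close>

lemma mat_trace_inner: "dim_row A = dim_row B \<Longrightarrow> dim_col A = dim_col B \<Longrightarrow>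
  mat_trace (transpose_mat A * B) = (\<Sum>p\<in>{..<dim_row A} \<times> {..<dim_col A}. A $$ p * B $$ p)"
proof -
  assume a: "dim_row A = dim_row B" "dim_col A = dim_col B"
  have "mat_trace (transpose_mat A * B) = (\<Sum>i<dim_col A. \<Sum>k<dim_row A. A $$ (k, i) * B $$ (k, i))"
    using a by (simp add: mat_trace_mult)
  also have "\<dots> = (\<Sum>k<dim_row A. \<Sum>i<dim_col A. A $$ (k, i) * B $$ (k, i))"
    by (rule sum.swap)
  finally show ?thesis by (simp add: sum.cartesian_product case_prod_beta)
qed

lemma mat_trace_square_nonneg: "0 \<le> mat_trace (transpose_mat A * A)"
  by (simp add: mat_trace_inner sum_nonneg)

lemma mat_trace_square_eq_0:
  assumes "mat_trace (transpose_mat A * A) = 0" "A \<in> carrier_mat n m"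
  shows "A = 0\<^sub>m n m"
proof -
  have "\<forall>p\<in>{..<n} \<times> {..<m}. A $$ p * A $$ p = 0"
    using assms by (subst sum_nonneg_eq_0_iff[symmetric]) (auto simp: mat_trace_inner)
  then show ?thesis using assms(2) by (intro eq_matI) auto
qed

lemma mat_trace_Cauchy_Schwarz:
  assumes "dim_row A = dim_row B" "dim_col A = dim_col B"
  shows "(mat_trace (transpose_mat A * B))\<^sup>2 \<le> mat_trace (transpose_mat A * A) * mat_trace (transpose_mat B * B)"
  using assms Cauchy_Schwarz_ineq_sum[of "\<lambda>p. A $$ p" "\<lambda>p. B $$ p" "{..<dim_row A} \<times> {..<dim_col A}"]
  by (simp add: mat_trace_inner power2_eq_square)

section \<open>The spectral theorem for symmetric real matrices\<close>

lemma mult_of_bool_if: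
  "(if P then 1 else 0) * (x :: real) = (if P then x else 0)" "x * (if P then 1 else 0) = (if P then x else 0)"
  by auto

text \<open>A complex eigenvalue c with an eigenvector X + iY always exists. Symmetry forces c to be
  real, so X and Y both satisfy the real eigenvalue equation, and one of them is nonzero. Vectors
  are kept as one-column matrices so that \<open>mat_algebra\<close> applies to them.\<close>

lemma symmetric_real_eigenvector:
  fixes A :: "real mat"
  assumes A: "A \<in> carrier_mat n n" "transpose_mat A = A" and n: "0 < n"
  obtains l V where "V \<in> carrier_mat n 1" "transpose_mat V * V = 1\<^sub>m 1" "A * V = l \<cdot>\<^sub>m V"
proof -
  let ?C = "map_mat complex_of_real A"
  have C: "?C \<in> carrier_mat n n" using A by simp
  obtain c where "c \<in> spectrum ?C" using spectrum_non_empty[OF C n] by auto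
  then obtain z where z: "eigenvector ?C z c" unfolding spectrum_def eigenvalue_def by auto
  then have zc: "z \<in> carrier_vec n" and z0: "z \<noteq> 0\<^sub>v n" and ev: "?C *\<^sub>v z = c \<cdot>\<^sub>v z"
    using A unfolding eigenvector_def by auto
  have sum: "(\<Sum>j<n. complex_of_real (A $$ (i, j)) * z $ j) = c * z $ i" if "i < n" for i
    using arg_cong[OF ev, of "\<lambda>v. v $ i"] that A zc
    by (simp add: scalar_prod_def atLeast0LessThan)
  define X where "X = mat n 1 (\<lambda>(i, j). Re (z $ i))"
  define Y where "Y = mat n 1 (\<lambda>(i, j). Im (z $ i))"
  have XY: "X \<in> carrier_mat n 1" "Y \<in> carrier_mat n 1" by (auto simp: X_def Y_def)
  note dims = carrier_matD[OF A(1)] carrier_matD[OF XY(1)] carrier_matD[OF XY(2)]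
  have AX: "A * X = Re c \<cdot>\<^sub>m X - Im c \<cdot>\<^sub>m Y"
  proof (rule eq_matI)
    fix i j assume "i < dim_row (Re c \<cdot>\<^sub>m X - Im c \<cdot>\<^sub>m Y)" "j < dim_col (Re c \<cdot>\<^sub>m X - Im c \<cdot>\<^sub>m Y)"
    then have ij: "i < n" "j = 0" using XY by auto
    show "(A * X) $$ (i, j) = (Re c \<cdot>\<^sub>m X - Im c \<cdot>\<^sub>m Y) $$ (i, j)"
      using arg_cong[OF sum[OF ij(1)], of Re] ij dims
      by (simp add: X_def Y_def mat_mult_index del: index_mult_mat(1))
  qed (use dims in auto)
  have AY: "A * Y = Im c \<cdot>\<^sub>m X + Re c \<cdot>\<^sub>m Y"
  proof (rule eq_matI)
    fix i j assume "i < dim_row (Im c \<cdot>\<^sub>m X + Re c \<cdot>\<^sub>m Y)" "j < dim_col (Im c \<cdot>\<^sub>m X + Re c \<cdot>\<^sub>m Y)"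
    then have ij: "i < n" "j = 0" using XY by auto
    show "(A * Y) $$ (i, j) = (Im c \<cdot>\<^sub>m X + Re c \<cdot>\<^sub>m Y) $$ (i, j)"
      using arg_cong[OF sum[OF ij(1)], of Im] ij dims
      by (simp add: X_def Y_def mat_mult_index del: index_mult_mat(1))
  qed (use dims in auto)
  let ?q = "\<lambda>X Y. mat_trace (transpose_mat X * (Y :: real mat))"
  have sym: "?q Y X = ?q X Y" using dims by (simp add: mat_trace_inner mult.commute)
  \<comment> \<open>Expanding both sides by \<open>AX\<close> and \<open>AY\<close> cancels the
    terms with Re c and leaves Im c times the squared norm of the eigenvector.\<close>
  have "?q Y (A * X) = ?q (A * Y) X" using dims A(2) by (simp add: mat_algebra)
  also have "\<dots> = ?q X (A * Y)" using dims by (simp add: mat_trace_inner mult.commute)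
  finally have "Im c * (?q X X + ?q Y Y) = 0"
    using dims sym unfolding AX AY by (simp add: mat_algebra mat_trace_simps algebra_simps)
  moreover have "?q X X + ?q Y Y \<noteq> 0"
  proof
    assume "?q X X + ?q Y Y = 0"
    then have "?q X X = 0" "?q Y Y = 0"
      using mat_trace_square_nonneg[of X] mat_trace_square_nonneg[of Y] by auto
    then have "X = 0\<^sub>m n 1" "Y = 0\<^sub>m n 1"
      using mat_trace_square_eq_0[OF _ XY(1)] mat_trace_square_eq_0[OF _ XY(2)] by blast+
    then have "X $$ (i, 0) = 0" "Y $$ (i, 0) = 0" if "i < n" for i using that by auto
    then have "z $ i = 0" if "i < n" for i using that by (simp add: X_def Y_def complex_eq_iff)
    then show False using z0 zc by auto
  qed
  ultimately have "Im c = 0" by simp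
  then have AX': "A * X = Re c \<cdot>\<^sub>m X" and AY': "A * Y = Re c \<cdot>\<^sub>m Y"
    using AX AY dims by (auto intro!: eq_matI)
  obtain Z where Z: "Z \<in> carrier_mat n 1" "A * Z = Re c \<cdot>\<^sub>m Z" "?q Z Z \<noteq> 0"
    using AX' AY' XY \<open>?q X X + ?q Y Y \<noteq> 0\<close> by (metis add.right_neutral)
  let ?k = "sqrt (?q Z Z)"
  have pos: "?q Z Z > 0" using Z(3) mat_trace_square_nonneg[of Z] by simp
  have ZZ: "transpose_mat Z * Z = ?q Z Z \<cdot>\<^sub>m 1\<^sub>m 1"
    using Z(1) by (intro eq_matI) (auto simp: mat_trace_def)
  show thesis
  proof (rule that[of "(1 / ?k) \<cdot>\<^sub>m Z" "Re c"])
    show "transpose_mat ((1 / ?k) \<cdot>\<^sub>m Z) * ((1 / ?k) \<cdot>\<^sub>m Z) = 1\<^sub>m 1"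
      using Z(1) pos by (simp add: mat_algebra) (subst ZZ, rule eq_matI, auto)
    show "A * ((1 / ?k) \<cdot>\<^sub>m Z) = Re c \<cdot>\<^sub>m ((1 / ?k) \<cdot>\<^sub>m Z)"
      using Z A dims by (simp add: mat_algebra) (rule eq_matI, auto)
  qed (use Z in auto)
qed

text \<open>The Householder reflection in the hyperplane orthogonal to W = V - E exchanges the unit
  vectors E and V; the case W = 0 is treated apart.\<close>

lemma orthogonal_extension:
  fixes V :: "real mat"
  assumes V: "V \<in> carrier_mat n 1" "transpose_mat V * V = 1\<^sub>m 1" and n: "0 < n"
  obtains Q where "Q \<in> carrier_mat n n" "transpose_mat Q * Q = 1\<^sub>m n"
    "Q * mat n 1 (\<lambda>(i, j). if i = 0 then 1 else 0) = V"
proof -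
  define E where "E = (mat n 1 (\<lambda>(i, j). if i = 0 then 1 else 0) :: real mat)"
  have E: "E \<in> carrier_mat n 1" by (simp add: E_def)
  define W where "W = V - E"
  have W: "W \<in> carrier_mat n 1" using V E by (auto simp: W_def)
  note dims = carrier_matD[OF V(1)] carrier_matD[OF E] carrier_matD[OF W]
  have EE: "transpose_mat E * E = 1\<^sub>m 1"
    by (rule eq_matI) (use n in \<open>auto simp: mat_mult_index E_def mult_of_bool_if simp del: index_mult_mat(1)\<close>)
  have VE: "transpose_mat V * E = V $$ (0, 0) \<cdot>\<^sub>m 1\<^sub>m 1"
    by (rule eq_matI) (use n dims in \<open>auto simp: mat_mult_index E_def mult_of_bool_if simp del: index_mult_mat(1)\<close>)
  have EV: "transpose_mat E * V = V $$ (0, 0) \<cdot>\<^sub>m 1\<^sub>m 1"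
    by (rule eq_matI) (use n dims in \<open>auto simp: mat_mult_index E_def mult_of_bool_if simp del: index_mult_mat(1)\<close>)
  \<comment> \<open>The squared norm of W: V and E are unit vectors, and their inner product is the
    first entry of V.\<close>
  define c where "c = 2 - 2 * V $$ (0, 0)"
  have WW: "transpose_mat W * W = c \<cdot>\<^sub>m 1\<^sub>m 1"
    unfolding W_def using dims by (simp add: mat_algebra EE VE EV V(2)) (rule eq_matI, auto simp: c_def)
  have WE: "transpose_mat W * E = (- c / 2) \<cdot>\<^sub>m 1\<^sub>m 1"
    unfolding W_def using dims by (simp add: mat_algebra EE VE) (rule eq_matI, auto simp: c_def field_simps)
  show thesis
  proof (cases "c = 0")
    case True
    then have "W = 0\<^sub>m n 1" using WW by (intro mat_trace_square_eq_0[OF _ W]) (simp add: mat_trace_simps)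
    have "V = E"
    proof (rule eq_matI)
      fix i j assume "i < dim_row E" "j < dim_col E"
      then show "V $$ (i, j) = E $$ (i, j)"
        using arg_cong[OF \<open>W = 0\<^sub>m n 1\<close>, of "\<lambda>M. M $$ (i, j)"] dims by (simp add: W_def)
    qed (use dims in auto)
    then show thesis using that[of "1\<^sub>m n"] E by (simp add: E_def)
  next
    case False
    define Q where "Q = 1\<^sub>m n - (2 / c) \<cdot>\<^sub>m (W * transpose_mat W)"
    have Q: "Q \<in> carrier_mat n n" using W by (auto simp: Q_def)
    have "transpose_mat Q * Q = 1\<^sub>m n"
      unfolding Q_def using dims
      by (simp add: mat_algebra mult_left_eq[OF WW]) (rule eq_matI, use False in \<open>auto simp: field_simps\<close>)
    moreover have "Q * E = V"
      unfolding Q_def using dims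
      by (simp add: mat_algebra WE)
         (rule eq_matI, use False in \<open>auto simp: W_def diff_divide_distrib\<close>)
    ultimately show thesis using that Q unfolding E_def by blast
  qed
qed

text \<open>Deflation: in an orthonormal basis that starts with an eigenvector, the first column of
  the matrix is a multiple of the first unit vector, by symmetry so is the first row, and the
  remaining block is symmetric of smaller size.\<close>

theorem symmetric_spectral:
  fixes A :: "real mat"
  assumes "A \<in> carrier_mat n n" "transpose_mat A = A"
  shows "\<exists>Q d. Q \<in> carrier_mat n n \<and> transpose_mat Q * Q = 1\<^sub>m n \<and> Q * transpose_mat Q = 1\<^sub>m n \<and>
    A = Q * mat_diag n d * transpose_mat Q"
  using assms
proof (induction n arbitrary: A)
  case 0
  then show ?case by (intro exI[of _ "1\<^sub>m 0"] exI[of _ "\<lambda>_. 0"]) auto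
next
  case (Suc m)
  let ?n = "Suc m"
  let ?E = "mat ?n 1 (\<lambda>(i, j). if i = 0 then 1 else 0) :: real mat"
  obtain l V where V: "V \<in> carrier_mat ?n 1" "transpose_mat V * V = 1\<^sub>m 1" "A * V = l \<cdot>\<^sub>m V"
    using symmetric_real_eigenvector[OF Suc.prems] by blast
  obtain Q where Q: "Q \<in> carrier_mat ?n ?n" "transpose_mat Q * Q = 1\<^sub>m ?n" "Q * ?E = V"
    using orthogonal_extension[OF V(1,2)] by blast
  have QQ: "Q * transpose_mat Q = 1\<^sub>m ?n"
    using mat_mult_left_right_inverse[OF _ Q(1) Q(2)] Q(1) by auto
  note dims = carrier_matD[OF Suc.prems(1)] carrier_matD[OF V(1)] carrier_matD[OF Q(1)]
  define B where "B = transpose_mat Q * A * Q"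
  have B: "B \<in> carrier_mat ?n ?n" using Q Suc.prems by (auto simp: B_def)
  have Bsym: "transpose_mat B = B" unfolding B_def using dims Suc.prems(2) by (simp add: mat_algebra)
  have "B * ?E = l \<cdot>\<^sub>m ?E"
    unfolding B_def using dims Q(3)[symmetric] V(3) Q(2) by (simp add: mat_algebra mult_left_eq[OF Q(2)])
  then have B0: "B $$ (i, 0) = (if i = 0 then l else 0)" if "i < ?n" for i
  proof -
    have "(B * ?E) $$ (i, 0) = B $$ (i, 0)"
      using that B by (simp add: mat_mult_index if_distrib sum.lessThan_Suc_shift cong: if_cong del: index_mult_mat(1) sum.lessThan_Suc)
    then show ?thesis using \<open>B * ?E = l \<cdot>\<^sub>m ?E\<close> that by (cases "i = 0") auto
  qed
  have B0': "B $$ (0, i) = (if i = 0 then l else 0)" if "i < ?n" for i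
    using B0[OF that] arg_cong[OF Bsym, of "\<lambda>M. M $$ (i, 0)"] that B by simp
  define A' where "A' = mat m m (\<lambda>(i, j). B $$ (Suc i, Suc j))"
  have A': "A' \<in> carrier_mat m m" by (simp add: A'_def)
  have "transpose_mat A' = A'"
  proof (rule eq_matI)
    fix i j assume "i < dim_row A'" "j < dim_col A'"
    then show "transpose_mat A' $$ (i, j) = A' $$ (i, j)"
      using arg_cong[OF Bsym, of "\<lambda>M. M $$ (Suc i, Suc j)"] B by (simp add: A'_def)
  qed (auto simp: A'_def)
  then obtain Q' d where Q': "Q' \<in> carrier_mat m m" "transpose_mat Q' * Q' = 1\<^sub>m m"
    "Q' * transpose_mat Q' = 1\<^sub>m m" "A' = Q' * mat_diag m d * transpose_mat Q'"
    using Suc.IH[OF A'] by blast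
  define F where "F = four_block_mat (1\<^sub>m 1) (0\<^sub>m 1 m) (0\<^sub>m m 1) Q'"
  have F: "F \<in> carrier_mat ?n ?n" using Q' four_block_carrier_mat[of "1\<^sub>m 1" 1 1 Q' m m] by (simp add: F_def)
  have Ft: "transpose_mat F = four_block_mat (1\<^sub>m 1) (0\<^sub>m 1 m) (0\<^sub>m m 1) (transpose_mat Q')"
    unfolding F_def using Q' by (subst transpose_four_block_mat[of _ 1 1 _ m _ m]) auto
  have FF: "transpose_mat F * F = 1\<^sub>m ?n"
    unfolding Ft unfolding F_def using Q'
    by (subst mult_four_block_mat[of _ 1 1 _ m _ m _ _ 1 _ m])
       (auto simp: four_block_one_mat[of 1 m, simplified])
  have FF': "F * transpose_mat F = 1\<^sub>m ?n"
    using mat_mult_left_right_inverse[OF _ F FF] F by auto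
  let ?d = "\<lambda>i. case i of 0 \<Rightarrow> l | Suc j \<Rightarrow> d j"
  have D: "mat_diag ?n ?d = four_block_mat (l \<cdot>\<^sub>m 1\<^sub>m 1) (0\<^sub>m 1 m) (0\<^sub>m m 1) (mat_diag m d)"
    by (rule eq_matI) (auto simp: mat_diag_def split: nat.split)
  have "F * mat_diag ?n ?d * transpose_mat F = four_block_mat (l \<cdot>\<^sub>m 1\<^sub>m 1) (0\<^sub>m 1 m) (0\<^sub>m m 1) A'"
    unfolding Ft D Q'(4) unfolding F_def
    using Q'(1) mat_diag_dim[of m d] carrier_matD[OF mat_diag_dim[of m d]]
    by (simp add: mat_algebra mult_four_block_mat[where ?nr1.0 = 1 and ?n1.0 = 1 and ?n2.0 = m and ?nr2.0 = m and ?nc1.0 = 1 and ?nc2.0 = m])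
  also have "\<dots> = B"
    using B A' B0 B0' by (intro eq_matI) (auto simp: A'_def)
  finally have Beq: "B = F * mat_diag ?n ?d * transpose_mat F" ..
  have "A = Q * B * transpose_mat Q"
    unfolding B_def using dims by (simp add: mat_algebra QQ mult_left_eq[OF QQ])
  then have 1: "A = (Q * F) * mat_diag ?n ?d * transpose_mat (Q * F)"
    unfolding Beq using dims carrier_matD[OF F] carrier_matD[OF mat_diag_dim[of ?n ?d]] by (simp add: mat_algebra)
  have 2: "transpose_mat (Q * F) * (Q * F) = 1\<^sub>m ?n"
    using dims carrier_matD[OF F] by (simp add: mat_algebra mult_left_eq[OF Q(2)] FF)
  have 3: "(Q * F) * transpose_mat (Q * F) = 1\<^sub>m ?n"
    using dims carrier_matD[OF F] by (simp add: mat_algebra mult_left_eq[OF FF'] QQ)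
  show ?case using 1 2 3 Q(1) F by (intro exI[of _ "Q * F"] exI[of _ ?d] conjI) auto
qed

section \<open>Frames and projectors\<close>

lemma stiefelD:
  assumes "U \<in> stiefel n q"
  shows "U \<in> carrier_mat n q" "dim_row U = n" "dim_col U = q" "transpose_mat U * U = 1\<^sub>m q"
  using assms by (auto simp: stiefel_def)

text \<open>A left inverse makes Y injective, so its rank is k; and
  \<open>Y * transpose_mat Y\<close> has the same column space as Y because it fixes every vector Y
  x.\<close>

lemma rank_frame_projector:
  assumes Y: "Y \<in> stiefel n k"
  shows "vec_space.rank n (Y * transpose_mat Y) = k"
proof -
  interpret vec_space "TYPE(real)" n .
  note Yd = stiefelD[OF Y]
  have inj: "v = 0\<^sub>v k" if "v \<in> carrier_vec k" "Y *\<^sub>v v = 0\<^sub>v n" for v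
  proof -
    have "v = (transpose_mat Y * Y) *\<^sub>v v" using that by (simp add: Yd(4))
    also have "\<dots> = transpose_mat Y *\<^sub>v 0\<^sub>v n"
      using that Yd by (subst assoc_mult_mat_vec[of _ k n _ k]) auto
    finally show ?thesis using Yd by (auto simp: scalar_prod_def)
  qed
  \<comment> \<open>Independence is stated for the set of columns, which would silently merge equal
    ones. Equal columns i and j would give the identity matrix a 1 off the diagonal.\<close>
  have dist: "distinct (cols Y)"
  proof (rule ccontr)
    assume "\<not> distinct (cols Y)"
    then obtain i j where ij: "i < k" "j < k" "i \<noteq> j" "col Y i = col Y j"
      using Yd unfolding distinct_conv_nth by auto
    have "(transpose_mat Y * Y) $$ (i, j) = (transpose_mat Y * Y) $$ (i, i)" using ij Yd(2,3) by simp
    then show False using ij by (simp add: Yd(4))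
  qed
  have "lin_indpt (set (cols Y))"
    using lin_depE[OF Yd(1) _ dist] inj by blast
  then have rY: "rank Y = k" using lin_indpt_full_rank[OF Yd(1) dist] by blast
  have YY: "Y * transpose_mat Y \<in> carrier_mat n n" using Yd by auto
  have 1: "\<exists>x'\<in>carrier_vec k. Y *\<^sub>v x' = (Y * transpose_mat Y) *\<^sub>v x" if "x \<in> carrier_vec n" for x
    using that Yd(1) by (intro bexI[of _ "transpose_mat Y *\<^sub>v x"]) auto
  have 2: "\<exists>x'\<in>carrier_vec n. (Y * transpose_mat Y) *\<^sub>v x' = Y *\<^sub>v x" if x: "x \<in> carrier_vec k" for x
  proof (intro bexI[of _ "Y *\<^sub>v x"])
    have "(Y * transpose_mat Y) *\<^sub>v (Y *\<^sub>v x) = Y *\<^sub>v ((transpose_mat Y * Y) *\<^sub>v x)"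
      using x Yd(1)
      by (simp add: assoc_mult_mat_vec[of _ n k _ n] assoc_mult_mat_vec[of _ k n _ k])
    then show "(Y * transpose_mat Y) *\<^sub>v (Y *\<^sub>v x) = Y *\<^sub>v x" using x by (simp add: Yd(4))
  qed (use x Yd in auto)
  have "col_space (Y * transpose_mat Y) = col_space Y"
    unfolding col_space_eq[OF Yd(1)] col_space_eq[OF YY] using Yd(2,3) 1 2 by (auto; metis)
  then show ?thesis using rY unfolding rank_def col_space_def by simp
qed

lemma frame_projector_in_grassmann:
  assumes "Y \<in> stiefel n k"
  shows "Y * transpose_mat Y \<in> grassmann n k"
  using stiefelD[OF assms] rank_frame_projector[OF assms]
  by (auto simp: grassmann_def mat_algebra mult_left_eq[OF stiefelD(4)[OF assms]])

text \<open>Idempotence makes every eigenvalue 0 or 1; the eigenvectors for 1 form the frame. Their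
  number k equals q since both are the rank of P.\<close>

lemma grassmann_frame:
  assumes P: "P \<in> grassmann n q"
  obtains Y where "Y \<in> stiefel n q" "P = Y * transpose_mat Y"
proof -
  have Pd: "P \<in> carrier_mat n n" "transpose_mat P = P" "P * P = P" using P by (auto simp: grassmann_def)
  obtain Q d where Q: "Q \<in> carrier_mat n n" "transpose_mat Q * Q = 1\<^sub>m n" "Q * transpose_mat Q = 1\<^sub>m n"
    "P = Q * mat_diag n d * transpose_mat Q" using symmetric_spectral[OF Pd(1,2)] by blast
  note dims = carrier_matD[OF Q(1)] carrier_matD[OF Pd(1)]
  have "mat_diag n (\<lambda>i. d i * d i) = transpose_mat Q * (P * P) * Q"
    unfolding Q(4) using dims by (simp add: mat_algebra mult_left_eq[OF Q(2)] Q(2) flip: mat_diag_diag)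
  also have "\<dots> = mat_diag n d"
    unfolding Pd(3) unfolding Q(4) using dims by (simp add: mat_algebra mult_left_eq[OF Q(2)] Q(2))
  finally have dd: "mat_diag n (\<lambda>i. d i * d i) = mat_diag n d" .
  have "d i * d i = d i" if "i < n" for i
    using arg_cong[OF dd, of "\<lambda>M. M $$ (i, i)"] that by (simp add: mat_diag_def)
  then have d: "d i = 0 \<or> d i = 1" if "i < n" for i using that by fastforce
  define js where "js = filter (\<lambda>i. d i = 1) [0..<n]"
  define k where "k = length js"
  have js: "js ! b < n" "d (js ! b) = 1" if "b < k" for b
    using nth_mem[of b js] that by (auto simp: k_def js_def)
  have jsd: "distinct js" by (simp add: js_def)
  define Y where "Y = mat n k (\<lambda>(a, b). Q $$ (a, js ! b))"
  have Y: "Y \<in> carrier_mat n k" by (simp add: Y_def)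
  have "transpose_mat Y * Y = 1\<^sub>m k"
  proof (rule eq_matI)
    fix b c assume "b < dim_row (1\<^sub>m k :: real mat)" "c < dim_col (1\<^sub>m k :: real mat)"
    then have bc: "b < k" "c < k" by auto
    have "(transpose_mat Y * Y) $$ (b, c) = (transpose_mat Q * Q) $$ (js ! b, js ! c)"
      using bc js dims by (simp add: mat_mult_index Y_def del: index_mult_mat(1))
    then show "(transpose_mat Y * Y) $$ (b, c) = 1\<^sub>m k $$ (b, c)"
      using bc js jsd by (simp add: Q(2) nth_eq_iff_index_eq k_def)
  qed (use Y in auto)
  then have YS: "Y \<in> stiefel n k" using Y by (simp add: stiefel_def)
  have "P = Y * transpose_mat Y"
  proof (rule eq_matI)
    fix a b assume "a < dim_row (Y * transpose_mat Y)" "b < dim_col (Y * transpose_mat Y)"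
    then have ab: "a < n" "b < n" using Y by auto
    have "(Y * transpose_mat Y) $$ (a, b) = (\<Sum>c<k. Q $$ (a, js ! c) * Q $$ (b, js ! c))"
      using ab by (simp add: mat_mult_index Y_def del: index_mult_mat(1))
    also have "\<dots> = (\<Sum>i\<in>set js. Q $$ (a, i) * Q $$ (b, i))"
      using bij_betw_nth[OF jsd, of "{..<k}" "set js"] unfolding k_def
      by (intro sum.reindex_bij_betw[of _ _ _ "\<lambda>i. Q $$ (a, i) * Q $$ (b, i)"]) auto
    also have "\<dots> = (\<Sum>i<n. Q $$ (a, i) * d i * Q $$ (b, i))"
      by (rule sum.mono_neutral_cong_left) (use d in \<open>auto simp: js_def\<close>)
    also have "\<dots> = P $$ (a, b)"
      unfolding Q(4) mat_diag_mult_right[OF Q(1)] using ab dims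
      by (simp add: mat_mult_index del: index_mult_mat(1))
    finally show "P $$ (a, b) = (Y * transpose_mat Y) $$ (a, b)" by simp
  qed (use Y dims in auto)
  moreover have "k = q" using P rank_frame_projector[OF YS] calculation by (simp add: grassmann_def)
  ultimately show thesis using that YS by blast
qed

text \<open>Unlike the rank, the trace depends continuously on the entries; this is what fixes the
  type of a continuous family of flags.\<close>

lemma grassmann_trace: "P \<in> grassmann n q \<Longrightarrow> mat_trace P = q"
  by (metis grassmann_frame index_transpose_mat(2,3) mat_trace_comm mat_trace_one stiefelD(4))

section \<open>Polynomial approximation of the squared arc sine\<close>

text \<open>The coefficients of the power series \<open>(arcsin (sqrt x))\<^sup>2 = \<Sum>k. arcsin_sq_coeff k * x ^ (k + 1)\<close>;
  the recursion is the differential equation \<open>2 x (1 - x) y'' + (1 - 2 x) y' = 1\<close>.\<close>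

primrec arcsin_sq_coeff :: "nat \<Rightarrow> real" where
  "arcsin_sq_coeff 0 = 1"
| "arcsin_sq_coeff (Suc k) = 2 * (real k + 1)\<^sup>2 / ((real k + 2) * (2 * real k + 3)) * arcsin_sq_coeff k"

definition arcsin_sq_poly :: "nat \<Rightarrow> real poly" where
  "arcsin_sq_poly N = (\<Sum>k\<le>N. monom (arcsin_sq_coeff k) (Suc k))"

text \<open>The bound by 1 is crude but enough: in the Taylor remainder below, the coefficient is
  multiplied by a high power of a sine less than 1.\<close>

lemma arcsin_sq_coeff_bounds: "0 < arcsin_sq_coeff k" "arcsin_sq_coeff k \<le> 1"
proof -
  show pos: "0 < arcsin_sq_coeff k" for k
    by (induction k) (auto intro!: mult_pos_pos divide_pos_pos)
  show "arcsin_sq_coeff k \<le> 1"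
  proof (induction k)
    case (Suc k)
    have "2 * (real k + 1)\<^sup>2 \<le> (real k + 2) * (2 * real k + 3)"
      by (simp add: power2_eq_square algebra_simps)
    then have "2 * (real k + 1)\<^sup>2 / ((real k + 2) * (2 * real k + 3)) \<le> 1"
      by (subst divide_le_eq_1_pos) auto
    then show ?case using Suc pos[of k] by (simp only: arcsin_sq_coeff.simps) (intro mult_le_one, auto)
  qed simp
qed

text \<open>The operator 2 x (1 - x) y'' + (1 - 2 x) y' sends a monomial to two neighbouring
  monomials, which makes the sum in the next lemma telescope.\<close>

lemma monom_ode:
  "(monom 2 1 - monom 2 2) * pderiv (pderiv (monom c (Suc (Suc N)))) + (1 - monom 2 1) * pderiv (monom c (Suc (Suc N)))
     = monom (c * (real N + 2) * (2 * real N + 3)) (Suc N) - monom (2 * (real N + 2)\<^sup>2 * c) (Suc (Suc N))"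
  by (simp add: pderiv_monom ring_distribs mult_monom)
     (rule poly_eqI, simp add: algebra_simps power2_eq_square)

text \<open>The recursion of the coefficients says that the lower term of each new monomial cancels
  the defect left by the previous partial sum; only the last defect survives.\<close>

lemma arcsin_sq_poly_ode:
  "(monom 2 1 - monom 2 2) * pderiv (pderiv (arcsin_sq_poly N)) + (1 - monom 2 1) * pderiv (arcsin_sq_poly N) =
     1 - monom (2 * (real N + 1)\<^sup>2 * arcsin_sq_coeff N) (Suc N)"
proof (induction N)
  case 0
  show ?case by (simp add: arcsin_sq_poly_def pderiv_monom algebra_simps mult_monom flip: monom_0 one_poly_eq_simps(1))
next
  case (Suc N)
  let ?c = "arcsin_sq_coeff (Suc N)"
  have eq: "(monom 2 1 - monom 2 2) * pderiv (pderiv (monom ?c (Suc (Suc N)))) + (1 - monom 2 1) * pderiv (monom ?c (Suc (Suc N)))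
     = monom (?c * (real N + 2) * (2 * real N + 3)) (Suc N) - monom (2 * (real N + 2)\<^sup>2 * ?c) (Suc (Suc N))"
    by (rule monom_ode)
  have p: "arcsin_sq_poly (Suc N) = arcsin_sq_poly N + monom ?c (Suc (Suc N))" by (simp add: arcsin_sq_poly_def)
  have c: "?c * (real N + 2) * (2 * real N + 3) = 2 * (real N + 1)\<^sup>2 * arcsin_sq_coeff N"
  proof -
    have "x / (e * f) * a * e * f = x * a" if "e \<noteq> 0" "f \<noteq> 0" for x e f a :: real
      using that by simp
    from this[of "real N + 2" "2 * real N + 3"] show ?thesis by simp
  qed
  have split: "K * pderiv (pderiv (q + m)) + L * pderiv (q + m) =
      (K * pderiv (pderiv q) + L * pderiv q) + (K * pderiv (pderiv m) + L * pderiv m)" for K L q m :: "real poly"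
    by (simp add: pderiv_add algebra_simps)
  show ?case unfolding p split Suc eq c by (simp add: add.commute del: arcsin_sq_coeff.simps)
qed

lemma arcsin_sq_poly_0: "poly (arcsin_sq_poly N) 0 = 0"
  by (simp add: arcsin_sq_poly_def poly_sum poly_monom)

lemma arcsin_sq_poly_coeff_nonneg: "0 \<le> coeff (arcsin_sq_poly N) k"
  by (auto simp: arcsin_sq_poly_def coeff_sum intro!: sum_nonneg less_imp_le[OF arcsin_sq_coeff_bounds(1)])

text \<open>The derivative of this polynomial is \<open>p' * (1 - 2 X (1 - X) p'' - (1 - 2 X) p')\<close>, and the second
  factor is a monomial with a positive coefficient.\<close>

lemma arcsin_sq_poly_excess_coeff_nonneg:
  fixes N :: nat
  defines "p \<equiv> arcsin_sq_poly N"
  shows "0 \<le> coeff (p - (pderiv p)\<^sup>2 * (monom 1 1 - monom 1 2)) k"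
proof -
  let ?E = "p - (pderiv p)\<^sup>2 * (monom 1 1 - monom 1 2)"
  let ?c = "2 * (real N + 1)\<^sup>2 * arcsin_sq_coeff N"
  have "pderiv ?E = pderiv p * (1 - ((monom 2 1 - monom 2 2) * pderiv (pderiv p) + (1 - monom 2 1) * pderiv p))"
  proof -
    have 2: "monom 2 1 = 2 * monom (1::real) 1" "monom 2 2 = 2 * monom (1::real) 2"
      by (simp_all add: numeral_poly smult_monom)
    have 1: "pderiv (monom 1 1 - monom 1 2) = (1 - monom (2::real) 1)"
      by (simp add: pderiv_diff pderiv_monom monom_0 one_pCons)
    have 3: "pderiv (p - q\<^sup>2 * m) = pderiv p - (2 * q * pderiv q * m + q\<^sup>2 * pderiv m)" for q m :: "real poly"
      by (simp add: pderiv_diff pderiv_mult power2_eq_square)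
    show ?thesis unfolding 3 1 unfolding 2 by (simp add: power2_eq_square algebra_simps)
  qed
  also have "\<dots> = pderiv p * monom ?c (Suc N)" unfolding p_def arcsin_sq_poly_ode by simp
  finally have E: "pderiv ?E = monom ?c (Suc N) * pderiv p" by (simp add: mult.commute)
  show ?thesis
  \<comment> \<open>The derivative determines every coefficient but the constant one, which vanishes
    because p has no constant term.\<close>
  proof (cases k)
    case 0
    have "coeff ?E 0 = poly ?E 0" by (rule poly_0_coeff_0[symmetric])
    also have "\<dots> = 0" by (simp add: p_def arcsin_sq_poly_0 poly_monom)
    finally show ?thesis using 0 by simp
  next
    case (Suc j)
    have "0 \<le> coeff (pderiv ?E) j"
      unfolding E using arcsin_sq_coeff_bounds(1)[of N] arcsin_sq_poly_coeff_nonneg[of N]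
      by (auto simp: coeff_monom_mult coeff_pderiv p_def intro!: mult_nonneg_nonneg)
    then show ?thesis by (simp add: coeff_pderiv Suc zero_le_mult_iff)
  qed
qed

text \<open>In the variable t with x = sin^2 t the operator of the differential equation is half the
  second derivative. The difference \<open>f0\<close> between t^2 and the partial sum therefore has
  the single power \<open>f2\<close> as its second derivative, and Taylor's formula of order 2 at 0
  bounds it by a multiple of (N + 1)^2 (sin t)^(2 N + 2), which tends to 0 because sin t <
  1.\<close>

lemma arcsin_sq_poly_tendsto:
  assumes t: "0 \<le> t" "t < pi / 2"
  shows "(\<lambda>N. poly (arcsin_sq_poly N) ((sin t)\<^sup>2)) \<longlonglongrightarrow> t\<^sup>2"
proof -
  have s: "0 \<le> sin t" "sin t < 1"
    using t sin_monotone_2pi[of t "pi / 2"] by (auto intro: sin_ge_zero)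
  have bound: "\<bar>t\<^sup>2 - poly (arcsin_sq_poly N) ((sin t)\<^sup>2)\<bar> \<le> 2 * t\<^sup>2 * (real (Suc N) * sin t ^ Suc N)\<^sup>2" for N
  proof (cases "t = 0")
    case False
    define p where "p = arcsin_sq_poly N"
    define f0 where "f0 = (\<lambda>x. x\<^sup>2 - poly p ((sin x)\<^sup>2))"
    define f1 where "f1 = (\<lambda>x. 2 * x - poly (pderiv p) ((sin x)\<^sup>2) * (2 * sin x * cos x))"
    define f2 where "f2 = (\<lambda>x. 4 * (real N + 1)\<^sup>2 * arcsin_sq_coeff N * ((sin x)\<^sup>2) ^ Suc N)"
    have d0: "(f0 has_real_derivative f1 x) (at x)" for x
      unfolding f0_def f1_def by (auto intro!: derivative_eq_intros DERIV_chain2[OF poly_DERIV] simp: power2_eq_square)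
    have d1: "(f1 has_real_derivative f2 x) (at x)" for x
    proof -
      let ?m = "(sin x)\<^sup>2"
      have ode: "(2 * ?m - 2 * ?m\<^sup>2) * poly (pderiv (pderiv p)) ?m + (1 - 2 * ?m) * poly (pderiv p) ?m =
          1 - 2 * (real N + 1)\<^sup>2 * arcsin_sq_coeff N * ?m ^ Suc N"
        using arg_cong[OF arcsin_sq_poly_ode, of "\<lambda>q. poly q ?m" N] unfolding p_def
        by (simp add: poly_monom)
      have d: "(f1 has_real_derivative 2 - (poly (pderiv (pderiv p)) ?m * (2 * sin x * cos x) * (2 * sin x * cos x)
          + poly (pderiv p) ?m * (2 * (cos x)\<^sup>2 - 2 * ?m))) (at x)"
        unfolding f1_def by (auto intro!: derivative_eq_intros DERIV_chain2[OF poly_DERIV] simp: power2_eq_square algebra_simps)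
      have e1: "2 - (poly (pderiv (pderiv p)) ?m * (2 * sin x * cos x) * (2 * sin x * cos x)
          + poly (pderiv p) ?m * (2 * (cos x)\<^sup>2 - 2 * ?m)) =
          2 - 2 * ((2 * ?m - 2 * ?m\<^sup>2) * poly (pderiv (pderiv p)) ?m + (1 - 2 * ?m) * poly (pderiv p) ?m)"
      proof -
        have "2 * sin x * cos x * (2 * sin x * cos x) = 4 * ?m * (cos x)\<^sup>2" by (simp add: power2_eq_square)
        then have "poly (pderiv (pderiv p)) ?m * (2 * sin x * cos x) * (2 * sin x * cos x) =
          poly (pderiv (pderiv p)) ?m * (4 * ?m * (1 - ?m))" by (simp add: cos_squared_eq mult.assoc)
        then show ?thesis unfolding cos_squared_eq by (simp add: algebra_simps power2_eq_square)
      qed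
      have e2: "2 - 2 * ((2 * ?m - 2 * ?m\<^sup>2) * poly (pderiv (pderiv p)) ?m + (1 - 2 * ?m) * poly (pderiv p) ?m) = f2 x"
        unfolding ode f2_def by (simp add: algebra_simps del: power_Suc)
      show ?thesis using d unfolding e1 e2 .
    qed
    \<comment> \<open>The Taylor formula takes a sequence of derivatives; at order 2 it looks at the
      indices 0, 1 and 2.\<close>
    define diff where "diff = (\<lambda>m::nat. if m = 0 then f0 else if m = 1 then f1 else f2)"
    obtain x where x: "0 < x" "x < t" "f0 t = (\<Sum>m<2. diff m 0 / fact m * t ^ m) + diff 2 x / fact 2 * t ^ 2"
    proof -
      have "\<forall>m x. m < 2 \<and> 0 \<le> x \<and> x \<le> t \<longrightarrow> (diff m has_real_derivative diff (Suc m) x) (at x)"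
        using d0 d1 by (simp add: diff_def less_2_cases_iff)
      then have "\<exists>x>0. x < t \<and> f0 t = (\<Sum>m<2. diff m 0 / fact m * t ^ m) + diff 2 x / fact 2 * t ^ 2"
        using t False by (intro Maclaurin) (auto simp: diff_def)
      then show thesis using that by blast
    qed
    have "f0 t = f2 x / 2 * t\<^sup>2"
    proof -
      have "{..<2::nat} = {0, 1}" by auto
      moreover have "f0 0 = 0" "f1 0 = 0" by (simp_all add: f0_def f1_def p_def arcsin_sq_poly_0)
      ultimately show ?thesis using x(3) by (simp add: diff_def)
    qed
    also have "\<dots> = 2 * t\<^sup>2 * ((real (Suc N) * sin x ^ Suc N)\<^sup>2 * arcsin_sq_coeff N)"
    proof -
      have "((sin x)\<^sup>2) ^ Suc N = (sin x ^ Suc N)\<^sup>2" by (simp only: mult.commute flip: power_mult)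
      then show ?thesis unfolding f2_def by (simp only: power_mult_distrib of_nat_Suc mult_ac add.commute[of 1]) simp
    qed
    finally have f: "f0 t = 2 * t\<^sup>2 * ((real (Suc N) * sin x ^ Suc N)\<^sup>2 * arcsin_sq_coeff N)" .
    have sx: "0 \<le> sin x" "sin x \<le> sin t"
      using x t by (auto intro!: sin_ge_zero sin_monotone_2pi_le)
    have "0 \<le> f0 t" unfolding f using arcsin_sq_coeff_bounds(1)[of N] by simp
    moreover have "f0 t \<le> 2 * t\<^sup>2 * ((real (Suc N) * sin t ^ Suc N)\<^sup>2 * 1)"
      unfolding f using sx arcsin_sq_coeff_bounds[of N]
      by (intro mult_left_mono mult_mono power_mono) auto
    ultimately show ?thesis by (simp add: f0_def p_def)
  qed (simp add: arcsin_sq_poly_0)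
  have "(\<lambda>N. real (Suc N) * sin t ^ Suc N) \<longlonglongrightarrow> 0"
    by (rule LIMSEQ_Suc[of "\<lambda>N. real N * sin t ^ N"], rule powser_times_n_limit_0) (use s in simp)
  then have "(\<lambda>N. 2 * t\<^sup>2 * (real (Suc N) * sin t ^ Suc N)\<^sup>2) \<longlonglongrightarrow> 2 * t\<^sup>2 * 0\<^sup>2"
    by (intro tendsto_intros)
  moreover have z: "2 * t\<^sup>2 * (0::real)\<^sup>2 = 0" by simp
  ultimately have lim: "(\<lambda>N. 2 * t\<^sup>2 * (real (Suc N) * sin t ^ Suc N)\<^sup>2) \<longlonglongrightarrow> 0"
    using z by (simp only:)
  have "(\<lambda>N. t\<^sup>2 - poly (arcsin_sq_poly N) ((sin t)\<^sup>2)) \<longlonglongrightarrow> 0"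
    by (rule Lim_null_comparison[OF _ lim]) (use bound in \<open>simp only: real_norm_def eventually_True\<close>)
  from tendsto_diff[OF tendsto_const[of "t\<^sup>2"] this] show ?thesis by simp
qed

section \<open>Calculus of matrix curves\<close>

text \<open>Entry formulas for products and sums hold where the dimensions of the operands are
  known, that is on S. Derivatives are therefore transferred between functions that agree on
  S.\<close>

lemma has_real_derivative_transform_on:
  fixes f g :: "real \<Rightarrow> real"
  assumes "(f has_real_derivative D) (at t within S)" "t \<in> S" "\<And>s. s \<in> S \<Longrightarrow> f s = g s"
  shows "(g has_real_derivative D) (at t within S)"
  by (rule has_field_derivative_transform_within[OF assms(1) _ assms(2), of 1]) (use assms(3) in auto)

lemma has_mat_derivative_carrier: "has_mat_derivative a b f F G \<Longrightarrow> F \<in> carrier_mat a b"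
  by (simp add: has_mat_derivative_def)

lemma has_mat_derivative_within_subset:
  "has_mat_derivative a b f F (at t within S) \<Longrightarrow> T \<subseteq> S \<Longrightarrow> has_mat_derivative a b f F (at t within T)"
  unfolding has_mat_derivative_def by (auto intro: DERIV_subset[where s = S and t = T])

lemma has_mat_derivative_const: "A \<in> carrier_mat a b \<Longrightarrow> has_mat_derivative a b (\<lambda>_. A) (0\<^sub>m a b) F"
  by (simp add: has_mat_derivative_def)

lemma has_mat_derivative_mult:
  assumes f: "has_mat_derivative a b f F (at t within S)" and g: "has_mat_derivative b c g G (at t within S)"
    and fc: "\<And>s. s \<in> S \<Longrightarrow> f s \<in> carrier_mat a b" and gc: "\<And>s. s \<in> S \<Longrightarrow> g s \<in> carrier_mat b c" and t: "t \<in> S"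
  shows "has_mat_derivative a c (\<lambda>s. f s * g s) (F * g t + f t * G) (at t within S)"
proof -
  have FG: "F \<in> carrier_mat a b" "G \<in> carrier_mat b c" using f g by (auto simp: has_mat_derivative_def)
  have "((\<lambda>s. (f s * g s) $$ (i, j)) has_real_derivative (F * g t + f t * G) $$ (i, j)) (at t within S)"
    if ij: "i < a" "j < c" for i j
  proof (rule has_real_derivative_transform_on[OF _ t])
    have "((\<lambda>s. \<Sum>k<b. f s $$ (i, k) * g s $$ (k, j)) has_real_derivative
        (\<Sum>k<b. F $$ (i, k) * g t $$ (k, j) + G $$ (k, j) * f t $$ (i, k))) (at t within S)"
      using f g ij by (intro DERIV_sum DERIV_mult) (auto simp: has_mat_derivative_def)
    then show "((\<lambda>s. \<Sum>k<b. f s $$ (i, k) * g s $$ (k, j)) has_real_derivative (F * g t + f t * G) $$ (i, j)) (at t within S)"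
      using FG fc[OF t] gc[OF t] ij
      by (simp add: mat_mult_index sum.distrib mult.commute del: index_mult_mat(1))
    show "(\<Sum>k<b. f s $$ (i, k) * g s $$ (k, j)) = (f s * g s) $$ (i, j)" if "s \<in> S" for s
      using fc[OF that] gc[OF that] ij by (simp add: mat_mult_index del: index_mult_mat(1))
  qed
  then show ?thesis using FG fc[OF t] gc[OF t] by (simp add: has_mat_derivative_def)
qed

lemma has_mat_derivative_transpose:
  assumes f: "has_mat_derivative a b f F (at t within S)"
    and fc: "\<And>s. s \<in> S \<Longrightarrow> f s \<in> carrier_mat a b" and t: "t \<in> S"
  shows "has_mat_derivative b a (\<lambda>s. transpose_mat (f s)) (transpose_mat F) (at t within S)"
proof -
  have FG: "F \<in> carrier_mat a b" using f by (auto simp: has_mat_derivative_def)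
  have "((\<lambda>s. transpose_mat (f s) $$ (i, j)) has_real_derivative transpose_mat F $$ (i, j)) (at t within S)"
    if ij: "i < b" "j < a" for i j
  proof (rule has_real_derivative_transform_on[OF _ t])
    show "((\<lambda>s. f s $$ (j, i)) has_real_derivative transpose_mat F $$ (i, j)) (at t within S)"
      using f FG ij by (auto simp: has_mat_derivative_def)
    show "f s $$ (j, i) = transpose_mat (f s) $$ (i, j)" if "s \<in> S" for s
      using fc[OF that] ij by simp
  qed
  then show ?thesis using FG by (simp add: has_mat_derivative_def)
qed

lemma has_mat_derivative_add:
  assumes f: "has_mat_derivative a b f F (at t within S)" and g: "has_mat_derivative a b g G (at t within S)"
    and fc: "\<And>s. s \<in> S \<Longrightarrow> f s \<in> carrier_mat a b" and gc: "\<And>s. s \<in> S \<Longrightarrow> g s \<in> carrier_mat a b" and t: "t \<in> S"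
  shows "has_mat_derivative a b (\<lambda>s. f s + g s) (F + G) (at t within S)"
proof -
  have FG: "F \<in> carrier_mat a b" "G \<in> carrier_mat a b" using f g by (auto simp: has_mat_derivative_def)
  have "((\<lambda>s. (f s + g s) $$ (i, j)) has_real_derivative (F + G) $$ (i, j)) (at t within S)"
    if ij: "i < a" "j < b" for i j
  proof (rule has_real_derivative_transform_on[OF _ t])
    show "((\<lambda>s. f s $$ (i, j) + g s $$ (i, j)) has_real_derivative (F + G) $$ (i, j)) (at t within S)"
      using f g FG ij by (auto simp: has_mat_derivative_def intro: DERIV_add)
    show "f s $$ (i, j) + g s $$ (i, j) = (f s + g s) $$ (i, j)" if "s \<in> S" for s
      using fc[OF that] gc[OF that] ij by simp
  qed
  then show ?thesis using FG by (simp add: has_mat_derivative_def)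
qed

lemma has_mat_derivative_minus:
  assumes f: "has_mat_derivative a b f F (at t within S)" and g: "has_mat_derivative a b g G (at t within S)"
    and fc: "\<And>s. s \<in> S \<Longrightarrow> f s \<in> carrier_mat a b" and gc: "\<And>s. s \<in> S \<Longrightarrow> g s \<in> carrier_mat a b" and t: "t \<in> S"
  shows "has_mat_derivative a b (\<lambda>s. f s - g s) (F - G) (at t within S)"
proof -
  have FG: "F \<in> carrier_mat a b" "G \<in> carrier_mat a b" using f g by (auto simp: has_mat_derivative_def)
  have "((\<lambda>s. (f s - g s) $$ (i, j)) has_real_derivative (F - G) $$ (i, j)) (at t within S)"
    if ij: "i < a" "j < b" for i j
  proof (rule has_real_derivative_transform_on[OF _ t])
    show "((\<lambda>s. f s $$ (i, j) - g s $$ (i, j)) has_real_derivative (F - G) $$ (i, j)) (at t within S)"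
      using f g FG ij by (auto simp: has_mat_derivative_def intro: DERIV_diff)
    show "f s $$ (i, j) - g s $$ (i, j) = (f s - g s) $$ (i, j)" if "s \<in> S" for s
      using fc[OF that] gc[OF that] ij by simp
  qed
  then show ?thesis using FG by (auto simp: has_mat_derivative_def)
qed

lemma has_real_derivative_mat_trace:
  assumes f: "has_mat_derivative n n f F (at t within S)"
    and fc: "\<And>s. s \<in> S \<Longrightarrow> f s \<in> carrier_mat n n" and t: "t \<in> S"
  shows "((\<lambda>s. mat_trace (f s)) has_real_derivative mat_trace F) (at t within S)"
proof (rule has_real_derivative_transform_on[OF _ t])
  have "F \<in> carrier_mat n n" using f by (simp add: has_mat_derivative_def)
  then show "((\<lambda>s. \<Sum>i<n. f s $$ (i, i)) has_real_derivative mat_trace F) (at t within S)"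
    using f by (auto simp: mat_trace_def has_mat_derivative_def intro!: DERIV_sum)
  show "(\<Sum>i<n. f s $$ (i, i)) = mat_trace (f s)" if "s \<in> S" for s
    using fc[OF that] by (simp add: mat_trace_def)
qed

lemma has_mat_derivative_cong:
  assumes "has_mat_derivative a b f F (at t within S)" "\<And>s. s \<in> S \<Longrightarrow> f s = g s" "t \<in> S"
  shows "has_mat_derivative a b g F (at t within S)"
  unfolding has_mat_derivative_def
proof (intro conjI allI impI)
  show "F \<in> carrier_mat a b" using assms(1) by (rule has_mat_derivative_carrier)
  show "((\<lambda>t. g t $$ (i, j)) has_real_derivative F $$ (i, j)) (at t within S)" if "i < a" "j < b" for i j
    by (rule has_real_derivative_transform_on[OF _ assms(3), of "\<lambda>t. f t $$ (i, j)"])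
       (use assms that in \<open>auto simp: has_mat_derivative_def\<close>)
qed

lemma has_mat_derivative_unique:
  assumes "has_mat_derivative a b f F (at t within {0..1})" "has_mat_derivative a b f G (at t within {0..1})"
    "t \<in> {0..1}"
  shows "F = G"
proof (rule eq_matI)
  have FG: "F \<in> carrier_mat a b" "G \<in> carrier_mat a b" using assms by (auto simp: has_mat_derivative_def)
  fix i j assume "i < dim_row G" "j < dim_col G"
  then have ij: "i < a" "j < b" using FG by auto
  show "F $$ (i, j) = G $$ (i, j)"
    using assms ij vector_derivative_unique_within_closed_interval[of 0 1 t "\<lambda>s. f s $$ (i, j)"]
    by (auto simp: has_mat_derivative_def has_real_derivative_iff_has_vector_derivative)
qed (use assms in \<open>auto simp: has_mat_derivative_def\<close>)

lemma has_mat_derivative_zero_const: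
  assumes "\<And>t. t \<in> {0..1} \<Longrightarrow> has_mat_derivative a b f (0\<^sub>m a b) (at t within {0..1})"
    "\<And>t. t \<in> {0..1} \<Longrightarrow> f t \<in> carrier_mat a b" "t \<in> {0..1}"
  shows "f t = f 0"
proof (rule eq_matI)
  have c: "f t \<in> carrier_mat a b" "f 0 \<in> carrier_mat a b" using assms by auto
  fix i j assume "i < dim_row (f 0)" "j < dim_col (f 0)"
  then have ij: "i < a" "j < b" using c by auto
  have "((\<lambda>s. f s $$ (i, j)) has_real_derivative 0) (at t within {0..1})" if "t \<in> {0..1}" for t
    using assms(1)[OF that] ij by (simp add: has_mat_derivative_def)
  then obtain c where "\<forall>x\<in>{0..1}. f x $$ (i, j) = c"
    using has_field_derivative_zero_constant[of "{0..1}" "\<lambda>s. f s $$ (i, j)"] by auto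
  then show "f t $$ (i, j) = f 0 $$ (i, j)" using assms(3) by auto
qed (use assms(2)[of 0] assms(2)[OF assms(3)] in auto)

text \<open>The derivative of \<open>tr (X\<^sup>T X)\<close> vanishes.\<close>

lemma skew_linear_ode_zero:
  assumes X: "\<And>t. t \<in> {0..1} \<Longrightarrow> has_mat_derivative n m X (A * X t - X t * B) (at t within {0..1})"
    and Xc: "\<And>t. t \<in> {0..1} \<Longrightarrow> X t \<in> carrier_mat n m" and X0: "X 0 = 0\<^sub>m n m"
    and A: "A \<in> carrier_mat n n" "transpose_mat A = - A" and B: "B \<in> carrier_mat m m" "transpose_mat B = - B"
    and t: "t \<in> {0..1}"
  shows "X t = 0\<^sub>m n m"
proof (rule mat_trace_square_eq_0[OF _ Xc[OF t]])
  let ?f = "\<lambda>t. mat_trace (transpose_mat (X t) * X t)"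
  have "(?f has_real_derivative 0) (at s within {0..1})" if s: "s \<in> {0..1}" for s
  proof -
    let ?D = "A * X s - X s * B"
    note d = carrier_matD[OF A(1)] carrier_matD[OF B(1)] carrier_matD[OF Xc[OF s]]
    have "(?f has_real_derivative mat_trace (transpose_mat ?D * X s + transpose_mat (X s) * ?D)) (at s within {0..1})"
      by (rule has_real_derivative_mat_trace[OF has_mat_derivative_mult[OF has_mat_derivative_transpose[OF X[OF s]] X[OF s]]])
         (use Xc s in \<open>auto intro!: mult_carrier_mat[of _ m n]\<close>)
    moreover have "mat_trace (transpose_mat ?D * X s + transpose_mat (X s) * ?D) = 0"
    proof -
      have "mat_trace (B * (transpose_mat (X s) * X s)) = mat_trace (transpose_mat (X s) * (X s * B))"
        using d by (subst mat_trace_comm) (auto simp: mat_algebra)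
      then show ?thesis using d by (simp add: mat_algebra mat_trace_simps A(2) B(2))
    qed
    ultimately show ?thesis by simp
  qed
  then obtain c where "\<forall>x\<in>{0..1}. ?f x = c"
    using has_field_derivative_zero_constant[of "{0..1}" ?f] by auto
  then have "?f t = ?f 0" using t by auto
  then show "?f t = 0" by (simp add: X0 mat_trace_simps mat_algebra)
qed

section \<open>Entrywise continuously differentiable matrix curves\<close>

lemma C1_differentiable_on_sum:
  fixes f :: "'a \<Rightarrow> real \<Rightarrow> 'b::real_normed_vector"
  shows "(\<And>i. i \<in> I \<Longrightarrow> f i C1_differentiable_on S) \<Longrightarrow> (\<lambda>x. \<Sum>i\<in>I. f i x) C1_differentiable_on S"
  by (induction I rule: infinite_finite_induct) auto

lemma C1_differentiable_on_sin_cos: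
  "(\<lambda>t. sin (c * t)) C1_differentiable_on S" "(\<lambda>t. cos (c * t)) C1_differentiable_on S" for c :: real
  unfolding C1_differentiable_on_def
  by (rule exI[of _ "\<lambda>t. c * cos (c * t)"] exI[of _ "\<lambda>t. - (c * sin (c * t))"];
      auto intro!: derivative_eq_intros continuous_intros simp flip: has_real_derivative_iff_has_vector_derivative)+

text \<open>The dimensions are required at every time, not only on \<open>S\<close>, because \<open>C1_differentiable_on\<close>
  speaks about two-sided derivatives at the points of \<open>S\<close>.\<close>

lemma mat_mult_C1:
  fixes f g :: "real \<Rightarrow> real mat"
  assumes "\<And>i j. i < a \<Longrightarrow> j < b \<Longrightarrow> (\<lambda>t. f t $$ (i, j)) C1_differentiable_on S"
    "\<And>i j. i < b \<Longrightarrow> j < c \<Longrightarrow> (\<lambda>t. g t $$ (i, j)) C1_differentiable_on S"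
    "\<And>t. f t \<in> carrier_mat a b" "\<And>t. g t \<in> carrier_mat b c" "i < a" "j < c"
  shows "(\<lambda>t. (f t * g t) $$ (i, j)) C1_differentiable_on S"
proof -
  have "(\<lambda>t. (f t * g t) $$ (i, j)) = (\<lambda>t. \<Sum>k<b. f t $$ (i, k) * g t $$ (k, j))"
  proof
    fix t show "(f t * g t) $$ (i, j) = (\<Sum>k<b. f t $$ (i, k) * g t $$ (k, j))"
      using assms(3)[of t] assms(4)[of t] assms(5,6) by (subst mat_mult_index) auto
  qed
  then show ?thesis using assms(1,2,5,6) by (simp only:) (intro C1_differentiable_on_sum C1_differentiable_on_mult, auto)
qed

lemma mat_transpose_C1:
  fixes f :: "real \<Rightarrow> real mat"
  assumes "\<And>i j. i < a \<Longrightarrow> j < b \<Longrightarrow> (\<lambda>t. f t $$ (i, j)) C1_differentiable_on S"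
    "\<And>t. f t \<in> carrier_mat a b" "i < b" "j < a"
  shows "(\<lambda>t. transpose_mat (f t) $$ (i, j)) C1_differentiable_on S"
proof -
  have "(\<lambda>t. transpose_mat (f t) $$ (i, j)) = (\<lambda>t. f t $$ (j, i))"
  proof
    fix t show "transpose_mat (f t) $$ (i, j) = f t $$ (j, i)" using assms(2)[of t] assms(3,4) by simp
  qed
  then show ?thesis using assms by simp
qed

section \<open>Tangent vectors and the geodesic equations\<close>

text \<open>A one-column matrix, so that the product of a coordinate vector with a transposed one is
  a matrix unit.\<close>

definition coord_vec :: "nat \<Rightarrow> nat \<Rightarrow> real mat" where
  "coord_vec n k = mat n 1 (\<lambda>(i, j). if i = k then 1 else 0)"

lemma coord_vec_dim [simp]: "dim_row (coord_vec n k) = n" "dim_col (coord_vec n k) = 1"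
  by (simp_all add: coord_vec_def)

lemma mat_trace_mult_coord_vec:
  assumes "M \<in> carrier_mat n n" "k < n" "l < n"
  shows "mat_trace (M * (coord_vec n k * transpose_mat (coord_vec n l))) = M $$ (l, k)"
proof -
  let ?E = "coord_vec n k * transpose_mat (coord_vec n l)"
  have "?E $$ (j, i) = (if i = l then if j = k then 1 else 0 else 0)"
    if "i < n" "j < n" for i j
    using that by (simp add: mat_mult_index del: index_mult_mat(1)) (simp add: coord_vec_def)
  then have "(\<Sum>j<n. M $$ (i, j) * ?E $$ (j, i)) = (if i = l then M $$ (l, k) else 0)" if "i < n" for i
    using that assms(2) by (simp add: mult_of_bool_if del: index_mult_mat(1))
  then show ?thesis using assms by (simp add: mat_trace_mult del: index_mult_mat(1))
qed

lemma coord_vec_inner: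
  assumes "k < n" "l < n"
  shows "transpose_mat (coord_vec n k) * coord_vec n l = (if k = l then 1\<^sub>m 1 else 0\<^sub>m 1 1)"
  by (rule eq_matI) (use assms in \<open>auto simp: mat_mult_index coord_vec_def mult_of_bool_if simp del: index_mult_mat(1)\<close>)

text \<open>Differences of two transposed matrix units detect the antisymmetric part of M entry by
  entry. They generate plane rotations and satisfy A^3 = - A; restricting the tests to such A leaves
  curves that can be written down without a matrix exponential.\<close>

lemma symmetric_if_orthogonal_to_skew:
  assumes M: "M \<in> carrier_mat n n"
    and orth: "\<And>A. A \<in> carrier_mat n n \<Longrightarrow> transpose_mat A = - A \<Longrightarrow> A * (A * A) = - A \<Longrightarrow> mat_trace (M * A) = 0"
  shows "transpose_mat M = M"
proof (rule eq_matI)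
  fix i j assume "i < dim_row M" "j < dim_col M"
  then have ij: "i < n" "j < n" using M by auto
  let ?V = "coord_vec n i" and ?W = "coord_vec n j"
  show "transpose_mat M $$ (i, j) = M $$ (i, j)"
  proof (cases "i = j")
    case False
    define A where "A = ?V * transpose_mat ?W - ?W * transpose_mat ?V"
    have inner: "transpose_mat ?V * ?V = 1\<^sub>m 1" "transpose_mat ?W * ?W = 1\<^sub>m 1"
      "transpose_mat ?V * ?W = 0\<^sub>m 1 1" "transpose_mat ?W * ?V = 0\<^sub>m 1 1"
      using ij False by (simp_all add: coord_vec_inner)
    have A: "A \<in> carrier_mat n n" by (rule carrier_matI) (simp_all add: A_def)
    have "transpose_mat A = - A" unfolding A_def by (simp add: mat_algebra) (rule eq_matI, auto)
    moreover have "A * (A * A) = - A"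
      unfolding A_def by (simp add: mat_algebra inner mult_left_eq[OF inner(1)] mult_left_eq[OF inner(2)]
        mult_left_eq[OF inner(3)] mult_left_eq[OF inner(4)]) (rule eq_matI, auto)
    ultimately have "mat_trace (M * A) = 0" using orth A by blast
    then show ?thesis
      unfolding A_def using M ij by (simp add: mat_algebra mat_trace_simps mat_trace_mult_coord_vec)
  qed (use M ij in simp)
qed (use M in auto)

text \<open>Rodrigues' formula: the exponential of t A when A^3 = - A.\<close>

definition rotation :: "real mat \<Rightarrow> real \<Rightarrow> real mat" where
  "rotation A t = 1\<^sub>m (dim_row A) + sin t \<cdot>\<^sub>m A + (1 - cos t) \<cdot>\<^sub>m (A * A)"

context
  fixes n :: nat and A :: "real mat"
  assumes A: "A \<in> carrier_mat n n" "transpose_mat A = - A" "A * (A * A) = - A"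
begin

lemma rotation_carrier: "rotation A t \<in> carrier_mat n n"
  using A(1) by (auto simp: rotation_def)

lemma rotation_0: "rotation A 0 = 1\<^sub>m n"
  unfolding rotation_def by (rule eq_matI) (use A(1) in auto)

lemma rotation_orthogonal: "transpose_mat (rotation A t) * rotation A t = 1\<^sub>m n"
proof -
  note d = carrier_matD[OF A(1)]
  \<comment> \<open>All powers reduce to A and A^2, so orthogonality becomes the identity 2 (1 - cos
    t) = sin^2 t + (1 - cos t)^2.\<close>
  have 4: "A * (A * (A * A)) = - (A * A)" by (subst A(3)) (use d in \<open>simp add: mat_algebra\<close>)
  have sc: "sin t * sin t = 1 - cos t * cos t" using sin_squared_eq[of t] by (simp add: power2_eq_square)
  have trig: "sin t * (sin t * x) = x - cos t * (cos t * x)" for x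
    using arg_cong[OF sc, of "\<lambda>y. y * x"] by (simp add: algebra_simps)
  show ?thesis
    unfolding rotation_def using d
    by (simp add: mat_algebra A(2) 4 A(3)) (rule eq_matI, auto simp: algebra_simps trig simp del: index_mult_mat(1))
qed

lemma rotation_C1: "i < n \<Longrightarrow> j < n \<Longrightarrow> (\<lambda>t. rotation A t $$ (i, j)) C1_differentiable_on S"
  using A(1) C1_differentiable_on_sin_cos[of 1 S] unfolding rotation_def by (auto simp del: index_mult_mat(1))

lemma rotation_derivative: "has_mat_derivative n n (rotation A) A (at 0)"
proof -
  have "((\<lambda>t. rotation A t $$ (i, j)) has_real_derivative A $$ (i, j)) (at 0)" if "i < n" "j < n" for i j
    using that A(1) unfolding rotation_def
    by (auto intro!: derivative_eq_intros simp del: index_mult_mat(1))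
  then show ?thesis using A(1) by (simp add: has_mat_derivative_def)
qed

lemma rotation_stiefel:
  assumes U: "U \<in> stiefel n q"
  shows "rotation A t * U \<in> stiefel n q"
proof -
  have r: "transpose_mat (rotation A t) * rotation A t = 1\<^sub>m n" by (rule rotation_orthogonal)
  show ?thesis using stiefelD[OF U] carrier_matD[OF rotation_carrier[of t]] rotation_carrier[of t]
    by (auto simp: stiefel_def mat_algebra mult_left_eq[OF r])
qed

lemma stiefel_rotation_tangent:
  assumes U: "U \<in> stiefel n q"
  shows "A * U \<in> tangent_space n q (stiefel n q) U"
proof -
  note Ud = stiefelD[OF U]
  have "has_mat_derivative n q (\<lambda>t. rotation A t * U) (A * U + rotation A 0 * 0\<^sub>m n q) (at 0 within UNIV)"
    by (rule has_mat_derivative_mult[OF rotation_derivative has_mat_derivative_const]) (use Ud rotation_carrier in auto)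
  then have "has_mat_derivative n q (\<lambda>t. rotation A t * U) (A * U) (at 0)"
    using Ud A(1) by (simp add: rotation_0 mat_algebra)
  moreover have "(\<lambda>t. (rotation A t * U) $$ (i, j)) C1_differentiable_on S" if "i < n" "j < q" for i j S
    by (rule mat_mult_C1[of n n _ _ q]) (use rotation_C1 rotation_carrier Ud that in auto)
  moreover have "rotation A 0 * U = U" using Ud by (simp add: rotation_0)
  ultimately show ?thesis using rotation_stiefel[OF U] unfolding tangent_space_def
    by (intro CollectI exI[of _ "\<lambda>t. rotation A t * U"] exI[of _ 1]) auto
qed

lemma grassmann_rotation_tangent:
  assumes P: "P \<in> grassmann n q"
  shows "A * P - P * A \<in> tangent_space n n (grassmann n q) P"
proof -
  obtain Y where Y: "Y \<in> stiefel n q" "P = Y * transpose_mat Y" using grassmann_frame[OF P] .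
  have Pc: "P \<in> carrier_mat n n" using P by (simp add: grassmann_def)
  let ?g = "\<lambda>t. rotation A t * P * transpose_mat (rotation A t)"
  have "has_mat_derivative n n ?g ((A * P + rotation A 0 * 0\<^sub>m n n) * transpose_mat (rotation A 0)
      + (rotation A 0 * P) * transpose_mat A) (at 0 within UNIV)"
    by (rule has_mat_derivative_mult[OF has_mat_derivative_mult[OF rotation_derivative has_mat_derivative_const]
      has_mat_derivative_transpose[OF rotation_derivative]]) (use Pc rotation_carrier in \<open>auto intro!: mult_carrier_mat[of _ n n]\<close>)
  moreover have "(A * P + rotation A 0 * 0\<^sub>m n n) * transpose_mat (rotation A 0)
      + (rotation A 0 * P) * transpose_mat A = A * P - P * A"
    using carrier_matD[OF A(1)] carrier_matD[OF Pc] A(2) by (simp add: rotation_0 mat_algebra) (rule eq_matI, auto simp del: index_mult_mat(1))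
  ultimately have "has_mat_derivative n n ?g (A * P - P * A) (at 0)" by simp
  moreover have "(\<lambda>t. ?g t $$ (i, j)) C1_differentiable_on S" if "i < n" "j < n" for i j S
    by (rule mat_mult_C1[of n n _ _ n], rule mat_mult_C1[of n n _ _ n])
       (use rotation_C1 rotation_carrier Pc that mat_transpose_C1[of n n "rotation A"] in
         \<open>auto intro!: mult_carrier_mat[of _ n n]\<close>)
  moreover have "?g 0 = P" using Pc by (simp add: rotation_0)
  \<comment> \<open>Moving a frame instead of the projector avoids computing the rank of a
    conjugate.\<close>
  moreover have "?g t \<in> grassmann n q" for t
  proof -
    have "?g t = (rotation A t * Y) * transpose_mat (rotation A t * Y)"
      using stiefelD[OF Y(1)] carrier_matD[OF rotation_carrier[of t]] by (simp add: Y(2) mat_algebra)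
    then show ?thesis using frame_projector_in_grassmann[OF rotation_stiefel[OF Y(1)]] by simp
  qed
  ultimately show ?thesis unfolding tangent_space_def
    by (intro CollectI exI[of _ ?g] exI[of _ 1]) auto
qed

end

text \<open>Tangent vectors A U with A skew suffice as tests: the trace of
  \<open>N\<^sup>T A U\<close> is that of \<open>U N\<^sup>T A\<close>, so
  \<open>U N\<^sup>T\<close> is orthogonal to skew matrices and hence symmetric.\<close>

lemma stiefel_normal:
  assumes U: "U \<in> stiefel n q" and N: "N \<in> carrier_mat n q"
    and orth: "\<And>D. D \<in> tangent_space n q (stiefel n q) U \<Longrightarrow> stiefel_metric N D = 0"
  shows "N * transpose_mat U = U * transpose_mat N"
proof -
  note d = stiefelD[OF U] carrier_matD[OF N]
  have "transpose_mat (U * transpose_mat N) = U * transpose_mat N"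
  proof (rule symmetric_if_orthogonal_to_skew)
    fix A :: "real mat" assume A: "A \<in> carrier_mat n n" "transpose_mat A = - A" "A * (A * A) = - A"
    have "mat_trace (transpose_mat N * (A * U)) = 0"
      using orth[OF stiefel_rotation_tangent[OF A U]] by (simp add: stiefel_metric_def)
    then show "mat_trace (U * transpose_mat N * A) = 0"
      using d carrier_matD[OF A(1)] mat_trace_comm[of U "transpose_mat N * A"] by (simp add: mat_algebra)
  qed (use d in auto)
  then show ?thesis using d by (simp add: mat_algebra)
qed

text \<open>Testing against commutators of skew matrices with P makes P N - N P symmetric, while a
  commutator of symmetric matrices is skew; so it vanishes.\<close>

lemma grassmann_normal:
  assumes P: "P \<in> grassmann n q" and N: "N \<in> carrier_mat n n" "transpose_mat N = N"
    and orth: "\<And>D. D \<in> tangent_space n n (grassmann n q) P \<Longrightarrow> grassmann_metric N D = 0"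
  shows "N * P = P * N"
proof -
  have Pc: "P \<in> carrier_mat n n" "transpose_mat P = P" using P by (auto simp: grassmann_def)
  note d = carrier_matD[OF Pc(1)] carrier_matD[OF N(1)]
  have "transpose_mat (P * N - N * P) = P * N - N * P"
  proof (rule symmetric_if_orthogonal_to_skew)
    fix A :: "real mat" assume A: "A \<in> carrier_mat n n" "transpose_mat A = - A" "A * (A * A) = - A"
    note d = d carrier_matD[OF A(1)]
    have "mat_trace (N * (A * P - P * A)) = 0"
      using orth[OF grassmann_rotation_tangent[OF A P]] by (simp add: grassmann_metric_def)
    moreover have "mat_trace (N * (A * P)) = mat_trace (P * (N * A))"
      using d mat_trace_comm[of "N * A" P] by (simp add: mat_algebra)
    ultimately show "mat_trace ((P * N - N * P) * A) = 0"
      using d by (simp add: mat_algebra mat_trace_simps)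
  qed (use d in auto)
  then have e: "N * P - P * N = P * N - N * P" using d by (simp add: mat_algebra Pc(2) N(2))
  show ?thesis
  proof (rule eq_matI)
    fix i j assume "i < dim_row (P * N)" "j < dim_col (P * N)"
    then show "(N * P) $$ (i, j) = (P * N) $$ (i, j)"
      using arg_cong[OF e, of "\<lambda>M. M $$ (i, j)"] d by (simp del: index_mult_mat(1))
  qed (use d in auto)
qed

lemma mat_add_eq_zero_iff:
  fixes X :: "real mat"
  assumes "X \<in> carrier_mat n m" "Y \<in> carrier_mat n m"
  shows "X + Y = 0\<^sub>m n m \<longleftrightarrow> X = - Y"
proof
  assume e: "X + Y = 0\<^sub>m n m"
  show "X = - Y"
  proof (rule eq_matI)
    fix i j assume "i < dim_row (- Y)" "j < dim_col (- Y)"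
    then show "X $$ (i, j) = (- Y) $$ (i, j)"
      using arg_cong[OF e, of "\<lambda>M. M $$ (i, j)"] assms by simp
  qed (use assms in auto)
qed (use assms in \<open>auto intro!: eq_matI\<close>)

lemma mat_diff_eq_zero_iff:
  fixes X :: "real mat"
  assumes "X \<in> carrier_mat n m" "Y \<in> carrier_mat n m"
  shows "X - Y = 0\<^sub>m n m \<longleftrightarrow> X = Y"
proof
  assume e: "X - Y = 0\<^sub>m n m"
  show "X = Y"
  proof (rule eq_matI)
    fix i j assume "i < dim_row Y" "j < dim_col Y"
    then show "X $$ (i, j) = Y $$ (i, j)"
      using arg_cong[OF e, of "\<lambda>M. M $$ (i, j)"] assms by simp
  qed (use assms in auto)
qed (use assms in \<open>auto intro!: eq_matI\<close>)

lemma mat_eq_uminus_self: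
  fixes X :: "real mat"
  assumes "X \<in> carrier_mat n m" "X = - X"
  shows "X = 0\<^sub>m n m"
proof (rule eq_matI)
  fix i j assume "i < dim_row (0\<^sub>m n m :: real mat)" "j < dim_col (0\<^sub>m n m :: real mat)"
  then show "X $$ (i, j) = 0\<^sub>m n m $$ (i, j)"
    using arg_cong[OF assms(2), of "\<lambda>M. M $$ (i, j)"] assms(1) by simp
qed (use assms in auto)

text \<open>The coefficients are the conserved momenta of the left \<open>O(n)\<close>- and the right \<open>O(q)\<close>-action.\<close>

lemma stiefel_geodesic_linear_ode:
  assumes g: "is_geodesic n q (stiefel n q) stiefel_metric \<gamma> \<gamma>'" and t: "t \<in> {0..1}"
  defines "A \<equiv> \<gamma>' 0 * transpose_mat (\<gamma> 0) - \<gamma> 0 * transpose_mat (\<gamma>' 0)"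
    and "B \<equiv> transpose_mat (\<gamma> 0) * \<gamma>' 0"
  shows "transpose_mat A = - A" "transpose_mat B = - B" "\<gamma>' t = A * \<gamma> t - \<gamma> t * B"
proof -
  obtain \<gamma>'' where g: "\<And>t. t \<in> {0..1} \<Longrightarrow> \<gamma> t \<in> stiefel n q"
    "\<And>t. t \<in> {0..1} \<Longrightarrow> has_mat_derivative n q \<gamma> (\<gamma>' t) (at t within {0..1})"
    "\<And>t. t \<in> {0..1} \<Longrightarrow> has_mat_derivative n q \<gamma>' (\<gamma>'' t) (at t within {0..1})"
    "\<And>t D. t \<in> {0..1} \<Longrightarrow> D \<in> tangent_space n q (stiefel n q) (\<gamma> t) \<Longrightarrow> stiefel_metric (\<gamma>'' t) D = 0"
    using g unfolding is_geodesic_def by blast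
  have c: "\<gamma> t \<in> carrier_mat n q" "\<gamma>' t \<in> carrier_mat n q" "\<gamma>'' t \<in> carrier_mat n q" if "t \<in> {0..1}" for t
    using g(1)[OF that] has_mat_derivative_carrier[OF g(2)[OF that]] has_mat_derivative_carrier[OF g(3)[OF that]]
    by (auto simp: stiefel_def)
  note d = carrier_matD[OF c(1)] carrier_matD[OF c(2)] carrier_matD[OF c(3)]
  define MA where "MA = (\<lambda>t. \<gamma>' t * transpose_mat (\<gamma> t) - \<gamma> t * transpose_mat (\<gamma>' t))"
  define MB where "MB = (\<lambda>t. transpose_mat (\<gamma> t) * \<gamma>' t)"
  have normal: "\<gamma>'' t * transpose_mat (\<gamma> t) = \<gamma> t * transpose_mat (\<gamma>'' t)" if "t \<in> {0..1}" for t
    using stiefel_normal[OF g(1)[OF that] c(3)[OF that]] g(4)[OF that] by blast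
  have orth: "transpose_mat (\<gamma> t) * \<gamma> t = 1\<^sub>m q" if "t \<in> {0..1}" for t
    using g(1)[OF that] by (simp add: stiefel_def)
  have MA: "MA t = MA 0" if "t \<in> {0..1}" for t
  proof (rule has_mat_derivative_zero_const[OF _ _ that])
    fix t :: real assume t: "t \<in> {0..1}"
    have "has_mat_derivative n n MA ((\<gamma>'' t * transpose_mat (\<gamma> t) + \<gamma>' t * transpose_mat (\<gamma>' t))
       - (\<gamma>' t * transpose_mat (\<gamma>' t) + \<gamma> t * transpose_mat (\<gamma>'' t))) (at t within {0..1})"
      unfolding MA_def using t
      by (intro has_mat_derivative_minus has_mat_derivative_mult[where b = q] has_mat_derivative_transpose g(2,3)
        mult_carrier_mat[of _ n q] c transpose_carrier_mat[THEN iffD2]) auto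
    moreover have "(\<gamma>'' t * transpose_mat (\<gamma> t) + \<gamma>' t * transpose_mat (\<gamma>' t))
       - (\<gamma>' t * transpose_mat (\<gamma>' t) + \<gamma> t * transpose_mat (\<gamma>'' t)) = 0\<^sub>m n n"
      unfolding normal[OF t] by (rule eq_matI) (use d[OF t] in \<open>auto simp del: index_mult_mat(1)\<close>)
    ultimately show "has_mat_derivative n n MA (0\<^sub>m n n) (at t within {0..1})" by simp
    show "MA t \<in> carrier_mat n n" using d[OF t] by (auto simp: MA_def)
  qed
  have MBskew: "transpose_mat (MB t) + MB t = 0\<^sub>m q q" if t: "t \<in> {0..1}" for t
  proof (rule has_mat_derivative_unique[OF _ _ t])
    have "has_mat_derivative q q (\<lambda>t. transpose_mat (\<gamma> t) * \<gamma> t)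
        (transpose_mat (\<gamma>' t) * \<gamma> t + transpose_mat (\<gamma> t) * \<gamma>' t) (at t within {0..1})"
      using t by (intro has_mat_derivative_mult[where b = n] has_mat_derivative_transpose g(2)
        c transpose_carrier_mat[THEN iffD2]) auto
    then show "has_mat_derivative q q (\<lambda>t. transpose_mat (\<gamma> t) * \<gamma> t) (transpose_mat (MB t) + MB t) (at t within {0..1})"
      using d[OF t] by (simp add: MB_def mat_algebra)
    show "has_mat_derivative q q (\<lambda>t. transpose_mat (\<gamma> t) * \<gamma> t) (0\<^sub>m q q) (at t within {0..1})"
      by (rule has_mat_derivative_cong[OF has_mat_derivative_const[of "1\<^sub>m q"]]) (use orth t in auto)
  qed
  have MBc: "MB t \<in> carrier_mat q q" if "t \<in> {0..1}" for t using d[OF that] by (auto simp: MB_def)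
  \<comment> \<open>The derivative of the right momentum is skew because the momentum is, and
    symmetric because the acceleration is normal; both together make it zero.\<close>
  have MB: "MB t = MB 0" if "t \<in> {0..1}" for t
  proof (rule has_mat_derivative_zero_const[OF _ MBc that])
    fix t :: real assume t: "t \<in> {0..1}"
    let ?D = "transpose_mat (\<gamma>' t) * \<gamma>' t + transpose_mat (\<gamma> t) * \<gamma>'' t"
    have D: "has_mat_derivative q q MB ?D (at t within {0..1})"
      unfolding MB_def using t by (intro has_mat_derivative_mult[where b = n] has_mat_derivative_transpose g(2,3)
        c transpose_carrier_mat[THEN iffD2]) auto
    have "has_mat_derivative q q (\<lambda>t. transpose_mat (MB t) + MB t) (transpose_mat ?D + ?D) (at t within {0..1})"
      using t by (intro has_mat_derivative_add has_mat_derivative_transpose D MBc transpose_carrier_mat[THEN iffD2])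
    moreover have "has_mat_derivative q q (\<lambda>t. transpose_mat (MB t) + MB t) (0\<^sub>m q q) (at t within {0..1})"
      by (rule has_mat_derivative_cong[OF has_mat_derivative_const[of "0\<^sub>m q q"]]) (use MBskew t in auto)
    ultimately have "transpose_mat ?D + ?D = 0\<^sub>m q q" using has_mat_derivative_unique t by blast
    then have "transpose_mat ?D = - ?D"
      using has_mat_derivative_carrier[OF D] by (subst (asm) mat_add_eq_zero_iff) auto
    moreover have "transpose_mat ?D = ?D"
    proof -
      have "transpose_mat (\<gamma> t) * (\<gamma>'' t * transpose_mat (\<gamma> t)) * \<gamma> t = transpose_mat (\<gamma> t) * (\<gamma> t * transpose_mat (\<gamma>'' t)) * \<gamma> t"
        by (simp only: normal[OF t])
      then have "transpose_mat (\<gamma> t) * \<gamma>'' t = transpose_mat (\<gamma>'' t) * \<gamma> t"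
        using d[OF t] by (simp add: mat_algebra orth[OF t] mult_left_eq[OF orth[OF t]])
      then show ?thesis using d[OF t] by (simp add: mat_algebra)
    qed
    ultimately have "?D = 0\<^sub>m q q"
      using has_mat_derivative_carrier[OF D] by (intro mat_eq_uminus_self) auto
    then show "has_mat_derivative q q MB (0\<^sub>m q q) (at t within {0..1})" using D by simp
  qed
  have 0: "(0::real) \<in> {0..1}" by simp
  have AB: "A = MA 0" "B = MB 0" by (simp_all add: A_def B_def MA_def MB_def)
  show "transpose_mat A = - A"
    unfolding A_def using d[OF 0] by (simp add: mat_algebra) (rule eq_matI, auto simp del: index_mult_mat(1))
  show "transpose_mat B = - B"
    using MBskew[OF 0] MBc[OF 0] unfolding AB by (subst (asm) mat_add_eq_zero_iff) auto
  have MBt: "transpose_mat (MB t) = - MB t"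
    using MBskew[OF t] MBc[OF t] by (subst (asm) mat_add_eq_zero_iff) auto
  then have MBt': "transpose_mat (\<gamma>' t) * \<gamma> t = - (transpose_mat (\<gamma> t) * \<gamma>' t)"
    using d[OF t] by (simp add: MB_def mat_algebra)
  \<comment> \<open>By orthonormality
    \<open>A \<gamma> = \<gamma>' - \<gamma> \<gamma>'\<^sup>T \<gamma>\<close>, and skewness of
    \<open>\<gamma>\<^sup>T \<gamma>'\<close> turns the last term into
    \<open>+ \<gamma> B\<close>.\<close>
  show "\<gamma>' t = A * \<gamma> t - \<gamma> t * B"
    unfolding AB MA[OF t, symmetric] MB[OF t, symmetric] unfolding MA_def MB_def
    using d[OF t] by (simp add: mat_algebra orth[OF t] MBt') (rule eq_matI, auto simp del: index_mult_mat(1))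
qed

lemma linear_ode_unique:
  assumes f: "\<And>t. t \<in> {0..1} \<Longrightarrow> has_mat_derivative n m f (A * f t - f t * B) (at t within {0..1})"
    and g: "\<And>t. t \<in> {0..1} \<Longrightarrow> has_mat_derivative n m g (A * g t - g t * B) (at t within {0..1})"
    and c: "\<And>t. t \<in> {0..1} \<Longrightarrow> f t \<in> carrier_mat n m" "\<And>t. t \<in> {0..1} \<Longrightarrow> g t \<in> carrier_mat n m"
    and fg: "f 0 = g 0"
    and A: "A \<in> carrier_mat n n" "transpose_mat A = - A" and B: "B \<in> carrier_mat m m" "transpose_mat B = - B"
    and t: "t \<in> {0..1}"
  shows "f t = g t"
proof -
  have "f t - g t = 0\<^sub>m n m"
  proof (rule skew_linear_ode_zero[of n m "\<lambda>t. f t - g t" A B, OF _ _ _ A B t])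
    fix t :: real assume t: "t \<in> {0..1}"
    note d = carrier_matD[OF c(1)[OF t]] carrier_matD[OF c(2)[OF t]] carrier_matD[OF A(1)] carrier_matD[OF B(1)]
    have "A * (f t - g t) - (f t - g t) * B = (A * f t - f t * B) - (A * g t - g t * B)"
      using d by (simp add: mat_algebra) (rule eq_matI, auto simp del: index_mult_mat(1))
    then show "has_mat_derivative n m (\<lambda>t. f t - g t) (A * (f t - g t) - (f t - g t) * B) (at t within {0..1})"
      using t by (simp only:) (intro has_mat_derivative_minus f g c)
    show "f t - g t \<in> carrier_mat n m" using d by auto
  next
    show "f 0 - g 0 = 0\<^sub>m n m" using c(2)[of 0] by (subst mat_diff_eq_zero_iff) (auto simp: fg)
  qed
  then show ?thesis using c[OF t] by (simp add: mat_diff_eq_zero_iff)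
qed

text \<open>The coefficients of the linear equation depend only on position and velocity at time 0,
  so geodesics with the same initial data solve the same initial value problem. This gives meaning
  to the definite description in \<open>riem_exp\<close>.\<close>

lemma stiefel_geodesic_unique:
  assumes f: "is_geodesic n q (stiefel n q) stiefel_metric f f'"
    and g: "is_geodesic n q (stiefel n q) stiefel_metric g g'"
    and eq: "f 0 = g 0" "f' 0 = g' 0"
  shows "f 1 = g 1"
proof -
  have c: "h t \<in> carrier_mat n q" "h' t \<in> carrier_mat n q" "has_mat_derivative n q h (h' t) (at t within {0..1})"
    if "is_geodesic n q (stiefel n q) stiefel_metric h h'" "t \<in> {0..1}" for h h' t
    using that has_mat_derivative_carrier unfolding is_geodesic_def stiefel_def by blast+
  note F = stiefel_geodesic_linear_ode[OF f] and G = stiefel_geodesic_linear_ode[OF g]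
  have 0: "(0::real) \<in> {0..1}" by simp
  note d = carrier_matD[OF c(1)[OF f 0]] carrier_matD[OF c(2)[OF f 0]]
  let ?A = "f' 0 * transpose_mat (f 0) - f 0 * transpose_mat (f' 0)" and ?B = "transpose_mat (f 0) * f' 0"
  show ?thesis
  proof (rule linear_ode_unique[of n q f ?A ?B g])
    show "has_mat_derivative n q f (?A * f t - f t * ?B) (at t within {0..1})" if "t \<in> {0..1}" for t
      using c(3)[OF f that] F(3)[OF that] by simp
    show "has_mat_derivative n q g (?A * g t - g t * ?B) (at t within {0..1})" if "t \<in> {0..1}" for t
      using c(3)[OF g that] G(3)[OF that] by (simp add: eq)
  qed (use F(1,2)[OF 0] c(1)[OF f] c(1)[OF g] eq(1) d in auto)
qed

text \<open>The momentum \<open>\<gamma>' \<gamma> - \<gamma> \<gamma>'\<close> of the conjugation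
  action is conserved because a normal acceleration commutes with \<gamma>. Differentiating
  \<open>\<gamma> \<gamma> = \<gamma>\<close> gives \<open>\<gamma> \<gamma>' \<gamma> = 0\<close>,
  which turns the commutator of the momentum with \<gamma> back into
  \<open>\<gamma>'\<close>.\<close>

lemma grassmann_geodesic_linear_ode:
  assumes g: "is_geodesic n n (grassmann n q) grassmann_metric \<gamma> \<gamma>'" and t: "t \<in> {0..1}"
  defines "A \<equiv> \<gamma>' 0 * \<gamma> 0 - \<gamma> 0 * \<gamma>' 0"
  shows "transpose_mat A = - A" "\<gamma>' t = A * \<gamma> t - \<gamma> t * A"
proof -
  obtain \<gamma>'' where g: "\<And>t. t \<in> {0..1} \<Longrightarrow> \<gamma> t \<in> grassmann n q"
    "\<And>t. t \<in> {0..1} \<Longrightarrow> has_mat_derivative n n \<gamma> (\<gamma>' t) (at t within {0..1})"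
    "\<And>t. t \<in> {0..1} \<Longrightarrow> has_mat_derivative n n \<gamma>' (\<gamma>'' t) (at t within {0..1})"
    "\<And>t D. t \<in> {0..1} \<Longrightarrow> D \<in> tangent_space n n (grassmann n q) (\<gamma> t) \<Longrightarrow> grassmann_metric (\<gamma>'' t) D = 0"
    using g unfolding is_geodesic_def by blast
  have c: "\<gamma> t \<in> carrier_mat n n" "\<gamma>' t \<in> carrier_mat n n" "\<gamma>'' t \<in> carrier_mat n n" if "t \<in> {0..1}" for t
    using g(1)[OF that] has_mat_derivative_carrier[OF g(2)[OF that]] has_mat_derivative_carrier[OF g(3)[OF that]]
    by (auto simp: grassmann_def)
  have P: "transpose_mat (\<gamma> t) = \<gamma> t" "\<gamma> t * \<gamma> t = \<gamma> t" if "t \<in> {0..1}" for t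
    using g(1)[OF that] by (auto simp: grassmann_def)
  note d = carrier_matD[OF c(1)] carrier_matD[OF c(2)] carrier_matD[OF c(3)]
  have sym': "transpose_mat (\<gamma>' t) = \<gamma>' t" if t: "t \<in> {0..1}" for t
    by (rule has_mat_derivative_unique[OF has_mat_derivative_cong[OF has_mat_derivative_transpose[OF g(2)]] g(2)])
       (use c P t in auto)
  have sym'': "transpose_mat (\<gamma>'' t) = \<gamma>'' t" if t: "t \<in> {0..1}" for t
    by (rule has_mat_derivative_unique[OF has_mat_derivative_cong[OF has_mat_derivative_transpose[OF g(3)]] g(3)])
       (use c sym' t in auto)
  have proj: "\<gamma>' t * \<gamma> t + \<gamma> t * \<gamma>' t = \<gamma>' t" if t: "t \<in> {0..1}" for t
    by (rule has_mat_derivative_unique[OF has_mat_derivative_cong[OF has_mat_derivative_mult[OF g(2) g(2)]] g(2)])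
       (use c P t in auto)
  have normal: "\<gamma>'' t * \<gamma> t = \<gamma> t * \<gamma>'' t" if "t \<in> {0..1}" for t
    using grassmann_normal[OF g(1)[OF that] c(3)[OF that] sym''[OF that]] g(4)[OF that] by blast
  define MA where "MA = (\<lambda>t. \<gamma>' t * \<gamma> t - \<gamma> t * \<gamma>' t)"
  have MA: "MA t = MA 0" if "t \<in> {0..1}" for t
  proof (rule has_mat_derivative_zero_const[OF _ _ that])
    fix t :: real assume t: "t \<in> {0..1}"
    have "has_mat_derivative n n MA ((\<gamma>'' t * \<gamma> t + \<gamma>' t * \<gamma>' t) - (\<gamma>' t * \<gamma>' t + \<gamma> t * \<gamma>'' t)) (at t within {0..1})"
      unfolding MA_def using t
      by (intro has_mat_derivative_minus has_mat_derivative_mult[where b = n] g(2,3)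
        mult_carrier_mat[of _ n n] c) auto
    moreover have "(\<gamma>'' t * \<gamma> t + \<gamma>' t * \<gamma>' t) - (\<gamma>' t * \<gamma>' t + \<gamma> t * \<gamma>'' t) = 0\<^sub>m n n"
      unfolding normal[OF t] by (rule eq_matI) (use d[OF t] in \<open>auto simp del: index_mult_mat(1)\<close>)
    ultimately show "has_mat_derivative n n MA (0\<^sub>m n n) (at t within {0..1})" by simp
    show "MA t \<in> carrier_mat n n" using d[OF t] by (auto simp: MA_def)
  qed
  have 0: "(0::real) \<in> {0..1}" by simp
  have A: "A = MA 0" by (simp add: A_def MA_def)
  show "transpose_mat A = - A"
    unfolding A_def using d[OF 0] P[OF 0] sym'[OF 0] by (simp add: mat_algebra) (rule eq_matI, auto simp del: index_mult_mat(1))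
  have z: "\<gamma> t * (\<gamma>' t * \<gamma> t) = 0\<^sub>m n n"
  proof -
    have "\<gamma> t * (\<gamma>' t * \<gamma> t + \<gamma> t * \<gamma>' t) * \<gamma> t = \<gamma> t * \<gamma>' t * \<gamma> t" by (simp only: proj[OF t])
    then have e: "\<gamma> t * (\<gamma>' t * \<gamma> t) + \<gamma> t * (\<gamma>' t * \<gamma> t) = \<gamma> t * (\<gamma>' t * \<gamma> t)"
      using d[OF t] P[OF t] by (simp add: mat_algebra mult_left_eq[OF P(2)[OF t]])
    show ?thesis
    proof (rule eq_matI)
      fix i j assume "i < dim_row (0\<^sub>m n n :: real mat)" "j < dim_col (0\<^sub>m n n :: real mat)"
      then show "(\<gamma> t * (\<gamma>' t * \<gamma> t)) $$ (i, j) = 0\<^sub>m n n $$ (i, j)"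
        using arg_cong[OF e, of "\<lambda>M. M $$ (i, j)"] d[OF t] by (simp del: index_mult_mat(1))
    qed (use d[OF t] in auto)
  qed
  have "MA t * \<gamma> t - \<gamma> t * MA t = \<gamma>' t * \<gamma> t + \<gamma> t * \<gamma>' t"
    unfolding MA_def using d[OF t] P[OF t] z
    by (simp add: mat_algebra mult_left_eq[OF P(2)[OF t]]) (rule eq_matI, auto simp del: index_mult_mat(1))
  then show "\<gamma>' t = A * \<gamma> t - \<gamma> t * A"
    unfolding A MA[OF t] proj[OF t] by simp
qed

lemma grassmann_geodesic_unique:
  assumes f: "is_geodesic n n (grassmann n q) grassmann_metric f f'"
    and g: "is_geodesic n n (grassmann n q) grassmann_metric g g'"
    and eq: "f 0 = g 0" "f' 0 = g' 0"
  shows "f 1 = g 1"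
proof -
  have c: "h t \<in> carrier_mat n n" "h' t \<in> carrier_mat n n" "has_mat_derivative n n h (h' t) (at t within {0..1})"
    if "is_geodesic n n (grassmann n q) grassmann_metric h h'" "t \<in> {0..1}" for h h' t
    using that has_mat_derivative_carrier unfolding is_geodesic_def grassmann_def by blast+
  note F = grassmann_geodesic_linear_ode[OF f] and G = grassmann_geodesic_linear_ode[OF g]
  have 0: "(0::real) \<in> {0..1}" by simp
  note d = carrier_matD[OF c(1)[OF f 0]] carrier_matD[OF c(2)[OF f 0]]
  let ?A = "f' 0 * f 0 - f 0 * f' 0"
  show ?thesis
  proof (rule linear_ode_unique[of n n f ?A ?A g])
    show "has_mat_derivative n n f (?A * f t - f t * ?A) (at t within {0..1})" if "t \<in> {0..1}" for t
      using c(3)[OF f that] F(2)[OF that] by simp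
    show "has_mat_derivative n n g (?A * g t - g t * ?A) (at t within {0..1})" if "t \<in> {0..1}" for t
      using c(3)[OF g that] G(2)[OF that] by (simp add: eq)
  qed (use F(1)[OF 0] c(1)[OF f] c(1)[OF g] eq(1) d in auto)
qed

section \<open>Horizontal geodesics\<close>

lemma has_mat_derivative_at_unique:
  assumes "has_mat_derivative a b f F (at t)" "has_mat_derivative a b f G (at t)"
  shows "F = G"
proof (rule eq_matI)
  have FG: "F \<in> carrier_mat a b" "G \<in> carrier_mat a b" using assms by (auto simp: has_mat_derivative_def)
  fix i j assume "i < dim_row G" "j < dim_col G"
  then have ij: "i < a" "j < b" using FG by auto
  show "F $$ (i, j) = G $$ (i, j)"
  proof (rule DERIV_unique[of "\<lambda>s. f s $$ (i, j)"])
    show "((\<lambda>s. f s $$ (i, j)) has_real_derivative F $$ (i, j)) (at t)"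
      "((\<lambda>s. f s $$ (i, j)) has_real_derivative G $$ (i, j)) (at t)"
      using assms ij by (auto simp: has_mat_derivative_def)
  qed
qed (use assms in \<open>auto simp: has_mat_derivative_def\<close>)

lemma stiefel_tangent_skew:
  assumes D: "D \<in> tangent_space n q (stiefel n q) U"
  shows "D \<in> carrier_mat n q" "transpose_mat D * U = - (transpose_mat U * D)"
proof -
  obtain \<gamma> \<epsilon> where g: "0 < \<epsilon>" "\<And>t. t \<in> {-\<epsilon><..<\<epsilon>} \<Longrightarrow> \<gamma> t \<in> stiefel n q" "\<gamma> 0 = U"
    "has_mat_derivative n q \<gamma> D (at 0)"
    using D unfolding tangent_space_def by blast
  show Dc: "D \<in> carrier_mat n q" using has_mat_derivative_carrier[OF g(4)] .
  let ?S = "{-\<epsilon><..<\<epsilon>}"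
  have S: "at 0 within ?S = at 0" "0 \<in> ?S" using g(1) by (auto intro: at_within_open)
  have d: "has_mat_derivative n q \<gamma> D (at 0 within ?S)" using g(4) S by simp
  have c: "\<gamma> t \<in> carrier_mat n q" if "t \<in> ?S" for t using g(2)[OF that] by (simp add: stiefel_def)
  have "has_mat_derivative q q (\<lambda>t. transpose_mat (\<gamma> t) * \<gamma> t) (transpose_mat D * \<gamma> 0 + transpose_mat (\<gamma> 0) * D) (at 0 within ?S)"
    by (intro has_mat_derivative_mult[where b = n] has_mat_derivative_transpose d c S transpose_carrier_mat[THEN iffD2]) auto
  moreover have "has_mat_derivative q q (\<lambda>t. transpose_mat (\<gamma> t) * \<gamma> t) (0\<^sub>m q q) (at 0 within ?S)"
    by (rule has_mat_derivative_cong[OF has_mat_derivative_const[of "1\<^sub>m q"]]) (use g(2) S in \<open>auto simp: stiefel_def\<close>)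
  ultimately have "transpose_mat D * U + transpose_mat U * D = 0\<^sub>m q q"
    using has_mat_derivative_at_unique unfolding S(1) g(3) by blast
  then show "transpose_mat D * U = - (transpose_mat U * D)"
    using Dc c[OF S(2)] by (subst (asm) mat_add_eq_zero_iff) (auto simp: g(3))
qed

text \<open>The last equation is the derivative of P P = P: relative to the range of P and its
  complement, a tangent vector has only off-diagonal blocks.\<close>

lemma grassmann_tangent:
  assumes D: "D \<in> tangent_space n n (grassmann n q) P"
  shows "D \<in> carrier_mat n n" "transpose_mat D = D" "D * P + P * D = D"
proof -
  obtain \<gamma> \<epsilon> where g: "0 < \<epsilon>" "\<And>t. t \<in> {-\<epsilon><..<\<epsilon>} \<Longrightarrow> \<gamma> t \<in> grassmann n q" "\<gamma> 0 = P"
    "has_mat_derivative n n \<gamma> D (at 0)"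
    using D unfolding tangent_space_def by blast
  show Dc: "D \<in> carrier_mat n n" using has_mat_derivative_carrier[OF g(4)] .
  let ?S = "{-\<epsilon><..<\<epsilon>}"
  have S: "at 0 within ?S = at 0" "0 \<in> ?S" using g(1) by (auto intro: at_within_open)
  have d: "has_mat_derivative n n \<gamma> D (at 0 within ?S)" using g(4) S by simp
  have c: "\<gamma> t \<in> carrier_mat n n" "transpose_mat (\<gamma> t) = \<gamma> t" "\<gamma> t * \<gamma> t = \<gamma> t" if "t \<in> ?S" for t
    using g(2)[OF that] by (auto simp: grassmann_def)
  have "has_mat_derivative n n \<gamma> (D * \<gamma> 0 + \<gamma> 0 * D) (at 0 within ?S)"
    by (rule has_mat_derivative_cong[OF has_mat_derivative_mult[OF d d]]) (use c S in auto)
  then show "D * P + P * D = D"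
    using has_mat_derivative_at_unique d unfolding S(1) g(3) by blast
  have "has_mat_derivative n n \<gamma> (transpose_mat D) (at 0 within ?S)"
    by (rule has_mat_derivative_cong[OF has_mat_derivative_transpose[OF d]]) (use c S in auto)
  then show "transpose_mat D = D"
    using has_mat_derivative_at_unique d unfolding S(1) by blast
qed

lemma velocity_eq:
  assumes "has_mat_derivative a b \<gamma> D (at t)"
  shows "velocity a b \<gamma> t = D"
  using assms by (intro eq_matI)
    (auto simp: velocity_def has_mat_derivative_def has_real_derivative_iff_has_vector_derivative intro!: vector_derivative_at)

lemma curve_length_const_speed:
  assumes "\<And>t. has_mat_derivative a b \<gamma> (\<gamma>' t) (at t)" "\<And>t. sqrt (g (\<gamma>' t) (\<gamma>' t)) = c"
  shows "curve_length a b g \<gamma> = ennreal c"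
proof -
  have "curve_length a b g \<gamma> = (\<integral>\<^sup>+t\<in>{0..1::real}. ennreal c \<partial>lborel)"
    unfolding curve_length_def velocity_eq[OF assms(1)] assms(2) ..
  also have "\<dots> = ennreal c" by (simp add: nn_integral_cmult_indicator)
  finally show ?thesis .
qed

lemma geodesic_dist_le_const_speed:
  assumes "\<And>t. has_mat_derivative a b \<gamma> (\<gamma>' t) (at t)" "\<And>t. sqrt (g (\<gamma>' t) (\<gamma>' t)) = c"
    "\<And>t. \<gamma> t \<in> M" "\<And>i j. i < a \<Longrightarrow> j < b \<Longrightarrow> (\<lambda>t. \<gamma> t $$ (i, j)) C1_differentiable_on UNIV"
  shows "geodesic_dist a b M g (\<gamma> 0) (\<gamma> 1) \<le> ennreal c"
proof -
  have "admissible_curve a b M (\<gamma> 0) (\<gamma> 1) \<gamma>"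
    using assms(3,4) unfolding admissible_curve_def
    by (auto intro!: C1_differentiable_imp_piecewise intro: C1_differentiable_on_subset)
  then show ?thesis unfolding geodesic_dist_def
    using curve_length_const_speed[of a b \<gamma> \<gamma>' g c] assms(1,2) by (intro INF_lower2[of \<gamma>]) auto
qed

text \<open>The interface between explicit formulas and Riemannian statements; S is the constant
  Gram matrix of the velocity. It is instantiated for a prescribed initial velocity and for
  prescribed principal angles.\<close>

locale horizontal_geodesic =
  fixes n q :: nat and f f' f'' :: "real \<Rightarrow> real mat" and S :: "real mat"
  assumes stiefel: "f t \<in> stiefel n q"
    and deriv: "has_mat_derivative n q f (f' t) (at t)"
    and deriv2: "has_mat_derivative n q f' (f'' t) (at t)"
    and C1: "\<And>i j. i < n \<Longrightarrow> j < q \<Longrightarrow> (\<lambda>t. f t $$ (i, j)) C1_differentiable_on UNIV"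
    and horizontal: "transpose_mat (f t) * f' t = 0\<^sub>m q q"
    and speed: "transpose_mat (f' t) * f' t = S"
    and accel: "f'' t = - (f t * S)"
begin

definition proj where "proj t = f t * transpose_mat (f t)"
definition proj' where "proj' t = f' t * transpose_mat (f t) + f t * transpose_mat (f' t)"

lemma dims [simp]:
  "dim_row (f t) = n" "dim_col (f t) = q" "dim_row (f' t) = n" "dim_col (f' t) = q"
  "dim_row (f'' t) = n" "dim_col (f'' t) = q" "dim_row S = q" "dim_col S = q"
  using stiefelD[OF stiefel] has_mat_derivative_carrier[OF deriv, of t] has_mat_derivative_carrier[OF deriv2, of t]
    arg_cong[OF speed[of t], of dim_row] arg_cong[OF speed[of t], of dim_col]
  by auto

lemma carriers [simp]: "f t \<in> carrier_mat n q" "f' t \<in> carrier_mat n q" "f'' t \<in> carrier_mat n q"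
  by (auto intro: carrier_matI)

lemma orth: "transpose_mat (f t) * f t = 1\<^sub>m q"
  using stiefelD(4)[OF stiefel] .

lemma S_symmetric: "transpose_mat S = S"
  using speed[of 0] by (auto simp: mat_algebra simp flip: speed[of 0])

lemma horizontal': "transpose_mat (f' t) * f t = 0\<^sub>m q q"
  using arg_cong[OF horizontal[of t], of transpose_mat] by (simp add: mat_algebra)

lemma derivs_within: "has_mat_derivative n q f (f' t) (at t within T)" "has_mat_derivative n q f' (f'' t) (at t within T)"
  using has_mat_derivative_within_subset[OF deriv, of T t] has_mat_derivative_within_subset[OF deriv2, of T t] by auto

text \<open>The acceleration - f S pairs with a tangent vector D, up to sign, as the trace of the
  symmetric S times the skew matrix \<open>f\<^sup>T D\<close>, which is zero.\<close>

lemma stiefel_geodesic: "is_geodesic n q (stiefel n q) stiefel_metric f f'"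
  unfolding is_geodesic_def
proof (intro exI[of _ f''] ballI conjI)
  fix t D assume D: "D \<in> tangent_space n q (stiefel n q) (f t)"
  note Dt = stiefel_tangent_skew[OF D]
  note d = carrier_matD[OF Dt(1)]
  let ?B = "transpose_mat (f t) * D"
  have "mat_trace (S * ?B) = mat_trace (transpose_mat (S * ?B))"
    using d by (subst mat_trace_transpose) auto
  also have "\<dots> = - mat_trace (?B * S)"
    using d Dt(2) by (simp add: mat_algebra S_symmetric mat_trace_simps)
  also have "mat_trace (?B * S) = mat_trace (S * ?B)" using d by (intro mat_trace_comm) auto
  finally show "stiefel_metric (f'' t) D = 0"
    using d by (simp add: stiefel_metric_def accel mat_algebra mat_trace_simps S_symmetric)
qed (use stiefel derivs_within in auto)

lemma proj_grassmann: "proj t \<in> grassmann n q"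
  unfolding proj_def by (rule frame_projector_in_grassmann[OF stiefel])

lemma proj_deriv: "has_mat_derivative n n proj (proj' t) (at t within UNIV)"
  unfolding proj_def proj'_def
  by (intro has_mat_derivative_mult[where b = q] has_mat_derivative_transpose deriv) auto

lemma proj_deriv2:
  "has_mat_derivative n n proj' ((f'' t * transpose_mat (f t) + f' t * transpose_mat (f' t))
    + (f' t * transpose_mat (f' t) + f t * transpose_mat (f'' t))) (at t within UNIV)"
  unfolding proj'_def
  by (intro has_mat_derivative_add has_mat_derivative_mult[where b = q] has_mat_derivative_transpose deriv deriv2
    mult_carrier_mat[of _ n q] transpose_carrier_mat[THEN iffD2]) auto

lemma proj_C1: "i < n \<Longrightarrow> j < n \<Longrightarrow> (\<lambda>t. proj t $$ (i, j)) C1_differentiable_on UNIV"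
  unfolding proj_def by (rule mat_mult_C1[of n q _ _ n]) (use C1 mat_transpose_C1[of n q f] in auto)

lemma proj_tangent: "proj' t \<in> tangent_space n n (grassmann n q) (proj t)"
  unfolding tangent_space_def
\<comment> \<open>\<open>tangent_space\<close> asks for a curve that passes through the point at
  time 0, hence the shift by t.\<close>
proof (intro CollectI exI[of _ "\<lambda>s. proj (s + t)"] exI[of _ 1] conjI ballI allI impI)
  fix i j assume ij: "i < n" "j < n"
  obtain D where D: "\<And>x. ((\<lambda>t. proj t $$ (i, j)) has_vector_derivative D x) (at x)" "continuous_on UNIV D"
    using proj_C1[OF ij] by (auto simp: C1_differentiable_on_def)
  have "((\<lambda>s. proj (s + t) $$ (i, j)) has_vector_derivative D (x + t)) (at x)" for x
    using iffD1[OF DERIV_shift D(1)[of "x + t", folded has_real_derivative_iff_has_vector_derivative]]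
    unfolding has_real_derivative_iff_has_vector_derivative .
  then show "(\<lambda>s. proj (s + t) $$ (i, j)) C1_differentiable_on {- 1<..<1}"
    unfolding C1_differentiable_on_def
    by (intro exI[of _ "\<lambda>x. D (x + t)"]) (auto intro!: continuous_on_compose2[OF D(2)] continuous_intros)
next
  have pd: "has_mat_derivative n n proj (proj' t) (at (0 + t))" using proj_deriv by simp
  have "((\<lambda>s. proj (s + t) $$ (i, j)) has_real_derivative proj' t $$ (i, j)) (at 0)" if "i < n" "j < n" for i j
    by (rule iffD1[OF DERIV_shift[of "\<lambda>s. proj s $$ (i, j)"]])
       (use pd that in \<open>simp add: has_mat_derivative_def\<close>)
  then show "has_mat_derivative n n (\<lambda>s. proj (s + t)) (proj' t) (at 0)"
    using has_mat_derivative_carrier[OF pd] by (simp add: has_mat_derivative_def)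
qed (use proj_grassmann in auto)

text \<open>The acceleration \<open>- 2 f S f\<^sup>T + 2 f' f'\<^sup>T\<close> is block diagonal
  with respect to the projector, whereas tangent vectors are block off-diagonal.\<close>

lemma proj_geodesic: "is_geodesic n n (grassmann n q) grassmann_metric proj proj'"
  unfolding is_geodesic_def
proof (intro exI ballI conjI)
  fix t :: real assume "t \<in> {0..1}"
  show "has_mat_derivative n n proj (proj' t) (at t within {0..1})"
    using has_mat_derivative_within_subset[OF proj_deriv] by auto
  show "has_mat_derivative n n proj' ((f'' t * transpose_mat (f t) + f' t * transpose_mat (f' t))
    + (f' t * transpose_mat (f' t) + f t * transpose_mat (f'' t))) (at t within {0..1})"
    using has_mat_derivative_within_subset[OF proj_deriv2] by auto
  fix D assume "D \<in> tangent_space n n (grassmann n q) (proj t)"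
  note Dt = grassmann_tangent[OF this]
  note d = carrier_matD[OF Dt(1)]
  have z: "transpose_mat (f' t) * (D * f' t) = 0\<^sub>m q q"
    using d arg_cong[OF Dt(3), of "\<lambda>X. transpose_mat (f' t) * X * f' t"]
    by (simp add: proj_def mat_algebra horizontal horizontal' mult_left_eq[OF horizontal'])
  have z': "transpose_mat (f t) * (D * f t) = 0\<^sub>m q q"
  proof -
    have e: "transpose_mat (f t) * (D * f t) + transpose_mat (f t) * (D * f t) = transpose_mat (f t) * (D * f t)"
      using d arg_cong[OF Dt(3), of "\<lambda>X. transpose_mat (f t) * X * f t"]
      by (simp add: proj_def mat_algebra orth mult_left_eq[OF orth])
    show ?thesis
    proof (rule eq_matI)
      fix i j assume "i < dim_row (0\<^sub>m q q :: real mat)" "j < dim_col (0\<^sub>m q q :: real mat)"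
      then show "(transpose_mat (f t) * (D * f t)) $$ (i, j) = 0\<^sub>m q q $$ (i, j)"
        using arg_cong[OF e, of "\<lambda>M. M $$ (i, j)"] d by (simp del: index_mult_mat(1))
    qed (use d in auto)
  qed
  have 1: "mat_trace (f t * (S * (transpose_mat (f t) * D))) = 0"
    using d z' by (subst mat_trace_comm) (auto simp: mat_algebra mat_trace_simps)
  have 2: "mat_trace (f' t * (transpose_mat (f' t) * D)) = 0"
    using d z by (subst mat_trace_comm) (auto simp: mat_algebra mat_trace_simps)
  show "grassmann_metric ((f'' t * transpose_mat (f t) + f' t * transpose_mat (f' t))
    + (f' t * transpose_mat (f' t) + f t * transpose_mat (f'' t))) D = 0"
    using d 1 2 by (simp add: grassmann_metric_def accel mat_algebra mat_trace_simps S_symmetric)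
qed (use proj_grassmann in auto)

lemma stiefel_exp_eq: "stiefel_exp n q (f 0) (f' 0) = f 1"
  unfolding stiefel_exp_def riem_exp_def
proof (rule the_equality)
  show "\<exists>\<gamma> \<gamma>'. is_geodesic n q (stiefel n q) stiefel_metric \<gamma> \<gamma>' \<and> \<gamma> 0 = f 0 \<and> \<gamma>' 0 = f' 0 \<and> \<gamma> 1 = f 1"
    using stiefel_geodesic by blast
qed (use stiefel_geodesic stiefel_geodesic_unique in metis)

lemma grassmann_exp_eq: "riem_exp n n (grassmann n q) grassmann_metric (proj 0) (proj' 0) = proj 1"
  unfolding riem_exp_def
proof (rule the_equality)
  show "\<exists>\<gamma> \<gamma>'. is_geodesic n n (grassmann n q) grassmann_metric \<gamma> \<gamma>' \<and> \<gamma> 0 = proj 0 \<and> \<gamma>' 0 = proj' 0 \<and> \<gamma> 1 = proj 1"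
    using proj_geodesic by blast
qed (use proj_geodesic grassmann_geodesic_unique in metis)

text \<open>In the square of \<open>proj'\<close> two products survive, each with trace tr S; the
  factor 1/2 in \<open>grassmann_metric\<close> makes the projection preserve the speed of a
  horizontal curve.\<close>

lemma grassmann_norm_proj': "grassmann_metric (proj' t) (proj' t) = mat_trace S"
proof -
  have 1: "mat_trace (f' t * transpose_mat (f' t)) = mat_trace S"
    by (subst mat_trace_comm) (auto simp: speed)
  have 2: "mat_trace (f t * (S * transpose_mat (f t))) = mat_trace S"
    by (subst mat_trace_comm) (auto simp: mat_algebra orth)
  show ?thesis unfolding grassmann_metric_def proj'_def
    by (simp add: mat_algebra mat_trace_simps horizontal horizontal' orth mult_left_eq[OF horizontal] mult_left_eq[OF horizontal']
      mult_left_eq[OF orth] mult_left_eq[OF speed] 1 2)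
qed

lemma stiefel_dist_le: "stiefel_dist n q (f 0) (f 1) \<le> ennreal (sqrt (mat_trace S))"
  unfolding stiefel_dist_def
  by (rule geodesic_dist_le_const_speed[OF deriv]) (use speed stiefel C1 in \<open>auto simp: stiefel_metric_def\<close>)

lemma grassmann_dist_le:
  "geodesic_dist n n (grassmann n q) grassmann_metric (proj 0) (proj 1) \<le> ennreal (sqrt (mat_trace S))"
  by (rule geodesic_dist_le_const_speed[of _ _ _ proj'])
     (use proj_deriv proj_grassmann proj_C1 grassmann_norm_proj' in auto)

end

lemma mat_diag_mult_assoc: "dim_row X = q \<Longrightarrow> mat_diag q f * (mat_diag q g * X) = mat_diag q (\<lambda>i. f i * g i) * (X :: real mat)"
  by (simp add: mult_left_eq[OF mat_diag_diag])

lemma transpose_mat_diag [simp]: "transpose_mat (mat_diag q f) = mat_diag q f"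
  by (rule eq_matI) (auto simp: mat_diag_def)

lemma mat_diag_cong: "(\<And>i. i < q \<Longrightarrow> f i = g i) \<Longrightarrow> mat_diag q f = mat_diag q g"
  by (rule eq_matI) (auto simp: mat_diag_def)

lemma has_mat_derivative_mat_diag:
  "(\<And>i. i < q \<Longrightarrow> ((\<lambda>t. d t i) has_real_derivative d' i) (at t within S)) \<Longrightarrow>
    has_mat_derivative q q (\<lambda>t. mat_diag q (d t)) (mat_diag q d') (at t within S)"
  by (auto simp: has_mat_derivative_def) (auto simp: mat_diag_def)

text \<open>Each column of U turns by the angle \<open>\<theta> i * t\<close> towards the
  corresponding column of H, and V rotates the result back to the frame of interest. For
  \<open>\<theta> i = 0\<close> there is no direction to turn to: that column of H is zero, and its
  sine factor vanishes.\<close>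

lemma horizontal_geodesic_explicit:
  fixes U H V :: "real mat" and \<theta> :: "nat \<Rightarrow> real"
  assumes U: "U \<in> stiefel n q" and H: "H \<in> carrier_mat n q" "transpose_mat U * H = 0\<^sub>m q q"
      "transpose_mat H * H = mat_diag q (\<lambda>i. if \<theta> i = 0 then 0 else 1)"
    and V: "V \<in> carrier_mat q q" "transpose_mat V * V = 1\<^sub>m q" "V * transpose_mat V = 1\<^sub>m q"
  defines "S \<equiv> transpose_mat V * mat_diag q (\<lambda>i. \<theta> i * \<theta> i) * V"
    and "f \<equiv> \<lambda>t. (U * mat_diag q (\<lambda>i. cos (\<theta> i * t)) + H * mat_diag q (\<lambda>i. sin (\<theta> i * t))) * V"
    and "f' \<equiv> \<lambda>t. (H * mat_diag q (\<lambda>i. \<theta> i * cos (\<theta> i * t)) - U * mat_diag q (\<lambda>i. \<theta> i * sin (\<theta> i * t))) * V"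
  shows "horizontal_geodesic n q f f' (\<lambda>t. - (f t * S)) S"
proof
  fix t :: real
  note d = stiefelD(2,3)[OF U] carrier_matD[OF H(1)] carrier_matD[OF V(1)]
  note UU = stiefelD(4)[OF U]
  have HU: "transpose_mat H * U = 0\<^sub>m q q"
    using arg_cong[OF H(2), of transpose_mat] d by (simp add: mat_algebra)
  note rules = mat_algebra UU H(2,3) HU mult_left_eq[OF UU] mult_left_eq[OF HU] mult_left_eq[OF H(2)] mult_left_eq[OF H(3)]
    mult_left_eq[OF V(3)] mat_diag_mult_assoc
  have c: "f t \<in> carrier_mat n q" "f' t \<in> carrier_mat n q" for t
    using d by (auto simp: f_def f'_def)
  have diag_add: "mat_diag q g + mat_diag q h = mat_diag q (\<lambda>i. g i + h i)" for g h :: "nat \<Rightarrow> real"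
    by (rule eq_matI) (auto simp: mat_diag_def)
  have trig: "cos (\<theta> i * t) * cos (\<theta> i * t) + sin (\<theta> i * t) * sin (\<theta> i * t) = 1" for i t
    using sin_cos_squared_add2[of "\<theta> i * t"] by (simp add: power2_eq_square)
  show "f t \<in> stiefel n q"
  proof -
    have "transpose_mat (f t) * f t = transpose_mat V * ((mat_diag q (\<lambda>i. cos (\<theta> i * t) * cos (\<theta> i * t))
        + mat_diag q (\<lambda>i. sin (\<theta> i * t) * ((if \<theta> i = 0 then 0 else 1) * sin (\<theta> i * t)))) * V)"
      using d unfolding f_def by (simp add: rules)
    also have "mat_diag q (\<lambda>i. cos (\<theta> i * t) * cos (\<theta> i * t))
        + mat_diag q (\<lambda>i. sin (\<theta> i * t) * ((if \<theta> i = 0 then 0 else 1) * sin (\<theta> i * t))) = 1\<^sub>m q"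
      unfolding diag_add by (subst mat_diag_one[symmetric], rule mat_diag_cong) (auto simp: trig)
    finally show ?thesis using c d by (simp add: stiefel_def V(2))
  qed
  show "transpose_mat (f t) * f' t = 0\<^sub>m q q"
  proof -
    have "transpose_mat (f t) * f' t = transpose_mat V * ((mat_diag q (\<lambda>i. sin (\<theta> i * t) * ((if \<theta> i = 0 then 0 else 1) * (\<theta> i * cos (\<theta> i * t))))
       - mat_diag q (\<lambda>i. cos (\<theta> i * t) * (\<theta> i * sin (\<theta> i * t)))) * V)"
      using d unfolding f_def f'_def by (simp add: rules)
    also have "mat_diag q (\<lambda>i. sin (\<theta> i * t) * ((if \<theta> i = 0 then 0 else 1) * (\<theta> i * cos (\<theta> i * t))))
       - mat_diag q (\<lambda>i. cos (\<theta> i * t) * (\<theta> i * sin (\<theta> i * t))) = 0\<^sub>m q q"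
      by (rule eq_matI) (auto simp: mat_diag_def)
    finally show ?thesis using d by (simp add: mat_algebra)
  qed
  show "transpose_mat (f' t) * f' t = S"
  proof -
    have "transpose_mat (f' t) * f' t = transpose_mat V * ((mat_diag q (\<lambda>i. (\<theta> i * cos (\<theta> i * t)) * ((if \<theta> i = 0 then 0 else 1) * (\<theta> i * cos (\<theta> i * t))))
       + mat_diag q (\<lambda>i. (\<theta> i * sin (\<theta> i * t)) * (\<theta> i * sin (\<theta> i * t)))) * V)"
      using d unfolding f'_def by (simp add: rules) (rule eq_matI, auto simp del: index_mult_mat(1))
    also have "mat_diag q (\<lambda>i. (\<theta> i * cos (\<theta> i * t)) * ((if \<theta> i = 0 then 0 else 1) * (\<theta> i * cos (\<theta> i * t))))
       + mat_diag q (\<lambda>i. (\<theta> i * sin (\<theta> i * t)) * (\<theta> i * sin (\<theta> i * t))) = mat_diag q (\<lambda>i. \<theta> i * \<theta> i)"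
    proof -
      have "(a * c) * (a * c) + (a * s) * (a * s) = a * a" if "c * c + s * s = 1" for a c s :: real
        using arg_cong[OF that, of "\<lambda>x. a * a * x"] by (simp add: algebra_simps)
      then show ?thesis unfolding diag_add using trig by (intro mat_diag_cong) auto
    qed
    finally show ?thesis using d by (simp add: S_def mat_algebra)
  qed
  define C where "C = (\<lambda>t. mat_diag q (\<lambda>i. cos (\<theta> i * t)))"
  define Sn where "Sn = (\<lambda>t. mat_diag q (\<lambda>i. sin (\<theta> i * t)))"
  define C' where "C' = (\<lambda>t. mat_diag q (\<lambda>i. \<theta> i * cos (\<theta> i * t)))"
  define Sn' where "Sn' = (\<lambda>t. mat_diag q (\<lambda>i. \<theta> i * sin (\<theta> i * t)))"
  have CS [simp]: "C t \<in> carrier_mat q q" "Sn t \<in> carrier_mat q q" "C' t \<in> carrier_mat q q" "Sn' t \<in> carrier_mat q q" for t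
    by (simp_all add: C_def Sn_def C'_def Sn'_def)
  note CSd [simp] = carrier_matD[OF CS(1)] carrier_matD[OF CS(2)] carrier_matD[OF CS(3)] carrier_matD[OF CS(4)]
  have f_eq: "f = (\<lambda>t. (U * C t + H * Sn t) * V)" and f'_eq: "f' = (\<lambda>t. (H * C' t - U * Sn' t) * V)"
    by (simp_all add: f_def f'_def C_def Sn_def C'_def Sn'_def)
  have dC: "has_mat_derivative q q C (mat_diag q (\<lambda>i. - (\<theta> i * sin (\<theta> i * t)))) (at t within UNIV)"
    unfolding C_def by (rule has_mat_derivative_mat_diag) (auto intro!: derivative_eq_intros)
  have dS: "has_mat_derivative q q Sn (C' t) (at t within UNIV)"
    unfolding Sn_def C'_def by (rule has_mat_derivative_mat_diag) (auto intro!: derivative_eq_intros)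
  have dC': "has_mat_derivative q q C' (mat_diag q (\<lambda>i. - (sin (\<theta> i * t) * (\<theta> i * \<theta> i)))) (at t within UNIV)"
    unfolding C'_def by (rule has_mat_derivative_mat_diag) (auto intro!: derivative_eq_intros)
  have dS': "has_mat_derivative q q Sn' (mat_diag q (\<lambda>i. cos (\<theta> i * t) * (\<theta> i * \<theta> i))) (at t within UNIV)"
    unfolding Sn'_def by (rule has_mat_derivative_mat_diag) (auto intro!: derivative_eq_intros)
  have Uc: "U \<in> carrier_mat n q" using U by (simp add: stiefel_def)
  have Cm: "mat_diag q (\<lambda>i. - (\<theta> i * sin (\<theta> i * t))) = - Sn' t"
    by (rule eq_matI) (auto simp: mat_diag_def Sn'_def)
  have C'm: "mat_diag q (\<lambda>i. - (sin (\<theta> i * t) * (\<theta> i * \<theta> i))) = - (Sn t * mat_diag q (\<lambda>i. \<theta> i * \<theta> i))"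
    unfolding Sn_def mat_diag_diag by (rule eq_matI) (auto simp: mat_diag_def)
  have S'm: "mat_diag q (\<lambda>i. cos (\<theta> i * t) * (\<theta> i * \<theta> i)) = C t * mat_diag q (\<lambda>i. \<theta> i * \<theta> i)"
    unfolding C_def mat_diag_diag by simp
  note const = has_mat_derivative_const[where F = "at t within UNIV"]
  show "has_mat_derivative n q f (f' t) (at t)"
  proof -
    have 1: "has_mat_derivative n q (\<lambda>t. U * C t) (0\<^sub>m n q * C t + U * (- Sn' t)) (at t within UNIV)"
      by (rule has_mat_derivative_mult[OF const[OF Uc] dC[unfolded Cm]]) (use Uc in auto)
    have 2: "has_mat_derivative n q (\<lambda>t. H * Sn t) (0\<^sub>m n q * Sn t + H * C' t) (at t within UNIV)"
      by (rule has_mat_derivative_mult[OF const[OF H(1)] dS]) (use H in auto)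
    have 3: "has_mat_derivative n q (\<lambda>t. U * C t + H * Sn t) ((0\<^sub>m n q * C t + U * (- Sn' t)) + (0\<^sub>m n q * Sn t + H * C' t)) (at t within UNIV)"
      by (rule has_mat_derivative_add[OF 1 2]) (use Uc H in auto)
    have 4: "has_mat_derivative n q f (((0\<^sub>m n q * C t + U * (- Sn' t)) + (0\<^sub>m n q * Sn t + H * C' t)) * V
        + (U * C t + H * Sn t) * 0\<^sub>m q q) (at t within UNIV)"
      unfolding f_eq by (rule has_mat_derivative_mult[OF 3 const[OF V(1)]]) (use Uc H V in auto)
    have "((0\<^sub>m n q * C t + U * (- Sn' t)) + (0\<^sub>m n q * Sn t + H * C' t)) * V + (U * C t + H * Sn t) * 0\<^sub>m q q = f' t"
      using d unfolding f'_eq by (simp add: mat_algebra) (rule eq_matI, auto simp del: index_mult_mat(1))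
    then show ?thesis using 4 by simp
  qed
  show "has_mat_derivative n q f' (- (f t * S)) (at t)"
  proof -
    let ?T = "mat_diag q (\<lambda>i. \<theta> i * \<theta> i)"
    have 1: "has_mat_derivative n q (\<lambda>t. H * C' t) (0\<^sub>m n q * C' t + H * (- (Sn t * ?T))) (at t within UNIV)"
      by (rule has_mat_derivative_mult[OF const[OF H(1)] dC'[unfolded C'm]]) (use H in auto)
    have 2: "has_mat_derivative n q (\<lambda>t. U * Sn' t) (0\<^sub>m n q * Sn' t + U * (C t * ?T)) (at t within UNIV)"
      by (rule has_mat_derivative_mult[OF const[OF Uc] dS'[unfolded S'm]]) (use Uc in auto)
    have 3: "has_mat_derivative n q (\<lambda>t. H * C' t - U * Sn' t)
        ((0\<^sub>m n q * C' t + H * (- (Sn t * ?T))) - (0\<^sub>m n q * Sn' t + U * (C t * ?T))) (at t within UNIV)"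
      by (rule has_mat_derivative_minus[OF 1 2]) (use Uc H in auto)
    have 4: "has_mat_derivative n q f' (((0\<^sub>m n q * C' t + H * (- (Sn t * ?T))) - (0\<^sub>m n q * Sn' t + U * (C t * ?T))) * V
        + (H * C' t - U * Sn' t) * 0\<^sub>m q q) (at t within UNIV)"
      unfolding f'_eq by (rule has_mat_derivative_mult[OF 3 const[OF V(1)]]) (use Uc H V in \<open>auto intro!: minus_carrier_mat\<close>)
    have "((0\<^sub>m n q * C' t + H * (- (Sn t * ?T))) - (0\<^sub>m n q * Sn' t + U * (C t * ?T))) * V
        + (H * C' t - U * Sn' t) * 0\<^sub>m q q = - (f t * S)"
      using d unfolding f_eq S_def by (simp add: mat_algebra mult_left_eq[OF V(3)]) (rule eq_matI, auto simp del: index_mult_mat(1))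
    then show ?thesis using 4 by simp
  qed
  show "- (f t * S) = - (f t * S)" ..
  fix i j assume ij: "i < n" "j < q"
  have C1diag: "(\<lambda>t. C t $$ (i, j)) C1_differentiable_on UNIV" "(\<lambda>t. Sn t $$ (i, j)) C1_differentiable_on UNIV"
    if "i < q" "j < q" for i j
    unfolding C_def Sn_def using that C1_differentiable_on_sin_cos[of "\<theta> j" UNIV]
    by (cases "i = j"; simp add: mat_diag_def)+
  have "(\<lambda>t. (U * C t + H * Sn t) $$ (i, j)) C1_differentiable_on UNIV" if "i < n" "j < q" for i j
  proof -
    have "(\<lambda>t. (U * C t) $$ (i, j) + (H * Sn t) $$ (i, j)) C1_differentiable_on UNIV"
      by (intro C1_differentiable_on_add mat_mult_C1[of n q _ _ q]) (use C1diag Uc H that in auto)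
    then show ?thesis using that d by (simp del: index_mult_mat(1))
  qed
  then show "(\<lambda>t. f t $$ (i, j)) C1_differentiable_on UNIV"
    unfolding f_eq by (rule mat_mult_C1[of n q _ _ q]) (use d V ij in \<open>auto simp: Uc H\<close>)
qed

text \<open>This is a singular value decomposition of K: with the eigenvectors Q of
  \<open>K\<^sup>T K\<close> the columns of L = K Q are orthogonal, their lengths \<theta> are the
  angular speeds, and normalizing them gives H.\<close>

lemma horizontal_geodesic_exists:
  assumes U: "U \<in> stiefel n q" and K: "K \<in> carrier_mat n q" "transpose_mat U * K = 0\<^sub>m q q"
  shows "\<exists>f f' f''. horizontal_geodesic n q f f' f'' (transpose_mat K * K) \<and> f 0 = U \<and> f' 0 = K"
proof -
  note d = stiefelD(2,3)[OF U] carrier_matD[OF K(1)]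
  have "transpose_mat K * K \<in> carrier_mat q q" "transpose_mat (transpose_mat K * K) = transpose_mat K * K"
    using d by (auto simp: mat_algebra)
  from symmetric_spectral[OF this] obtain Q e where Q: "Q \<in> carrier_mat q q" "transpose_mat Q * Q = 1\<^sub>m q"
    "Q * transpose_mat Q = 1\<^sub>m q" "transpose_mat K * K = Q * mat_diag q e * transpose_mat Q" by blast
  note d = d carrier_matD[OF Q(1)]
  define L where "L = K * Q"
  have L: "L \<in> carrier_mat n q" using K Q by (auto simp: L_def)
  have LL: "transpose_mat L * L = mat_diag q e"
    unfolding L_def using d by (simp add: mat_algebra mult_left_eq[OF Q(4)]) (simp add: mat_algebra Q(2) mult_left_eq[OF Q(2)])
  have e: "e i = (\<Sum>k<n. (L $$ (k, i))\<^sup>2)" if "i < q" for i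
    using arg_cong[OF LL, of "\<lambda>M. M $$ (i, i)"] that L
    by (simp add: mat_mult_index power2_eq_square del: index_mult_mat(1)) (simp add: mat_diag_def)
  have e0: "0 \<le> e i" if "i < q" for i unfolding e[OF that] by (intro sum_nonneg) auto
  have L0: "L $$ (k, i) = 0" if "i < q" "k < n" "e i = 0" for i k
    using that e[OF that(1)] by (simp add: sum_nonneg_eq_0_iff)
  define \<theta> where "\<theta> = (\<lambda>i. sqrt (e i))"
  \<comment> \<open>For \<open>\<theta> i = 0\<close> the value \<open>1 / 0 = 0\<close> yields a
    zero column, as the explicit formula requires.\<close>
  define H where "H = L * mat_diag q (\<lambda>i. 1 / \<theta> i)"
  have H: "H \<in> carrier_mat n q" using L by (auto simp: H_def)
  have UH: "transpose_mat U * H = 0\<^sub>m q q"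
    unfolding H_def L_def using d by (simp add: mat_algebra mult_left_eq[OF K(2)])
  have HH: "transpose_mat H * H = mat_diag q (\<lambda>i. if \<theta> i = 0 then 0 else 1)"
    unfolding H_def using L
    by (auto simp: mat_algebra mult_left_eq[OF LL] mat_diag_mult_assoc)
       (rule mat_diag_cong, use e0 in \<open>auto simp: \<theta>_def field_simps real_sqrt_mult_self\<close>)
  have HT: "H * mat_diag q \<theta> = L"
    unfolding H_def using L by (simp add: mat_algebra)
      (subst mat_diag_mult_right, simp, rule eq_matI, use L0 e0 in \<open>auto simp: \<theta>_def\<close>)
  have V: "transpose_mat Q \<in> carrier_mat q q" "transpose_mat (transpose_mat Q) * transpose_mat Q = 1\<^sub>m q"
    "transpose_mat Q * transpose_mat (transpose_mat Q) = 1\<^sub>m q" using Q by auto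
  have UQ: "U * Q \<in> stiefel n q"
    using d stiefelD(4)[OF U] by (auto simp: stiefel_def mat_algebra mult_left_eq[OF stiefelD(4)[OF U]] Q(2))
  have UQH: "transpose_mat (U * Q) * H = 0\<^sub>m q q" using d H UH by (simp add: mat_algebra)
  from horizontal_geodesic_explicit[OF UQ H UQH HH V]
  have "horizontal_geodesic n q
     (\<lambda>t. (U * Q * mat_diag q (\<lambda>i. cos (\<theta> i * t)) + H * mat_diag q (\<lambda>i. sin (\<theta> i * t))) * transpose_mat Q)
     (\<lambda>t. (H * mat_diag q (\<lambda>i. \<theta> i * cos (\<theta> i * t)) - U * Q * mat_diag q (\<lambda>i. \<theta> i * sin (\<theta> i * t))) * transpose_mat Q)
     (\<lambda>t. - ((U * Q * mat_diag q (\<lambda>i. cos (\<theta> i * t)) + H * mat_diag q (\<lambda>i. sin (\<theta> i * t))) * transpose_mat Q *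
       (transpose_mat (transpose_mat Q) * mat_diag q (\<lambda>i. \<theta> i * \<theta> i) * transpose_mat Q)))
     (transpose_mat (transpose_mat Q) * mat_diag q (\<lambda>i. \<theta> i * \<theta> i) * transpose_mat Q)" .
  moreover have "transpose_mat (transpose_mat Q) * mat_diag q (\<lambda>i. \<theta> i * \<theta> i) * transpose_mat Q = transpose_mat K * K"
    unfolding Q(4) using mat_diag_cong[of q "\<lambda>i. \<theta> i * \<theta> i" e] e0 by (simp add: \<theta>_def)
  moreover have zero: "mat_diag q (\<lambda>i. 0) = (0\<^sub>m q q :: real mat)" by (rule eq_matI) (auto simp: mat_diag_def)
  have "(U * Q * mat_diag q (\<lambda>i. cos (\<theta> i * 0)) + H * mat_diag q (\<lambda>i. sin (\<theta> i * 0))) * transpose_mat Q = U"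
    using d H by (simp add: mat_algebra zero Q(3))
  moreover have "(H * mat_diag q (\<lambda>i. \<theta> i * cos (\<theta> i * 0)) - U * Q * mat_diag q (\<lambda>i. \<theta> i * sin (\<theta> i * 0))) * transpose_mat Q = K"
  proof -
    have "(H * mat_diag q (\<lambda>i. \<theta> i * cos (\<theta> i * 0)) - U * Q * mat_diag q (\<lambda>i. \<theta> i * sin (\<theta> i * 0))) = L"
      using d H HT L by (simp add: zero mat_algebra) (rule eq_matI, auto)
    then show ?thesis using d by (simp add: L_def mat_algebra Q(3))
  qed
  ultimately show ?thesis by (intro exI) auto
qed

section \<open>A lower bound for lengths in the Grassmannian\<close>

text \<open>The last hypothesis bounds the derivative of sqrt F by v, but sqrt F need not be
  differentiable where F vanishes, and F vanishes at time 0. The substitute sqrt (F + e^2) obeys the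
  same bound and can be integrated; then e tends to 0.\<close>

lemma sqrt_le_nn_integral_speed:
  fixes F F' v :: "real \<Rightarrow> real"
  assumes fin: "finite S" and F: "continuous_on {0..1} F" "\<And>t. t \<in> {0..1} \<Longrightarrow> 0 \<le> F t" "F 0 = 0"
    and F': "\<And>t. t \<in> {0<..<1} - S \<Longrightarrow> (F has_real_derivative F' t) (at t)"
    and v: "continuous_on ({0<..<1} - S) v" "\<And>t. t \<in> {0<..<1} - S \<Longrightarrow> 0 \<le> v t"
    and bound: "\<And>t. t \<in> {0<..<1} - S \<Longrightarrow> (F' t)\<^sup>2 \<le> 4 * (v t)\<^sup>2 * F t"
  shows "ennreal (sqrt (F 1)) \<le> (\<integral>\<^sup>+t\<in>{0..1}. ennreal (v t) \<partial>lborel)"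
proof (cases "(\<integral>\<^sup>+t\<in>{0..1}. ennreal (v t) \<partial>lborel)")
  case top
  then show ?thesis by simp
next
  case (real r)
  let ?T = "{0<..<1} - S"
  \<comment> \<open>Extension by zero makes v measurable on the whole line; the exceptional set is
    finite, so the integral over the unit interval does not change.\<close>
  define w where "w = (\<lambda>t. indicator ?T t *\<^sub>R v t)"
  have wm: "w \<in> borel_measurable borel"
    unfolding w_def
    by (intro borel_measurable_continuous_on_indicator v(1) borel_open open_Diff finite_imp_closed fin) simp
  have w0: "0 \<le> w t" for t using v(2) by (auto simp: w_def indicator_def)
  have "(\<integral>\<^sup>+t. ennreal (w t) \<partial>lborel) = (\<integral>\<^sup>+t\<in>{0..1}. ennreal (v t) \<partial>lborel)"
  proof (rule nn_integral_cong_AE)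
    have "AE t in lborel. t \<notin> S \<union> {0, 1}"
      using fin by (intro AE_not_in finite_imp_null_set_lborel) auto
    then show "AE t in lborel. ennreal (w t) = ennreal (v t) * indicator {0..1} t"
      by (rule eventually_mono) (auto simp: w_def indicator_def)
  qed
  then have wi: "(w has_integral r) UNIV"
    using nn_integral_has_integral[OF wm w0, of r] real by simp
  have "(w has_integral r) {0..1}"
  proof -
    have "(\<lambda>t. if t \<in> {0..1} then w t else 0) = w"
    proof
      fix t show "(if t \<in> {0..1} then w t else 0) = w t" by (cases "t \<in> {0..1}") (auto simp: w_def indicator_def)
    qed
    then show ?thesis using wi has_integral_restrict[OF subset_UNIV, of "{0..1}" w r] by (simp only:)
  qed
  have "sqrt (F 1) \<le> r + e" if e: "0 < e" for e
  proof -
    let ?G = "\<lambda>t. sqrt (F t + e\<^sup>2)"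
    have pos: "0 < F t + e\<^sup>2" if "t \<in> {0..1}" for t using F(2)[OF that] zero_less_power[OF e, of 2] by linarith
    have I: "((\<lambda>t. F' t / (2 * ?G t)) has_integral (?G 1 - ?G 0)) {0..1}"
    proof (rule fundamental_theorem_of_calculus_interior_strong[OF fin])
      fix t assume t: "t \<in> {0<..<1} - S"
      have "((\<lambda>t. F t + e\<^sup>2) has_real_derivative F' t) (at t)"
        using DERIV_add[OF F'[OF t] DERIV_const[of "e\<^sup>2"]] by simp
      from DERIV_chain2[OF DERIV_real_sqrt[OF pos[of t]] this] t
      have "(?G has_real_derivative inverse (sqrt (F t + e\<^sup>2)) / 2 * F' t) (at t)" by simp
      then show "(?G has_vector_derivative F' t / (2 * ?G t)) (at t)"
        unfolding has_real_derivative_iff_has_vector_derivative[symmetric]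
        by (rule DERIV_cong) (simp add: field_simps)
    qed (auto intro!: continuous_intros F(1))
    have "?G 1 - ?G 0 \<le> r"
    proof (rule has_integral_le[OF has_integral_spike_finite[OF _ _ I] \<open>(w has_integral r) {0..1}\<close>])
      show "finite (S \<union> {0, 1})" using fin by simp
      show "(if t \<in> S \<union> {0, 1} then 0 else F' t / (2 * ?G t)) = F' t / (2 * ?G t)" if "t \<in> {0..1} - (S \<union> {0, 1})" for t
        using that by simp
      show "(if t \<in> S \<union> {0, 1} then 0 else F' t / (2 * ?G t)) \<le> w t" if t: "t \<in> {0..1}" for t
      proof (cases "t \<in> S \<union> {0, 1}")
        case False
        then have tT: "t \<in> ?T" using t by auto
        have "F t \<le> F t + e\<^sup>2" by simp
        then have "(F' t)\<^sup>2 \<le> 4 * (v t)\<^sup>2 * (F t + e\<^sup>2)"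
          by (intro order_trans[OF bound[OF tT]] mult_left_mono) auto
        also have "\<dots> = (2 * v t * ?G t)\<^sup>2"
          unfolding power_mult_distrib real_sqrt_pow2[OF less_imp_le[OF pos[OF t]]] by simp
        finally have "(F' t)\<^sup>2 \<le> (2 * v t * ?G t)\<^sup>2" .
        moreover have G: "0 < ?G t" using pos[OF t] by (rule real_sqrt_gt_zero)
        ultimately have "F' t \<le> 2 * v t * ?G t"
          using v(2)[OF tT] by (intro power2_le_imp_le[of "F' t"]) simp_all
        then have "F' t \<le> v t * (2 * ?G t)" by (simp only: mult_ac)
        then have "F' t / (2 * ?G t) \<le> v t"
          using G by (subst pos_divide_le_eq) simp_all
        moreover have "w t = v t" using tT by (simp add: w_def)
        ultimately show ?thesis using False by (simp only: if_False)
      qed (use w0 in auto)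
    qed
    moreover have "?G 0 = e" unfolding F(3) using e by simp
    moreover have "sqrt (F 1) \<le> ?G 1" unfolding real_sqrt_le_iff by simp
    ultimately show ?thesis by linarith
  qed
  then have "sqrt (F 1) \<le> r" by (rule field_le_epsilon)
  then show ?thesis using real by (simp add: ennreal_leI)
qed

section \<open>Powers of matrices and traces of polynomials in a matrix\<close>

lemma pow_mat_dims [simp]: "A \<in> carrier_mat n n \<Longrightarrow> dim_row (A ^\<^sub>m k) = n" "A \<in> carrier_mat n n \<Longrightarrow> dim_col (A ^\<^sub>m k) = n"
  by (cases k; simp)+

lemma pow_mat_carrier' [simp]: "A \<in> carrier_mat n n \<Longrightarrow> A ^\<^sub>m k \<in> carrier_mat n n"
  by (auto intro: carrier_matI)

lemma pow_mat_add:
  fixes A :: "real mat"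
  assumes A: "A \<in> carrier_mat n n"
  shows "A ^\<^sub>m (j + k) = A ^\<^sub>m j * A ^\<^sub>m k"
  by (induction k) (use A in \<open>simp_all add: mat_algebra\<close>)

lemma pow_mat_Suc_left:
  fixes A :: "real mat"
  assumes A: "A \<in> carrier_mat n n"
  shows "A ^\<^sub>m Suc k = A * A ^\<^sub>m k"
  using pow_mat_add[OF A, of 1 k] A by (simp add: mat_algebra)

lemma pow_mat_transpose:
  fixes A :: "real mat"
  assumes A: "A \<in> carrier_mat n n" "transpose_mat A = A"
  shows "transpose_mat (A ^\<^sub>m k) = A ^\<^sub>m k"
proof (induction k)
  case (Suc k)
  then show ?case using pow_mat_Suc_left[OF A(1), of k] A by (simp add: mat_algebra)
qed (use A in simp)

text \<open>A power of a Gram matrix is again a Gram matrix: of \<open>A ^\<^sub>m m\<close> for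
  even and of \<open>B * A ^\<^sub>m m\<close> for odd exponents.\<close>

lemma mat_trace_pow_nonneg:
  fixes A B :: "real mat"
  assumes B: "B \<in> carrier_mat n n" and A: "A = transpose_mat B * B"
  shows "0 \<le> mat_trace (A ^\<^sub>m k)"
proof -
  have Ac: "A \<in> carrier_mat n n" "transpose_mat A = A" using B by (auto simp: A mat_algebra)
  note d = carrier_matD[OF B]
  show ?thesis
  proof (cases "even k")
    case True
    then obtain m where k: "k = m + m" by (metis evenE mult_2)
    have "A ^\<^sub>m k = transpose_mat (A ^\<^sub>m m) * A ^\<^sub>m m"
      by (simp add: k pow_mat_add[OF Ac(1)] pow_mat_transpose[OF Ac])
    then show ?thesis using mat_trace_square_nonneg by simp
  next
    case False
    then obtain m where k: "k = m + Suc m" by (metis oddE mult_2 add_Suc_right Suc_eq_plus1)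
    have "A ^\<^sub>m k = A ^\<^sub>m m * (transpose_mat B * B * A ^\<^sub>m m)"
      unfolding k pow_mat_add[OF Ac(1)] pow_mat_Suc_left[OF Ac(1)] by (simp add: A)
    also have "\<dots> = transpose_mat (B * A ^\<^sub>m m) * (B * A ^\<^sub>m m)"
      using d Ac by (simp add: mat_algebra pow_mat_transpose[OF Ac])
    finally show ?thesis using mat_trace_square_nonneg by simp
  qed
qed

text \<open>The derivative of a power is a sum of products with D in every position. A and D need
  not commute, but all these products have the same trace by cyclicity.\<close>

lemma mat_trace_pow_deriv:
  fixes A :: "real \<Rightarrow> real mat"
  assumes D: "has_mat_derivative n n A D (at t within S)" and c: "\<And>s. s \<in> S \<Longrightarrow> A s \<in> carrier_mat n n" and t: "t \<in> S"
  shows "((\<lambda>s. mat_trace (A s ^\<^sub>m Suc k)) has_real_derivative (real k + 1) * mat_trace (A t ^\<^sub>m k * D)) (at t within S)"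
proof -
  have Dc: "D \<in> carrier_mat n n" using has_mat_derivative_carrier[OF D] .
  note d = carrier_matD[OF Dc] carrier_matD[OF c[OF t]]
  \<comment> \<open>The induction needs an arbitrary power in front: the product rule puts one more
    factor A on the right, and cyclicity moves it to the left.\<close>
  have "\<exists>E. has_mat_derivative n n (\<lambda>s. A s ^\<^sub>m Suc k) E (at t within S) \<and>
      (\<forall>j. mat_trace (A t ^\<^sub>m j * E) = (real k + 1) * mat_trace (A t ^\<^sub>m (j + k) * D))"
  proof (induction k)
    case 0
    have "has_mat_derivative n n (\<lambda>s. A s ^\<^sub>m Suc 0) D (at t within S)"
      by (rule has_mat_derivative_cong[OF D _ t]) (use c in \<open>auto simp: mat_algebra\<close>)
    then show ?case by auto
  next
    case (Suc k)
    then obtain E where E: "has_mat_derivative n n (\<lambda>s. A s ^\<^sub>m Suc k) E (at t within S)"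
      "\<And>j. mat_trace (A t ^\<^sub>m j * E) = (real k + 1) * mat_trace (A t ^\<^sub>m (j + k) * D)" by blast
    have Ec: "E \<in> carrier_mat n n" using has_mat_derivative_carrier[OF E(1)] .
    note d = d carrier_matD[OF Ec]
    have "has_mat_derivative n n (\<lambda>s. A s ^\<^sub>m Suc (Suc k)) (E * A t + A t ^\<^sub>m Suc k * D) (at t within S)"
      by (rule has_mat_derivative_cong[OF has_mat_derivative_mult[OF E(1) D]]) (use c t pow_mat_carrier'[OF c] in \<open>auto simp del: pow_mat.simps(2) simp: pow_mat.simps(2)[of _ "Suc k"]\<close>)
    moreover have "mat_trace (A t ^\<^sub>m j * (E * A t + A t ^\<^sub>m Suc k * D)) = (real (Suc k) + 1) * mat_trace (A t ^\<^sub>m (j + Suc k) * D)" for j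
    proof -
      have "mat_trace (A t ^\<^sub>m j * (E * A t)) = mat_trace (A t * (A t ^\<^sub>m j * E))"
        using d c[OF t] by (subst mat_trace_comm[of "A t"]) (auto simp: mat_algebra)
      also have "\<dots> = mat_trace (A t ^\<^sub>m Suc j * E)"
        using d c[OF t] by (simp only: pow_mat_Suc_left[OF c[OF t]]) (simp add: mat_algebra)
      finally have "mat_trace (A t ^\<^sub>m j * (E * A t)) = (real k + 1) * mat_trace (A t ^\<^sub>m (j + Suc k) * D)"
        unfolding E(2) by simp
      moreover have "mat_trace (A t ^\<^sub>m j * (A t ^\<^sub>m Suc k * D)) = mat_trace (A t ^\<^sub>m (j + Suc k) * D)"
        unfolding pow_mat_add[OF c[OF t], of j "Suc k"] using d c[OF t] by (simp add: mat_algebra del: pow_mat.simps)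
      ultimately show ?thesis using d c[OF t]
        by (simp add: mat_algebra mat_trace_simps del: pow_mat.simps) (simp add: algebra_simps del: pow_mat.simps)
    qed
    ultimately show ?case by blast
  qed
  then obtain E where E: "has_mat_derivative n n (\<lambda>s. A s ^\<^sub>m Suc k) E (at t within S)"
    "\<And>j. mat_trace (A t ^\<^sub>m j * E) = (real k + 1) * mat_trace (A t ^\<^sub>m (j + k) * D)" by blast
  have "((\<lambda>s. mat_trace (A s ^\<^sub>m Suc k)) has_real_derivative mat_trace E) (at t within S)"
    by (rule has_real_derivative_mat_trace[OF E(1) _ t]) (use c pow_mat_carrier'[OF c] in blast)
  moreover have "mat_trace E = (real k + 1) * mat_trace (A t ^\<^sub>m k * D)"
    using E(2)[of 0] c[OF t] has_mat_derivative_carrier[OF E(1)] by simp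
  ultimately show ?thesis by simp
qed

definition mat_sum :: "nat \<Rightarrow> nat set \<Rightarrow> (nat \<Rightarrow> real mat) \<Rightarrow> real mat" where
  "mat_sum n I f = mat n n (\<lambda>(i, j). \<Sum>k\<in>I. f k $$ (i, j))"

lemma mat_sum_dim [simp]: "dim_row (mat_sum n I f) = n" "dim_col (mat_sum n I f) = n"
  by (simp_all add: mat_sum_def)

lemma mat_trace_mult_mat_sum:
  assumes "X \<in> carrier_mat n n" "\<And>k. k \<in> I \<Longrightarrow> f k \<in> carrier_mat n n"
  shows "mat_trace (X * mat_sum n I f) = (\<Sum>k\<in>I. mat_trace (X * f k))"
proof -
  have "mat_trace (X * mat_sum n I f) = (\<Sum>i<n. \<Sum>j<n. \<Sum>k\<in>I. X $$ (i, j) * f k $$ (j, i))"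
    using assms(1) by (simp add: mat_trace_mult mat_sum_def sum_distrib_left)
  also have "\<dots> = (\<Sum>k\<in>I. \<Sum>i<n. \<Sum>j<n. X $$ (i, j) * f k $$ (j, i))"
    by (subst sum.swap[of _ I]) (intro sum.cong refl sum.swap)
  also have "\<dots> = (\<Sum>k\<in>I. mat_trace (X * f k))"
  proof (intro sum.cong refl)
    fix k assume "k \<in> I"
    then show "(\<Sum>i<n. \<Sum>j<n. X $$ (i, j) * f k $$ (j, i)) = mat_trace (X * f k)"
      using assms(1) assms(2)[of k] by (subst mat_trace_mult) auto
  qed
  finally show ?thesis .
qed

lemma mat_sum_transpose:
  assumes "\<And>k. k \<in> I \<Longrightarrow> f k \<in> carrier_mat n n" "\<And>k. k \<in> I \<Longrightarrow> transpose_mat (f k) = f k"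
  shows "transpose_mat (mat_sum n I f) = mat_sum n I f"
proof (rule eq_matI)
  fix i j assume "i < dim_row (mat_sum n I f)" "j < dim_col (mat_sum n I f)"
  then have ij: "i < n" "j < n" by auto
  have "f k $$ (j, i) = f k $$ (i, j)" if "k \<in> I" for k
    using arg_cong[OF assms(2)[OF that], of "\<lambda>M. M $$ (i, j)"] assms(1)[OF that] ij by simp
  then show "transpose_mat (mat_sum n I f) $$ (i, j) = mat_sum n I f $$ (i, j)"
    using ij by (simp add: mat_sum_def)
qed auto

text \<open>The trace of p(A). Being linear in p, it carries statements about coefficients of
  polynomials over to traces.\<close>

definition trace_poly :: "real mat \<Rightarrow> real poly \<Rightarrow> real" where
  "trace_poly A p = (\<Sum>k\<le>degree p. coeff p k * mat_trace (A ^\<^sub>m k))"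

lemma trace_poly_eq_sum:
  assumes "degree p \<le> m"
  shows "trace_poly A p = (\<Sum>k\<le>m. coeff p k * mat_trace (A ^\<^sub>m k))"
  unfolding trace_poly_def using assms by (intro sum.mono_neutral_left) (auto simp: coeff_eq_0)

lemma trace_poly_add: "trace_poly A (p + r) = trace_poly A p + trace_poly A r"
  by (simp add: trace_poly_eq_sum[of p "max (degree p) (degree r)"] trace_poly_eq_sum[of r "max (degree p) (degree r)"]
    trace_poly_eq_sum[OF degree_add_le_max] sum.distrib distrib_right)

lemma trace_poly_diff: "trace_poly A (p - r) = trace_poly A p - trace_poly A r"
  using trace_poly_add[of A "p - r" r] by simp

lemma trace_poly_0: "trace_poly A 0 = 0"
  by (simp add: trace_poly_def)

lemma trace_poly_sum: "trace_poly A (\<Sum>i\<in>I. p i) = (\<Sum>i\<in>I. trace_poly A (p i))"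
  by (induction I rule: infinite_finite_induct) (auto simp: trace_poly_0 trace_poly_add)

lemma trace_poly_monom: "trace_poly A (monom a k) = a * mat_trace (A ^\<^sub>m k)"
proof -
  have "trace_poly A (monom a k) = (\<Sum>j\<le>k. coeff (monom a k) j * mat_trace (A ^\<^sub>m j))"
    by (rule trace_poly_eq_sum) (rule degree_monom_le)
  also have "\<dots> = (\<Sum>j\<le>k. if j = k then a * mat_trace (A ^\<^sub>m j) else 0)"
    by (intro sum.cong) (auto simp: coeff_monom)
  finally show ?thesis by simp
qed

lemma trace_poly_nonneg:
  assumes "B \<in> carrier_mat n n" "A = transpose_mat B * B" "\<And>k. 0 \<le> coeff p k"
  shows "0 \<le> trace_poly A p"
  unfolding trace_poly_def using mat_trace_pow_nonneg[OF assms(1,2)] assms(3) by (intro sum_nonneg) simp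

lemma trace_poly_arcsin_sq:
  "trace_poly A (arcsin_sq_poly N) = (\<Sum>k\<le>N. arcsin_sq_coeff k * mat_trace (A ^\<^sub>m Suc k))"
  by (simp add: arcsin_sq_poly_def trace_poly_sum trace_poly_monom del: pow_mat.simps)

text \<open>Exhibiting P - P R P as a Gram matrix makes the traces of its powers nonnegative, so
  that \<open>trace_poly_nonneg\<close> applies.\<close>

lemma projector_defect:
  fixes P R :: "real mat"
  assumes P: "P \<in> grassmann n q" and R: "R \<in> grassmann n q"
  shows "P - P * R * P = transpose_mat ((1\<^sub>m n - R) * P) * ((1\<^sub>m n - R) * P)"
proof -
  have Pd: "dim_row P = n" "dim_col P = n" "transpose_mat P = P" "P * P = P" using P by (auto simp: grassmann_def)
  have Rd: "dim_row R = n" "dim_col R = n" "transpose_mat R = R" "R * R = R" using R by (auto simp: grassmann_def)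
  show ?thesis
    by (simp add: mat_algebra Pd(1,2) Rd(1,2) Pd(3,4) Rd(3,4) mult_left_eq[OF Rd(4)])
       (rule eq_matI, auto simp: Pd(1,2) Rd(1,2) simp del: index_mult_mat(1))
qed

text \<open>If the principal angles between \<open>P\<close> and \<open>R\<close> are \<open>t\<^sub>i\<close>, then \<open>P - P R P\<close> has the eigenvalues
  \<open>sin\<^sup>2 t\<^sub>i\<close> on the range of \<open>P\<close>.\<close>

lemma projector_speed_bound:
  fixes P R D :: "real mat"
  assumes P: "P \<in> grassmann n q" and R: "R \<in> grassmann n q"
    and D: "D \<in> carrier_mat n n" "transpose_mat D = D" "D * R + R * D = D"
  defines "A \<equiv> P - P * R * P"
  shows "(\<Sum>k\<le>N. arcsin_sq_coeff k * ((real k + 1) * mat_trace (A ^\<^sub>m k * (- (P * D * P)))))\<^sup>2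
    \<le> 4 * grassmann_metric D D * trace_poly A (arcsin_sq_poly N)"
proof -
  have Pd: "dim_row P = n" "dim_col P = n" "transpose_mat P = P" "P * P = P" using P by (auto simp: grassmann_def)
  have Rd: "dim_row R = n" "dim_col R = n" "transpose_mat R = R" "R * R = R" using R by (auto simp: grassmann_def)
  have A: "A \<in> carrier_mat n n" by (rule carrier_matI) (simp_all add: A_def Pd(1,2) Rd(1,2))
  have At: "transpose_mat A = A" by (simp add: A_def mat_algebra Pd Rd)
  note d = Pd(1,2) Rd(1,2) carrier_matD[OF D(1)] carrier_matD[OF A]
  have PA: "P * A = A" using d by (simp add: A_def mat_algebra Pd(4) mult_left_eq[OF Pd(4)])
  have PRP: "P * (R * P) = P - A"
    by (rule eq_matI) (use d in \<open>auto simp: A_def mat_algebra simp del: index_mult_mat(1)\<close>)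
  \<comment> \<open>The compression to the range of P matters for k = 0, where
    \<open>A ^\<^sub>m 0\<close> is the identity of the whole space; for k > 0 it changes
    nothing.\<close>
  define B where "B k = P * A ^\<^sub>m k * P" for k
  have B: "B k \<in> carrier_mat n n" for k by (rule carrier_matI) (simp_all add: B_def d)
  note d = d carrier_matD[OF B]
  have Bt: "transpose_mat (B k) = B k" for k
    using d A by (simp add: B_def mat_algebra Pd(3) pow_mat_transpose[OF A At])
  \<comment> \<open>These are the coefficients of p', so that M is p'(A) on the range of P and the
    sum in the claim is minus the trace of D M.\<close>
  define c where "c k = (real k + 1) * arcsin_sq_coeff k" for k
  define M where "M = mat_sum n {..N} (\<lambda>k. c k \<cdot>\<^sub>m B k)"
  have M: "M \<in> carrier_mat n n" by (rule carrier_matI) (simp_all add: M_def)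
  have Mt: "transpose_mat M = M"
    unfolding M_def by (rule mat_sum_transpose) (simp_all add: B transpose_smult' Bt)
  have trM: "mat_trace (X * M) = (\<Sum>k\<le>N. c k * mat_trace (X * B k))" if "X \<in> carrier_mat n n" for X
  proof -
    have "mat_trace (X * M) = (\<Sum>k\<le>N. mat_trace (X * (c k \<cdot>\<^sub>m B k)))"
      unfolding M_def by (rule mat_trace_mult_mat_sum[OF that]) (simp add: B)
    also have "\<dots> = (\<Sum>k\<le>N. c k * mat_trace (X * B k))"
    proof (intro sum.cong refl)
      fix k
      show "mat_trace (X * (c k \<cdot>\<^sub>m B k)) = c k * mat_trace (X * B k)"
        using carrier_matD[OF that] carrier_matD[OF B[of k]] by (simp add: mult_smult_right mat_trace_smult)
    qed
    finally show ?thesis .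
  qed
  note d = d carrier_matD[OF M]
  define Q where "Q = 1\<^sub>m n - R"
  have Qd: "dim_row Q = n" "dim_col Q = n" using d by (auto simp: Q_def)
  have Qt: "transpose_mat Q = Q" using d by (simp add: Q_def mat_algebra Rd(3))
  have QQ: "Q * Q = Q" and RQ: "R * Q = 0\<^sub>m n n" and QR: "Q * R = 0\<^sub>m n n"
    unfolding Q_def using d by (simp_all add: mat_algebra Rd(4)) (rule eq_matI, auto)+
  have PQP: "P * (Q * P) = A" unfolding Q_def A_def using d by (simp add: mat_algebra Pd(4))
  note d = d Qd
  have RDR: "R * (D * R) = 0\<^sub>m n n"
  proof -
    have "R * (D * R + R * D) * R = R * D * R" by (simp only: D(3))
    then have e: "R * (D * R) + R * (D * R) = R * (D * R)"
      using d by (simp add: mat_algebra Rd(4) mult_left_eq[OF Rd(4)])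
    show ?thesis
    proof (rule eq_matI)
      fix i j assume "i < dim_row (0\<^sub>m n n :: real mat)" "j < dim_col (0\<^sub>m n n :: real mat)"
      then show "(R * (D * R)) $$ (i, j) = 0\<^sub>m n n $$ (i, j)"
        using arg_cong[OF e, of "\<lambda>M. M $$ (i, j)"] d by (simp del: index_mult_mat(1))
    qed (simp_all add: d)
  qed
  have minus_zero: "X - 0\<^sub>m n n = X" if "X \<in> carrier_mat n n" for X :: "real mat"
    using that by (intro eq_matI) auto
  have QDR: "Q * (D * R) = D * R" and RDQ: "R * (D * Q) = R * D"
    unfolding Q_def using d by (simp_all add: mat_algebra RDR minus_zero[OF carrier_matI])
  define G where "G = mat_trace (Q * (M * (R * M)))"
  have trB: "mat_trace (A ^\<^sub>m k * (P * D * P)) = mat_trace (D * B k)" for k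
  proof -
    define X where "X = A ^\<^sub>m k"
    have X: "dim_row X = n" "dim_col X = n" using A by (simp_all add: X_def)
    have "mat_trace ((X * P) * (D * P)) = mat_trace ((D * P) * (X * P))"
      by (rule mat_trace_comm) (simp_all add: d X)
    moreover have "(X * P) * (D * P) = X * (P * D * P)" "(D * P) * (X * P) = D * (P * X * P)"
      by (simp_all add: mat_mult_assoc d X)
    ultimately show ?thesis by (simp only: B_def X_def)
  qed
  have QDR': "Q * (D * (R * X)) = D * (R * X)" and RDQ': "R * (D * (Q * X)) = R * (D * X)"
    if "dim_row X = n" for X
    using arg_cong[OF QDR, of "\<lambda>Y. Y * X"] arg_cong[OF RDQ, of "\<lambda>Y. Y * X"] that
    by (simp_all add: mat_mult_assoc d)
  have "(\<Sum>k\<le>N. arcsin_sq_coeff k * ((real k + 1) * mat_trace (A ^\<^sub>m k * (- (P * D * P))))) = - mat_trace (D * M)"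
  proof -
    have "mat_trace (A ^\<^sub>m k * (- (P * D * P))) = - mat_trace (D * B k)" for k
      unfolding trB[symmetric] by (subst mult_uminus_right) (use A in \<open>simp_all add: d mat_trace_uminus\<close>)
    then show ?thesis unfolding trM[OF D(1)] sum_negf[symmetric] c_def by (intro sum.cong refl) simp
  qed
  \<comment> \<open>D has only off-diagonal blocks with respect to R and Q = 1 - R. Dropping the
    diagonal blocks of M before the Cauchy--Schwarz inequality keeps the trace and gives the sharp
    constant: Z has squared norm 2 G.\<close>
  moreover have "(mat_trace (D * M))\<^sup>2 \<le> mat_trace (D * D) * (2 * G)"
  proof -
    define Z where "Z = R * M * Q + Q * M * R"
    have Z: "Z \<in> carrier_mat n n" by (rule carrier_matI) (simp_all add: Z_def d)
    have 1: "mat_trace (D * (R * (M * Q))) = mat_trace (D * (R * M))"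
    proof -
      have "mat_trace ((D * (R * M)) * Q) = mat_trace (Q * (D * (R * M)))"
        by (rule mat_trace_comm) (simp_all add: d)
      then show ?thesis by (simp add: mat_mult_assoc d QDR')
    qed
    have 2: "mat_trace (D * (Q * (M * R))) = mat_trace (R * (D * M))"
    proof -
      have "mat_trace ((D * (Q * M)) * R) = mat_trace (R * (D * (Q * M)))"
      by (rule mat_trace_comm) (simp_all add: d)
      then show ?thesis by (simp add: mat_mult_assoc d RDQ')
    qed
    have "mat_trace (D * M) = mat_trace ((D * R + R * D) * M)" by (simp only: D(3))
    also have "\<dots> = mat_trace (D * (R * M)) + mat_trace (R * (D * M))"
      using d by (simp add: mult_add_left mat_mult_assoc mat_trace_add)
    also have "\<dots> = mat_trace (D * Z)"
      unfolding Z_def 1[symmetric] 2[symmetric] using d by (simp add: mat_mult_assoc mult_add_right mat_trace_add)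
    finally have DZ: "mat_trace (D * M) = mat_trace (D * Z)" .
    have ZZ: "transpose_mat Z * Z = R * (M * (Q * (M * R))) + Q * (M * (R * (M * Q)))"
    proof -
      have Zt: "transpose_mat Z = Q * M * R + R * M * Q"
        unfolding Z_def using d by (simp add: transpose_add' transpose_mult' Qt Mt Rd(3) mat_mult_assoc)
      show ?thesis unfolding Zt unfolding Z_def using d
        by (simp add: mat_mult_assoc mult_add_right mult_add_left mult_left_eq[OF QQ]
          mult_left_eq[OF RQ] mult_left_eq[OF QR] mult_left_eq[OF Rd(4)] mult_zero_left mult_zero_right add_zero_left add_zero_right)
          (rule comm_add_mat[of _ n n]; rule carrier_matI; simp add: d)
    qed
    have 3: "mat_trace (R * (M * (Q * (M * R)))) = G"
    proof -
      have "mat_trace ((R * M) * (Q * (M * R))) = mat_trace ((Q * (M * R)) * (R * M))"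
        using d by (intro mat_trace_comm) auto
      then show ?thesis using d by (simp add: G_def mat_mult_assoc mult_left_eq[OF Rd(4)])
    qed
    have 4: "mat_trace (Q * (M * (R * (M * Q)))) = G"
    proof -
      have "mat_trace ((Q * (M * (R * M))) * Q) = mat_trace (Q * (Q * (M * (R * M))))"
        using d by (intro mat_trace_comm) auto
      then show ?thesis using d by (simp add: G_def mat_mult_assoc mult_left_eq[OF QQ])
    qed
    have "mat_trace (transpose_mat Z * Z) = 2 * G"
      unfolding ZZ using d 3 4 by (simp add: mat_trace_add)
    then show ?thesis
      using mat_trace_Cauchy_Schwarz[of D Z] d carrier_matD[OF Z] by (simp add: D(2) DZ)
  qed
  \<comment> \<open>Compressed to the range of P, Q becomes A and R becomes 1 - A. So G is the trace
    of p'^2 x (1 - x) at A, and the excess of p over this polynomial has nonnegative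
    coefficients.\<close>
  moreover have "G \<le> trace_poly A (arcsin_sq_poly N)"
  proof -
    let ?p = "arcsin_sq_poly N"
    have QB: "mat_trace (R * (B l * (Q * B k))) = mat_trace (A ^\<^sub>m Suc (k + l)) - mat_trace (A ^\<^sub>m Suc (Suc (k + l)))" for k l
    proof -
      have "R * (B l * (Q * B k)) = R * P * A ^\<^sub>m l * (P * (Q * P)) * A ^\<^sub>m k * P"
        unfolding B_def using d A by (simp add: mat_mult_assoc)
      also have "\<dots> = R * P * (A ^\<^sub>m l * (A * A ^\<^sub>m k)) * P"
        unfolding PQP using d A by (simp add: mat_mult_assoc)
      also have "A ^\<^sub>m l * (A * A ^\<^sub>m k) = A ^\<^sub>m Suc (k + l)"
        unfolding pow_mat_Suc_left[OF A, symmetric] pow_mat_add[OF A, symmetric] by (simp add: add.commute)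
      finally have e: "R * (B l * (Q * B k)) = R * P * A ^\<^sub>m Suc (k + l) * P" .
      let ?X = "A ^\<^sub>m Suc (k + l)"
      have X: "dim_row ?X = n" "dim_col ?X = n" using A by (simp_all del: pow_mat.simps)
      have "mat_trace (R * P * ?X * P) = mat_trace (P * (R * P * ?X))"
        using d X by (intro mat_trace_comm) (simp_all del: pow_mat.simps)
      also have "P * (R * P * ?X) = (P * (R * P)) * ?X"
        using d X by (simp add: mat_mult_assoc del: pow_mat.simps)
      also have "\<dots> = P * ?X - A * ?X"
        unfolding PRP using d X by (simp add: mult_minus_left del: pow_mat.simps)
      also have "P * ?X = ?X"
        unfolding pow_mat_Suc_left[OF A] using d A by (simp add: mult_left_eq[OF PA])
      also have "A * ?X = A ^\<^sub>m Suc (Suc (k + l))" by (rule pow_mat_Suc_left[OF A, symmetric])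
      also have "mat_trace (?X - A ^\<^sub>m Suc (Suc (k + l))) = mat_trace ?X - mat_trace (A ^\<^sub>m Suc (Suc (k + l)))"
        using A by (intro mat_trace_minus) (simp_all del: pow_mat.simps)
      finally show ?thesis unfolding e .
    qed
    have RMQ: "mat_trace (Q * M * R * B k) = (\<Sum>l\<le>N. c l * mat_trace (R * (B k * (Q * B l))))" for k
    proof -
      have "mat_trace ((Q * M) * (R * B k)) = mat_trace ((R * B k) * (Q * M))"
        using d by (intro mat_trace_comm) auto
      then have "mat_trace (Q * M * R * B k) = mat_trace (R * B k * Q * M)"
        using d by (simp add: mat_mult_assoc)
      also have "\<dots> = (\<Sum>l\<le>N. c l * mat_trace (R * B k * Q * B l))"
        by (rule trM) (rule carrier_matI; simp add: d)
      finally show ?thesis using d by (simp add: mat_mult_assoc)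
    qed
    have GM: "G = mat_trace (Q * M * R * M)" using d by (simp add: G_def mat_mult_assoc)
    have "G = (\<Sum>k\<le>N. c k * (\<Sum>l\<le>N. c l * mat_trace (R * (B k * (Q * B l)))))"
      unfolding GM RMQ[symmetric] by (rule trM) (rule carrier_matI; simp add: d)
    also have "\<dots> = (\<Sum>k\<le>N. \<Sum>l\<le>N. trace_poly A (monom (c k * c l) (Suc (l + k)) - monom (c k * c l) (Suc (Suc (l + k)))))"
      by (simp add: QB sum_distrib_left trace_poly_diff trace_poly_monom algebra_simps del: pow_mat.simps)
    also have "\<dots> = trace_poly A (\<Sum>k\<le>N. \<Sum>l\<le>N. monom (c k * c l) (Suc (l + k)) - monom (c k * c l) (Suc (Suc (l + k))))"
      by (simp add: trace_poly_sum)
    also have "(\<Sum>k\<le>N. \<Sum>l\<le>N. monom (c k * c l) (Suc (l + k)) - monom (c k * c l) (Suc (Suc (l + k))))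
       = (pderiv ?p)\<^sup>2 * (monom 1 1 - monom 1 2)"
    proof -
      have "pderiv (sum g I) = (\<Sum>k\<in>I. pderiv (g k))" for g :: "nat \<Rightarrow> real poly" and I
        by (induction I rule: infinite_finite_induct) (auto simp: pderiv_add)
      then have p': "pderiv ?p = (\<Sum>k\<le>N. monom (c k) k)"
        by (simp add: arcsin_sq_poly_def pderiv_monom c_def add.commute)
      show ?thesis
        unfolding p' power2_eq_square
        by (subst sum_product) (simp add: sum_distrib_right mult_monom right_diff_distrib add.commute sum_subtractf)
    qed
    finally have "trace_poly A ?p - G = trace_poly A (?p - (pderiv ?p)\<^sup>2 * (monom 1 1 - monom 1 2))"
      by (simp add: trace_poly_diff)
    moreover have "0 \<le> \<dots>"
    proof (rule trace_poly_nonneg[OF _ projector_defect[OF P R, folded A_def]])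
      show "(1\<^sub>m n - R) * P \<in> carrier_mat n n" by (rule carrier_matI) (simp_all add: d)
    qed (rule arcsin_sq_poly_excess_coeff_nonneg)
    ultimately show ?thesis by simp
  qed
  moreover have "0 \<le> mat_trace (D * D)" using mat_trace_square_nonneg[of D] by (simp add: D(2))
  ultimately have "(\<Sum>k\<le>N. arcsin_sq_coeff k * ((real k + 1) * mat_trace (A ^\<^sub>m k * (- (P * D * P)))))\<^sup>2
      = (mat_trace (D * M))\<^sup>2" "(mat_trace (D * M))\<^sup>2 \<le> mat_trace (D * D) * (2 * G)"
      "mat_trace (D * D) * (2 * G) \<le> mat_trace (D * D) * (2 * trace_poly A (arcsin_sq_poly N))"
    by (simp_all add: mult_left_mono)
  then show ?thesis unfolding grassmann_metric_def by linarith
qed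

section \<open>Regularity of admissible curves and lower bounds for their lengths\<close>

lemma continuous_on_mat_mult:
  fixes f g :: "'a::topological_space \<Rightarrow> real mat"
  assumes "\<And>i j. i < a \<Longrightarrow> j < b \<Longrightarrow> continuous_on S (\<lambda>t. f t $$ (i, j))"
    "\<And>i j. i < b \<Longrightarrow> j < c \<Longrightarrow> continuous_on S (\<lambda>t. g t $$ (i, j))"
    "\<And>t. t \<in> S \<Longrightarrow> f t \<in> carrier_mat a b" "\<And>t. t \<in> S \<Longrightarrow> g t \<in> carrier_mat b c" "i < a" "j < c"
  shows "continuous_on S (\<lambda>t. (f t * g t) $$ (i, j))"
proof (rule continuous_on_eq)
  show "continuous_on S (\<lambda>t. \<Sum>k<b. f t $$ (i, k) * g t $$ (k, j))"
    using assms by (intro continuous_on_sum continuous_on_mult) auto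
  show "(\<Sum>k<b. f t $$ (i, k) * g t $$ (k, j)) = (f t * g t) $$ (i, j)" if "t \<in> S" for t
    using assms(3)[OF that] assms(4)[OF that] assms(5,6) by (subst mat_mult_index) auto
qed

lemma continuous_on_mat_transpose:
  fixes f :: "'a::topological_space \<Rightarrow> real mat"
  assumes "\<And>i j. i < a \<Longrightarrow> j < b \<Longrightarrow> continuous_on S (\<lambda>t. f t $$ (i, j))"
    "\<And>t. t \<in> S \<Longrightarrow> f t \<in> carrier_mat a b" "i < b" "j < a"
  shows "continuous_on S (\<lambda>t. transpose_mat (f t) $$ (i, j))"
proof (rule continuous_on_eq)
  show "continuous_on S (\<lambda>t. f t $$ (j, i))" using assms by simp
  show "f t $$ (j, i) = transpose_mat (f t) $$ (i, j)" if "t \<in> S" for t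
    using assms(2)[OF that] assms(3,4) by simp
qed

lemma continuous_on_mat_trace:
  fixes f :: "'a::topological_space \<Rightarrow> real mat"
  assumes "\<And>i j. i < a \<Longrightarrow> j < a \<Longrightarrow> continuous_on S (\<lambda>t. f t $$ (i, j))"
    "\<And>t. t \<in> S \<Longrightarrow> f t \<in> carrier_mat a a"
  shows "continuous_on S (\<lambda>t. mat_trace (f t))"
proof (rule continuous_on_eq)
  show "continuous_on S (\<lambda>t. \<Sum>i<a. f t $$ (i, i))" using assms(1) by (intro continuous_on_sum) auto
  show "(\<Sum>i<a. f t $$ (i, i)) = mat_trace (f t)" if "t \<in> S" for t
    using assms(2)[OF that] by (simp add: mat_trace_def)
qed

lemma continuous_on_mat_pow:
  fixes f :: "'a::topological_space \<Rightarrow> real mat"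
  assumes "\<And>i j. i < a \<Longrightarrow> j < a \<Longrightarrow> continuous_on S (\<lambda>t. f t $$ (i, j))"
    "\<And>t. t \<in> S \<Longrightarrow> f t \<in> carrier_mat a a" "i < a" "j < a"
  shows "continuous_on S (\<lambda>t. (f t ^\<^sub>m k) $$ (i, j))"
  using assms(3,4)
proof (induction k arbitrary: i j)
  case 0
  show ?case
  proof (rule continuous_on_eq[OF continuous_on_const[of _ "if i = j then 1 else 0"]])
    show "(if i = j then 1 else 0) = (f t ^\<^sub>m 0) $$ (i, j)" if "t \<in> S" for t
      using assms(2)[OF that] 0 by simp
  qed
next
  case (Suc k)
  have "continuous_on S (\<lambda>t. (f t ^\<^sub>m k * f t) $$ (i, j))"
    by (rule continuous_on_mat_mult[OF Suc.IH assms(1) pow_mat_carrier'[OF assms(2)] assms(2) Suc.prems])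
  then show ?case by simp
qed

text \<open>Every entry has its own finite set of breakpoints; their union S serves all entries at
  once. With the endpoints removed as well, an open set remains on which \<open>velocity\<close> is
  a genuine two-sided derivative.\<close>

lemma admissible_curve_regular:
  assumes adm: "admissible_curve a b M p q \<gamma>"
  obtains S where "finite S"
    "\<And>t. t \<in> {0<..<1} - S \<Longrightarrow> has_mat_derivative a b \<gamma> (velocity a b \<gamma> t) (at t)"
    "\<And>i j. i < a \<Longrightarrow> j < b \<Longrightarrow> continuous_on ({0<..<1} - S) (\<lambda>t. velocity a b \<gamma> t $$ (i, j))"
proof -
  have "\<forall>p\<in>{..<a} \<times> {..<b}. \<exists>S. finite S \<and> (\<lambda>t. \<gamma> t $$ p) C1_differentiable_on ({0..1} - S)"
  proof
    fix p assume "p \<in> {..<a} \<times> {..<b}"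
    then have p: "fst p < a" "snd p < b" by (simp_all add: mem_Times_iff)
    have all: "\<forall>i<a. \<forall>j<b. (\<lambda>t. \<gamma> t $$ (i, j)) piecewise_C1_differentiable_on {0..1}"
      using adm unfolding admissible_curve_def by (elim conjE)
    from all[rule_format, OF p] show "\<exists>S. finite S \<and> (\<lambda>t. \<gamma> t $$ p) C1_differentiable_on ({0..1} - S)"
      unfolding prod.collapse piecewise_C1_differentiable_on_def by (rule conjunct2)
  qed
  from bchoice[OF this] obtain T where
    T0: "\<forall>p\<in>{..<a} \<times> {..<b}. finite (T p) \<and> (\<lambda>t. \<gamma> t $$ p) C1_differentiable_on ({0..1} - T p)" ..
  have T: "finite (T p)" "(\<lambda>t. \<gamma> t $$ p) C1_differentiable_on ({0..1} - T p)" if "p \<in> {..<a} \<times> {..<b}" for p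
    using bspec[OF T0 that] by (rule conjunct1, rule conjunct2)
  define S where "S = (\<Union>p\<in>{..<a} \<times> {..<b}. T p)"
  have C1: "(\<lambda>t. \<gamma> t $$ (i, j)) C1_differentiable_on ({0<..<1} - S)" if "i < a" "j < b" for i j
  proof (rule C1_differentiable_on_subset[OF T(2)[of "(i, j)"]])
    show "{0<..<1} - S \<subseteq> {0..1} - T (i, j)" using that unfolding S_def by (intro Diff_mono) auto
  qed (use that in auto)
  show thesis
  proof (rule that)
    show "finite S" unfolding S_def using T(1) by (intro finite_UN_I) auto
    show "has_mat_derivative a b \<gamma> (velocity a b \<gamma> t) (at t)" if t: "t \<in> {0<..<1} - S" for t
      unfolding has_mat_derivative_def
    proof (intro conjI allI impI)
      fix i j assume ij: "i < a" "j < b"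
      have "(\<lambda>t. \<gamma> t $$ (i, j)) differentiable (at t)"
        using C1[OF ij] t unfolding C1_differentiable_on_eq by blast
      then show "((\<lambda>t. \<gamma> t $$ (i, j)) has_real_derivative velocity a b \<gamma> t $$ (i, j)) (at t)"
        using ij by (simp add: velocity_def vector_derivative_works has_real_derivative_iff_has_vector_derivative)
    qed (simp add: velocity_def)
    show "continuous_on ({0<..<1} - S) (\<lambda>t. velocity a b \<gamma> t $$ (i, j))" if "i < a" "j < b" for i j
      using C1[OF that] that unfolding C1_differentiable_on_eq velocity_def by simp
  qed
qed

text \<open>With A = P - P \<gamma> P along the curve, the square root of tr p(A) starts at 0 and by
  \<open>projector_speed_bound\<close> grows at most with the speed of the curve.\<close>

lemma grassmann_curve_lower_bound:
  assumes adm: "admissible_curve n n (grassmann n q) P R \<gamma>"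
  shows "ennreal (sqrt (trace_poly (P - P * R * P) (arcsin_sq_poly N))) \<le> curve_length n n grassmann_metric \<gamma>"
proof -
  obtain S where S: "finite S"
    "\<And>t. t \<in> {0<..<1} - S \<Longrightarrow> has_mat_derivative n n \<gamma> (velocity n n \<gamma> t) (at t)"
    "\<And>i j. i < n \<Longrightarrow> j < n \<Longrightarrow> continuous_on ({0<..<1} - S) (\<lambda>t. velocity n n \<gamma> t $$ (i, j))"
    using admissible_curve_regular[OF adm] by metis
  have G: "\<gamma> t \<in> grassmann n q" if "t \<in> {0..1}" for t using adm that by (auto simp: admissible_curve_def)
  have ends: "\<gamma> 0 = P" "\<gamma> 1 = R" using adm by (auto simp: admissible_curve_def)
  have P: "P \<in> grassmann n q" using G[of 0] ends by simp
  have gc: "continuous_on {0..1} (\<lambda>t. \<gamma> t $$ (i, j))" if "i < n" "j < n" for i j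
    using adm that unfolding admissible_curve_def piecewise_C1_differentiable_on_def by blast
  have c: "\<gamma> t \<in> carrier_mat n n" "transpose_mat (\<gamma> t) = \<gamma> t" "\<gamma> t * \<gamma> t = \<gamma> t" if "t \<in> {0..1}" for t
    using G[OF that] by (auto simp: grassmann_def)
  have Pc: "P \<in> carrier_mat n n" "P * P = P" using P by (auto simp: grassmann_def)
  note Pd = carrier_matD[OF Pc(1)]
  define A where "A t = P - P * \<gamma> t * P" for t
  have Ac: "A t \<in> carrier_mat n n" for t unfolding A_def by (rule carrier_matI) (simp_all add: Pd)
  define F where "F t = trace_poly (A t) (arcsin_sq_poly N)" for t
  define D where "D t = velocity n n \<gamma> t" for t
  define F' where "F' t = (\<Sum>k\<le>N. arcsin_sq_coeff k * ((real k + 1) * mat_trace (A t ^\<^sub>m k * (- (P * D t * P)))))" for t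
  have Dp: "D t \<in> carrier_mat n n" "transpose_mat (D t) = D t" "D t * \<gamma> t + \<gamma> t * D t = D t"
    "has_mat_derivative n n \<gamma> (D t) (at t within {0<..<1})"
    if t: "t \<in> {0<..<1} - S" for t
  proof -
    have at: "at t within {0<..<1} = at t" using t by (intro at_within_open) auto
    have tT: "t \<in> {0<..<1}" using t by simp
    have d: "has_mat_derivative n n \<gamma> (D t) (at t within {0<..<1})" using S(2)[OF t] by (simp add: at D_def)
    then show "has_mat_derivative n n \<gamma> (D t) (at t within {0<..<1})" .
    show "D t \<in> carrier_mat n n" by (rule has_mat_derivative_carrier[OF d])
    have c': "\<gamma> s \<in> carrier_mat n n" "transpose_mat (\<gamma> s) = \<gamma> s" "\<gamma> s * \<gamma> s = \<gamma> s" if "s \<in> {0<..<1}" for s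
      using c that by auto
    have "has_mat_derivative n n \<gamma> (transpose_mat (D t)) (at t within {0<..<1})"
      by (rule has_mat_derivative_cong[OF has_mat_derivative_transpose[OF d c'(1) tT] c'(2) tT])
    then show "transpose_mat (D t) = D t" using has_mat_derivative_at_unique d unfolding at by blast
    have "has_mat_derivative n n \<gamma> (D t * \<gamma> t + \<gamma> t * D t) (at t within {0<..<1})"
      by (rule has_mat_derivative_cong[OF has_mat_derivative_mult[OF d d c'(1) c'(1) tT] c'(3) tT])
    then show "D t * \<gamma> t + \<gamma> t * D t = D t" using has_mat_derivative_at_unique d unfolding at by blast
  qed
  have Acont: "continuous_on {0..1} (\<lambda>t. A t $$ (i, j))" if ij: "i < n" "j < n" for i j
  proof (rule continuous_on_eq)
    have "continuous_on {0..1} (\<lambda>t. (P * \<gamma> t) $$ (i, j))" if "i < n" "j < n" for i j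
      by (rule continuous_on_mat_mult[OF continuous_on_const gc Pc(1) c(1) that])
    then have "continuous_on {0..1} (\<lambda>t. (P * \<gamma> t * P) $$ (i, j))"
      by (rule continuous_on_mat_mult[OF _ continuous_on_const mult_carrier_mat[OF Pc(1) c(1)] Pc(1) ij])
    then show "continuous_on {0..1} (\<lambda>t. P $$ (i, j) - (P * \<gamma> t * P) $$ (i, j))"
      by (intro continuous_on_diff continuous_on_const)
    show "P $$ (i, j) - (P * \<gamma> t * P) $$ (i, j) = A t $$ (i, j)" for t
      unfolding A_def using ij Pd by (simp del: index_mult_mat(1))
  qed
  have "ennreal (sqrt (F 1)) \<le> (\<integral>\<^sup>+t\<in>{0..1}. ennreal (sqrt (grassmann_metric (D t) (D t))) \<partial>lborel)"
  proof (rule sqrt_le_nn_integral_speed[OF S(1)])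
    show "continuous_on {0..1} F"
      unfolding F_def trace_poly_arcsin_sq
      by (intro continuous_on_sum continuous_on_mult continuous_on_const continuous_on_mat_trace[where a = n]
        continuous_on_mat_pow[OF Acont Ac]) (simp_all add: Ac del: pow_mat.simps)
    show "0 \<le> F t" if "t \<in> {0..1}" for t
      unfolding F_def A_def
    proof (rule trace_poly_nonneg[OF _ projector_defect[OF P G[OF that]] arcsin_sq_poly_coeff_nonneg])
      show "(1\<^sub>m n - \<gamma> t) * P \<in> carrier_mat n n"
        by (rule carrier_matI) (simp_all add: Pd carrier_matD[OF c(1)[OF that]])
    qed
    \<comment> \<open>p has no constant term, so the zeroth power, which is the identity, does not
      occur.\<close>
    show "F 0 = 0"
    proof -
      have "A 0 = 0\<^sub>m n n" unfolding A_def ends(1) Pc(2) using Pd by (intro eq_matI) auto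
      then have "A 0 ^\<^sub>m Suc k = 0\<^sub>m n n" for k
        using Ac[of 0] by (simp add: mult_zero_right)
      then show ?thesis unfolding F_def trace_poly_arcsin_sq by (simp only: mat_trace_zero) simp
    qed
    show "(F has_real_derivative F' t) (at t)" if t: "t \<in> {0<..<1} - S" for t
    proof -
      have at: "at t within {0<..<1} = at t" and tT: "t \<in> {0<..<1}" using t by (auto intro: at_within_open)
      have c': "\<gamma> s \<in> carrier_mat n n" if "s \<in> {0<..<1}" for s using c(1) that by auto
      note const = has_mat_derivative_const[OF Pc(1), of "at t within {0<..<1}"]
      have 1: "has_mat_derivative n n (\<lambda>t. P * \<gamma> t) (0\<^sub>m n n * \<gamma> t + P * D t) (at t within {0<..<1})"
        by (rule has_mat_derivative_mult[OF const Dp(4)[OF t] Pc(1) c' tT])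
      have 2: "has_mat_derivative n n (\<lambda>t. P * \<gamma> t * P) ((0\<^sub>m n n * \<gamma> t + P * D t) * P + P * \<gamma> t * 0\<^sub>m n n) (at t within {0<..<1})"
        by (rule has_mat_derivative_mult[OF 1 const mult_carrier_mat[OF Pc(1) c'] Pc(1) tT])
      have 3: "has_mat_derivative n n A (0\<^sub>m n n - ((0\<^sub>m n n * \<gamma> t + P * D t) * P + P * \<gamma> t * 0\<^sub>m n n)) (at t within {0<..<1})"
        unfolding A_def
        by (rule has_mat_derivative_minus[OF const 2 Pc(1) mult_carrier_mat[OF mult_carrier_mat[OF Pc(1) c'] Pc(1)] tT])
      have "0\<^sub>m n n - ((0\<^sub>m n n * \<gamma> t + P * D t) * P + P * \<gamma> t * 0\<^sub>m n n) = - (P * D t * P)"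
        using Pd carrier_matD[OF Dp(1)[OF t]] carrier_matD[OF c'[OF tT]]
        by (simp add: mat_algebra) (rule eq_matI, auto simp del: index_mult_mat(1))
      with 3 have A': "has_mat_derivative n n A (- (P * D t * P)) (at t within {0<..<1})" by (simp only:)
      show ?thesis
        unfolding F_def F'_def trace_poly_arcsin_sq at[symmetric]
        by (intro DERIV_sum DERIV_cmult mat_trace_pow_deriv[OF A' Ac tT])
    qed
    have metric: "grassmann_metric (D t) (D t) = mat_trace (D t * D t) / 2" for t by (simp add: grassmann_metric_def)
    have Dc: "D t \<in> carrier_mat n n" for t by (simp add: D_def velocity_def)
    show "continuous_on ({0<..<1} - S) (\<lambda>t. sqrt (grassmann_metric (D t) (D t)))"
      unfolding metric
      by (intro continuous_on_real_sqrt continuous_on_divide continuous_on_const continuous_on_mat_trace[where a = n]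
         continuous_on_mat_mult[OF _ _ Dc Dc] mult_carrier_mat[OF Dc Dc]) (simp_all add: D_def S(3))
    show "0 \<le> sqrt (grassmann_metric (D t) (D t))" if "t \<in> {0<..<1} - S" for t
      using mat_trace_square_nonneg[of "D t"] Dp(2)[OF that] by (simp add: metric)
    show "(F' t)\<^sup>2 \<le> 4 * (sqrt (grassmann_metric (D t) (D t)))\<^sup>2 * F t" if t: "t \<in> {0<..<1} - S" for t
    proof -
      have "0 \<le> grassmann_metric (D t) (D t)"
        using mat_trace_square_nonneg[of "D t"] Dp(2)[OF t] by (simp add: metric)
      moreover have "\<gamma> t \<in> grassmann n q" using G t by simp
      ultimately show ?thesis
        using projector_speed_bound[OF P _ Dp(1-3)[OF t], where N = N] unfolding F'_def F_def A_def by simp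
    qed
  qed
  then show ?thesis by (simp add: F_def A_def ends curve_length_def D_def)
qed

text \<open>The vertical part of V is measured by the skew matrix B =
  \<open>\<gamma>\<^sup>T V\<close> and is penalized by the projection: half the trace of D^2 is
  |V|^2 + tr (B^2), and tr (B^2) = - |B|^2.\<close>

lemma grassmann_metric_projected_le:
  assumes c: "\<gamma> \<in> carrier_mat n q" "V \<in> carrier_mat n q"
    and orth: "transpose_mat \<gamma> * \<gamma> = 1\<^sub>m q" and skew: "transpose_mat V * \<gamma> = - (transpose_mat \<gamma> * V)"
  defines "D \<equiv> V * transpose_mat \<gamma> + \<gamma> * transpose_mat V"
  shows "grassmann_metric D D \<le> stiefel_metric V V"
proof -
  note d = carrier_matD[OF c(1)] carrier_matD[OF c(2)]
  let ?B = "transpose_mat \<gamma> * V"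
  have 1: "mat_trace (V * (transpose_mat \<gamma> * (V * transpose_mat \<gamma>))) = mat_trace (?B * ?B)"
    using d mat_trace_comm[of "V * (transpose_mat \<gamma> * V)" "transpose_mat \<gamma>"] by (simp add: mat_mult_assoc)
  have 2: "mat_trace (V * transpose_mat V) = mat_trace (transpose_mat V * V)"
    using d by (intro mat_trace_comm) auto
  have 3: "mat_trace (\<gamma> * (transpose_mat V * (V * transpose_mat \<gamma>))) = mat_trace (transpose_mat V * V)"
    using d mat_trace_comm[of \<gamma> "transpose_mat V * (V * transpose_mat \<gamma>)"] by (simp add: mat_mult_assoc orth mult_one_right)
  have 4: "mat_trace (\<gamma> * (transpose_mat V * (\<gamma> * transpose_mat V))) = mat_trace (?B * ?B)"
  proof -
    have "mat_trace (\<gamma> * (transpose_mat V * (\<gamma> * transpose_mat V))) = mat_trace ((transpose_mat V * \<gamma>) * (transpose_mat V * \<gamma>))"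
      using d mat_trace_comm[of \<gamma> "transpose_mat V * (\<gamma> * transpose_mat V)"] by (simp add: mat_mult_assoc)
    also have "\<dots> = mat_trace (?B * ?B)" unfolding skew using d by (simp add: mult_uminus_left mult_uminus_right)
    finally show ?thesis .
  qed
  have "mat_trace (?B * ?B) = - mat_trace (transpose_mat ?B * ?B)"
    using d by (simp add: transpose_mult' skew mult_uminus_left mat_trace_uminus)
  then have 5: "mat_trace (?B * ?B) \<le> 0" using mat_trace_square_nonneg[of ?B] by simp
  have "D * D = V * (transpose_mat \<gamma> * (V * transpose_mat \<gamma>)) + \<gamma> * (transpose_mat V * (V * transpose_mat \<gamma>))
      + (V * transpose_mat V + \<gamma> * (transpose_mat V * (\<gamma> * transpose_mat V)))"
    unfolding D_def using d by (simp add: mult_add_left mult_add_right mat_mult_assoc mult_left_eq[OF orth] mult_one_left)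
  then have "mat_trace (D * D) = 2 * mat_trace (?B * ?B) + 2 * mat_trace (transpose_mat V * V)"
    using d by (simp add: mat_trace_add 1 2 3 4)
  then show ?thesis using 5 by (simp add: grassmann_metric_def stiefel_metric_def)
qed

text \<open>Every admissible curve of frames projects to a curve of projectors that is no longer;
  most of the work is the piecewise regularity of the projected curve.\<close>

lemma grassmann_dist_le_stiefel_dist:
  "geodesic_dist n n (grassmann n q) grassmann_metric (U * transpose_mat U) (W * transpose_mat W) \<le> stiefel_dist n q U W"
  unfolding stiefel_dist_def geodesic_dist_def
proof (rule INF_greatest)
  fix \<gamma> assume "\<gamma> \<in> Collect (admissible_curve n q (stiefel n q) U W)"
  then have adm: "admissible_curve n q (stiefel n q) U W \<gamma>" by simp
  obtain S where S: "finite S"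
    "\<And>t. t \<in> {0<..<1} - S \<Longrightarrow> has_mat_derivative n q \<gamma> (velocity n q \<gamma> t) (at t)"
    "\<And>i j. i < n \<Longrightarrow> j < q \<Longrightarrow> continuous_on ({0<..<1} - S) (\<lambda>t. velocity n q \<gamma> t $$ (i, j))"
    using admissible_curve_regular[OF adm] by metis
  have st: "\<gamma> t \<in> stiefel n q" if "t \<in> {0..1}" for t using adm that by (auto simp: admissible_curve_def)
  have c: "\<gamma> t \<in> carrier_mat n q" "transpose_mat (\<gamma> t) \<in> carrier_mat q n" "transpose_mat (\<gamma> t) * \<gamma> t = 1\<^sub>m q" if "t \<in> {0..1}" for t
    using st[OF that] by (auto simp: stiefel_def)
  have gc: "continuous_on {0..1} (\<lambda>t. \<gamma> t $$ (i, j))" if "i < n" "j < q" for i j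
    using adm that unfolding admissible_curve_def piecewise_C1_differentiable_on_def by blast
  define V where "V t = velocity n q \<gamma> t" for t
  have Vc: "V t \<in> carrier_mat n q" for t by (simp add: V_def velocity_def)
  define \<delta> where "\<delta> t = \<gamma> t * transpose_mat (\<gamma> t)" for t
  define D where "D t = V t * transpose_mat (\<gamma> t) + \<gamma> t * transpose_mat (V t)" for t
  have D: "has_mat_derivative n n \<delta> (D t) (at t)" "transpose_mat (V t) * \<gamma> t = - (transpose_mat (\<gamma> t) * V t)"
    if t: "t \<in> {0<..<1} - S" for t
  proof -
    have at: "at t within {0<..<1} = at t" and tT: "t \<in> {0<..<1}" using t by (auto intro: at_within_open)
    have d: "has_mat_derivative n q \<gamma> (V t) (at t within {0<..<1})" using S(2)[OF t] by (simp add: at V_def)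
    have c': "\<gamma> s \<in> carrier_mat n q" "transpose_mat (\<gamma> s) \<in> carrier_mat q n" "1\<^sub>m q = transpose_mat (\<gamma> s) * \<gamma> s" if "s \<in> {0<..<1}" for s
      using c[of s] that by auto
    note dt = has_mat_derivative_transpose[OF d c'(1) tT]
    show "has_mat_derivative n n \<delta> (D t) (at t)"
      using has_mat_derivative_mult[OF d dt c'(1) c'(2) tT] unfolding D_def \<delta>_def at .
    have "has_mat_derivative q q (\<lambda>t. transpose_mat (\<gamma> t) * \<gamma> t) (transpose_mat (V t) * \<gamma> t + transpose_mat (\<gamma> t) * V t) (at t within {0<..<1})"
      by (rule has_mat_derivative_mult[OF dt d c'(2) c'(1) tT])
    moreover have "has_mat_derivative q q (\<lambda>t. transpose_mat (\<gamma> t) * \<gamma> t) (0\<^sub>m q q) (at t within {0<..<1})"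
      by (rule has_mat_derivative_cong[OF has_mat_derivative_const[OF one_carrier_mat] c'(3) tT])
    ultimately have "transpose_mat (V t) * \<gamma> t + transpose_mat (\<gamma> t) * V t = 0\<^sub>m q q"
      using has_mat_derivative_at_unique unfolding at by blast
    then show "transpose_mat (V t) * \<gamma> t = - (transpose_mat (\<gamma> t) * V t)"
      using c'(1)[OF tT] Vc[of t] by (subst (asm) mat_add_eq_zero_iff) auto
  qed
  have "admissible_curve n n (grassmann n q) (U * transpose_mat U) (W * transpose_mat W) \<delta>"
    unfolding admissible_curve_def
  proof (intro conjI ballI allI impI)
    show "\<delta> t \<in> grassmann n q" if "t \<in> {0..1}" for t
      unfolding \<delta>_def by (rule frame_projector_in_grassmann[OF st[OF that]])
    show "\<delta> 0 = U * transpose_mat U" "\<delta> 1 = W * transpose_mat W"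
      using adm by (auto simp: \<delta>_def admissible_curve_def)
    fix i j assume ij: "i < n" "j < n"
    have gct: "continuous_on {0..1} (\<lambda>t. transpose_mat (\<gamma> t) $$ (i, j))" if "i < q" "j < n" for i j
      by (rule continuous_on_mat_transpose[OF gc c(1) that])
    have sub: "{0<..<1} - S \<subseteq> {0..1::real}" by auto
    have c': "\<gamma> t \<in> carrier_mat n q" "transpose_mat (\<gamma> t) \<in> carrier_mat q n" if "t \<in> {0<..<1} - S" for t
      using c[of t] that by auto
    have Vt: "transpose_mat (V t) \<in> carrier_mat q n" for t using Vc by simp
    have Vcont: "continuous_on ({0<..<1} - S) (\<lambda>t. V t $$ (i, j))" if "i < n" "j < q" for i j
      using S(3)[OF that] by (simp add: V_def)
    have "continuous_on ({0<..<1} - S) (\<lambda>t. (V t * transpose_mat (\<gamma> t)) $$ (i, j) + (\<gamma> t * transpose_mat (V t)) $$ (i, j))"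
      by (intro continuous_on_add continuous_on_mat_mult[OF Vcont continuous_on_subset[OF gct sub] Vc c'(2) ij]
        continuous_on_mat_mult[OF continuous_on_subset[OF gc sub] continuous_on_mat_transpose[OF Vcont Vc] c'(1) Vt ij])
    then have Dcont: "continuous_on ({0<..<1} - S) (\<lambda>t. D t $$ (i, j))"
    proof (rule continuous_on_eq)
      fix t assume "t \<in> {0<..<1} - S"
      from c'[OF this] show "(V t * transpose_mat (\<gamma> t)) $$ (i, j) + (\<gamma> t * transpose_mat (V t)) $$ (i, j) = D t $$ (i, j)"
        unfolding D_def using Vc[of t] ij by (simp del: index_mult_mat(1))
    qed
    have deriv: "((\<lambda>t. \<delta> t $$ (i, j)) has_vector_derivative D t $$ (i, j)) (at t)" if "t \<in> {0<..<1} - S" for t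
      using D(1)[OF that] ij by (simp add: has_mat_derivative_def has_real_derivative_iff_has_vector_derivative)
    have "continuous_on {0..1} (\<lambda>t. \<delta> t $$ (i, j))"
      unfolding \<delta>_def by (rule continuous_on_mat_mult[OF gc gct c(1) c(2) ij])
    \<comment> \<open>The endpoints join the breakpoints because two-sided derivatives are known
      only inside the interval.\<close>
    moreover have "{0..1} - (S \<union> {0, 1}) = {0<..<1} - S" by auto
    then have "(\<lambda>t. \<delta> t $$ (i, j)) C1_differentiable_on ({0..1} - (S \<union> {0, 1}))"
      unfolding C1_differentiable_on_def using deriv Dcont by (intro exI[of _ "\<lambda>t. D t $$ (i, j)"]) simp
    ultimately show "(\<lambda>t. \<delta> t $$ (i, j)) piecewise_C1_differentiable_on {0..1}"
      unfolding piecewise_C1_differentiable_on_def using S(1) by (intro conjI exI[of _ "S \<union> {0, 1}"]) auto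
  qed
  then have "(INF \<gamma>\<in>Collect (admissible_curve n n (grassmann n q) (U * transpose_mat U) (W * transpose_mat W)). curve_length n n grassmann_metric \<gamma>)
      \<le> curve_length n n grassmann_metric \<delta>"
    by (intro INF_lower) simp
  also have "\<dots> \<le> curve_length n q stiefel_metric \<gamma>"
    unfolding curve_length_def
  proof (rule nn_integral_mono_AE)
    have "AE t in lborel. t \<notin> S \<union> {0, 1}"
      using S(1) by (intro AE_not_in finite_imp_null_set_lborel) auto
    then show "AE t in lborel. ennreal (sqrt (grassmann_metric (velocity n n \<delta> t) (velocity n n \<delta> t))) * indicator {0..1} t
        \<le> ennreal (sqrt (stiefel_metric (velocity n q \<gamma> t) (velocity n q \<gamma> t))) * indicator {0..1} t"
    proof (rule eventually_mono)
      fix t :: real assume t: "t \<notin> S \<union> {0, 1}"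
      show "ennreal (sqrt (grassmann_metric (velocity n n \<delta> t) (velocity n n \<delta> t))) * indicator {0..1} t
        \<le> ennreal (sqrt (stiefel_metric (velocity n q \<gamma> t) (velocity n q \<gamma> t))) * indicator {0..1} t"
      proof (cases "t \<in> {0..1}")
        case True
        then have tS: "t \<in> {0<..<1} - S" using t by auto
        have "grassmann_metric (D t) (D t) \<le> stiefel_metric (V t) (V t)"
          unfolding D_def by (rule grassmann_metric_projected_le[OF c(1)[OF True] Vc c(3)[OF True] D(2)[OF tS]])
        then show ?thesis
          unfolding velocity_eq[OF D(1)[OF tS]] V_def[symmetric] using True by (simp add: ennreal_leI)
      qed simp
    qed
  qed
  finally show "(INF \<gamma>\<in>Collect (admissible_curve n n (grassmann n q) (U * transpose_mat U) (W * transpose_mat W)). curve_length n n grassmann_metric \<gamma>)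
      \<le> curve_length n q stiefel_metric \<gamma>" .
qed

section \<open>Minimal geodesics outside the cut locus\<close>

lemma stiefelI: "dim_row U = n \<Longrightarrow> dim_col U = q \<Longrightarrow> transpose_mat U * U = 1\<^sub>m q \<Longrightarrow> U \<in> stiefel n q"
  unfolding stiefel_def using carrier_matI[of U n q] by simp

text \<open>The columns of L are orthogonal with lengths |s i|. Where the length is zero,
  \<open>1 / 0 = 0\<close> gives a zero column, in agreement with the vanishing column of L, so L is
  recovered in all cases.\<close>

lemma normalize_columns:
  fixes L :: "real mat" and s :: "nat \<Rightarrow> real"
  assumes L: "L \<in> carrier_mat n q" and LL: "transpose_mat L * L = mat_diag q (\<lambda>i. s i * s i)"
  defines "H \<equiv> L * mat_diag q (\<lambda>i. 1 / s i)"
  shows "H \<in> carrier_mat n q" "transpose_mat H * H = mat_diag q (\<lambda>i. if s i = 0 then 0 else 1)" "H * mat_diag q s = L"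
proof -
  note d = carrier_matD[OF L]
  show "H \<in> carrier_mat n q" by (rule carrier_matI) (simp_all add: H_def d)
  have "transpose_mat H * H = mat_diag q (\<lambda>i. 1 / s i * (s i * s i * (1 / s i)))"
    unfolding H_def using d by (simp add: transpose_mult' mat_mult_assoc mult_left_eq[OF LL])
  also have "\<dots> = mat_diag q (\<lambda>i. if s i = 0 then 0 else 1)"
    by (rule mat_diag_cong) simp
  finally show "transpose_mat H * H = mat_diag q (\<lambda>i. if s i = 0 then 0 else 1)" .
  have L0: "L $$ (k, i) = 0" if "i < q" "k < n" "s i = 0" for i k
  proof -
    have "(\<Sum>k<n. L $$ (k, i) * L $$ (k, i)) = s i * s i"
      using arg_cong[OF LL, of "\<lambda>M. M $$ (i, i)"] that(1) d
      by (simp add: mat_mult_index del: index_mult_mat(1)) (simp add: mat_diag_def)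
    then have "\<forall>k\<in>{..<n}. L $$ (k, i) * L $$ (k, i) = 0"
      using that(3) by (subst sum_nonneg_eq_0_iff[symmetric]) auto
    then show ?thesis using that(2) by auto
  qed
  have "H * mat_diag q s = L * mat_diag q (\<lambda>i. 1 / s i * s i)"
    unfolding H_def using d by (simp add: mat_mult_assoc)
  also have "\<dots> = L"
    unfolding mat_diag_mult_right[OF L]
  proof (rule eq_matI)
    fix i j assume "i < dim_row L" "j < dim_col L"
    then show "mat n q (\<lambda>(i, j). L $$ (i, j) * (1 / s j * s j)) $$ (i, j) = L $$ (i, j)"
      using d L0[of j i] by (cases "s j = 0") auto
  qed (simp_all add: d)
  finally show "H * mat_diag q s = L" .
qed

lemma mat_trace_mat_diag: "mat_trace (mat_diag q f) = (\<Sum>i<q. f i)"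
  unfolding mat_trace_def by (intro sum.cong) (auto simp: mat_diag_def)

text \<open>The exponent is positive because the zeroth power is the identity and not
  \<open>U U\<^sup>T\<close>.\<close>

lemma frame_diag_pow:
  fixes U :: "real mat"
  assumes U: "U \<in> stiefel n q"
  shows "(U * mat_diag q f * transpose_mat U) ^\<^sub>m Suc k = U * mat_diag q (\<lambda>i. f i ^ Suc k) * transpose_mat U"
proof (induction k)
  note d = stiefelD(2,3)[OF U]
  case 0
  show ?case by (simp add: d mult_one_left)
next
  note d = stiefelD(2,3)[OF U]
  case (Suc k)
  have "(U * mat_diag q f * transpose_mat U) ^\<^sub>m Suc (Suc k)
      = U * mat_diag q (\<lambda>i. f i ^ Suc k) * transpose_mat U * (U * mat_diag q f * transpose_mat U)"
    using Suc.IH by (simp only: pow_mat.simps(2)[of _ "Suc k"])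
  also have "\<dots> = U * (mat_diag q (\<lambda>i. f i ^ Suc k) * (mat_diag q f * transpose_mat U))"
    using d by (simp add: mat_mult_assoc mult_left_eq[OF stiefelD(4)[OF U]] mult_one_left del: power_Suc)
  also have "\<dots> = U * mat_diag q (\<lambda>i. f i ^ Suc k * f i) * transpose_mat U"
    using d by (simp add: mat_mult_assoc mat_diag_mult_assoc del: power_Suc)
  finally show ?case by (simp add: mult.commute mult.left_commute)
qed

text \<open>The change of frame T = \<open>Z\<^sup>T Y\<close> is square with
  \<open>T\<^sup>T T = 1\<close>, hence orthogonal, and cancels in
  \<open>Y Y\<^sup>T\<close>.\<close>

lemma frame_change_orthogonal:
  fixes Z Y R :: "real mat"
  assumes Z: "Z \<in> stiefel n q" and Y: "Y \<in> stiefel n q" and "Z * transpose_mat Z * Y = Y"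
  shows "Y * transpose_mat Y = Z * transpose_mat Z"
proof -
  note dz = stiefelD[OF Z] and dy = stiefelD[OF Y]
  define T where "T = transpose_mat Z * Y"
  have T: "T \<in> carrier_mat q q" by (rule carrier_matI) (simp_all add: T_def dz dy)
  have YT: "Y = Z * T" using assms(3) dz(2,3) dy(2,3) by (simp add: T_def mat_mult_assoc)
  have "transpose_mat T * T = transpose_mat Y * Y"
    unfolding YT using dz(2,3) carrier_matD[OF T] by (simp add: transpose_mult' mat_mult_assoc mult_left_eq[OF dz(4)] mult_one_left)
  then have "transpose_mat T * T = 1\<^sub>m q" by (simp only: dy(4))
  then have TT: "T * transpose_mat T = 1\<^sub>m q"
    using mat_mult_left_right_inverse[OF _ T] T by (simp add: carrier_matD)
  show ?thesis
    unfolding YT using dz(2,3) carrier_matD[OF T] by (simp add: transpose_mult' mat_mult_assoc mult_left_eq[OF TT] mult_one_left)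
qed

text \<open>A zero column makes \<open>Z\<^sup>T U\<close> singular. The determinant carries this
  over to the transpose \<open>U\<^sup>T Z\<close>, the matrix in the rank condition.\<close>

lemma cut_locus_if_column_zero:
  assumes U: "U \<in> stiefel n q" and Z: "Z \<in> stiefel n q" and i: "i < q"
    and zero: "\<And>k. k < q \<Longrightarrow> (transpose_mat Z * U) $$ (k, i) = 0"
  shows "Z * transpose_mat Z \<in> grassmann_cut n q (U * transpose_mat U)"
proof -
  let ?X = "transpose_mat Z * U"
  have X: "?X \<in> carrier_mat q q" by (rule carrier_matI) (simp_all add: stiefelD[OF U] stiefelD[OF Z])
  have "?X *\<^sub>v unit_vec q i = 0\<^sub>v q"
  proof (rule eq_vecI)
    fix k assume "k < dim_vec (0\<^sub>v q :: real vec)"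
    then have k: "k < q" by simp
    have "(?X *\<^sub>v unit_vec q i) $ k = row ?X k \<bullet> unit_vec q i"
      by (rule index_mult_mat_vec) (simp add: carrier_matD(1)[OF X] k del: index_mult_mat)
    also have "\<dots> = row ?X k $ i"
      by (rule scalar_prod_right_unit[OF i])
    also have "\<dots> = ?X $$ (k, i)"
      by (rule index_row(1)) (simp_all only: carrier_matD[OF X] k i)
    finally show "(?X *\<^sub>v unit_vec q i) $ k = 0\<^sub>v q $ k" using zero[OF k] k by simp
  qed (simp only: dim_mult_mat_vec carrier_matD(1)[OF X] index_zero_vec(2))
  moreover have "unit_vec q i \<noteq> (0\<^sub>v q :: real vec)" using i by (rule unit_vec_nonzero)
  ultimately have "det ?X = 0"
    using det_0_iff_vec_prod_zero_field[OF X] unit_vec_carrier[of q i] by (intro iffD2[OF det_0_iff_vec_prod_zero_field[OF X]] exI conjI)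
  then have "det (transpose_mat ?X) = 0" using det_transpose[OF X] by simp
  moreover have "transpose_mat ?X = transpose_mat U * Z"
    by (simp add: transpose_mult' stiefelD[OF U] stiefelD[OF Z])
  ultimately have "det (transpose_mat U * Z) = 0" by (simp only:)
  moreover have "transpose_mat U * Z \<in> carrier_mat q q"
    by (rule carrier_matI) (simp_all add: stiefelD[OF U] stiefelD[OF Z])
  ultimately have "vec_space.rank q (transpose_mat U * Z) < q"
    by (intro vec_space.det_zero_low_rank)
  then show ?thesis using U Z unfolding grassmann_cut_def by (intro CollectI exI[of _ U] exI[of _ Z] conjI refl)
qed

text \<open>Diagonalizing \<open>U0\<^sup>T R U0\<close> rotates a frame of P to principal vectors,
  and c are the cosines of the principal angles. The numbers e i and 1 - e i are squared lengths of
  the components of the i-th vector in the range of R and its complement, so both are nonnegative; e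
  i = 0 would put R into the cut locus.\<close>

lemma principal_frames:
  assumes P: "P \<in> grassmann n q" and R: "R \<in> grassmann n q" and cut: "R \<notin> grassmann_cut n q P"
  obtains U c where "U \<in> stiefel n q" "P = U * transpose_mat U"
    "transpose_mat U * R * U = mat_diag q (\<lambda>i. c i * c i)" "\<forall>i<q. 0 < c i \<and> c i \<le> 1"
proof -
  obtain U0 where U0: "U0 \<in> stiefel n q" "P = U0 * transpose_mat U0" using grassmann_frame[OF P] .
  obtain Z where Z: "Z \<in> stiefel n q" "R = Z * transpose_mat Z" using grassmann_frame[OF R] .
  have Rd: "dim_row R = n" "dim_col R = n" "transpose_mat R = R" "R * R = R" using R by (auto simp: grassmann_def)
  note d0 = stiefelD(2,3)[OF U0(1)] stiefelD(2,3)[OF Z(1)] Rd(1,2)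
  let ?M = "transpose_mat U0 * R * U0"
  have M: "?M \<in> carrier_mat q q" "transpose_mat ?M = ?M"
    by (rule carrier_matI) (simp_all add: d0 transpose_mult' mat_mult_assoc Rd(3))
  obtain Q e where Q: "Q \<in> carrier_mat q q" "transpose_mat Q * Q = 1\<^sub>m q" "Q * transpose_mat Q = 1\<^sub>m q"
    "?M = Q * mat_diag q e * transpose_mat Q" using symmetric_spectral[OF M] by (elim exE conjE)
  define U where "U = U0 * Q"
  note d = d0 carrier_matD[OF Q(1)]
  have U: "U \<in> stiefel n q"
  proof (rule stiefelI)
    show "transpose_mat U * U = 1\<^sub>m q"
      unfolding U_def using d
      by (simp add: transpose_mult' mat_mult_assoc mult_left_eq[OF stiefelD(4)[OF U0(1)]] mult_one_left Q(2))
  qed (simp_all add: U_def d)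
  have PU: "P = U * transpose_mat U"
    unfolding U0(2) U_def using d by (simp add: transpose_mult' mat_mult_assoc mult_left_eq[OF Q(3)] mult_one_left)
  have URU: "transpose_mat U * R * U = mat_diag q e"
  proof -
    have "transpose_mat U * R * U = transpose_mat Q * ?M * Q"
      unfolding U_def using d by (simp add: transpose_mult' mat_mult_assoc)
    also have "\<dots> = mat_diag q e"
      unfolding Q(4) using d by (simp add: mat_mult_assoc mult_left_eq[OF Q(2)] Q(2) mult_one_left mult_one_right)
    finally show ?thesis .
  qed
  note d = d stiefelD(2,3)[OF U]
  let ?X = "transpose_mat Z * U" and ?W = "(1\<^sub>m n - R) * U"
  have XX: "transpose_mat ?X * ?X = mat_diag q e"
    using URU unfolding Z(2) using d by (simp add: transpose_mult' mat_mult_assoc)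
  have WW: "transpose_mat ?W * ?W = 1\<^sub>m q - mat_diag q e"
    unfolding URU[symmetric] using d
    by (simp add: mat_algebra Rd(3,4) mult_left_eq[OF Rd(4)] stiefelD(4)[OF U]) (rule eq_matI, auto simp del: index_mult_mat(1))
  have sumX: "e i = (\<Sum>k<q. ?X $$ (k, i) * ?X $$ (k, i))" if i: "i < q" for i
  proof -
    have "(transpose_mat ?X * ?X) $$ (i, i) = (\<Sum>k<q. transpose_mat ?X $$ (i, k) * ?X $$ (k, i))"
      using i d by (subst mat_mult_index) simp_all
    also have "\<dots> = (\<Sum>k<q. ?X $$ (k, i) * ?X $$ (k, i))"
      using i d by (intro sum.cong refl) (simp del: index_mult_mat(1))
    finally show ?thesis unfolding XX using i by (simp add: mat_diag_def)
  qed
  have sumW: "1 - e i = (\<Sum>k<n. ?W $$ (k, i) * ?W $$ (k, i))" if i: "i < q" for i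
  proof -
    have "(transpose_mat ?W * ?W) $$ (i, i) = (\<Sum>k<n. transpose_mat ?W $$ (i, k) * ?W $$ (k, i))"
      using i d by (subst mat_mult_index) simp_all
    also have "\<dots> = (\<Sum>k<n. ?W $$ (k, i) * ?W $$ (k, i))"
      using i d by (intro sum.cong refl) (simp del: index_mult_mat(1))
    finally show ?thesis unfolding WW using i by (simp add: mat_diag_def)
  qed
  have e: "0 \<le> e i" "e i \<le> 1" "e i \<noteq> 0" if i: "i < q" for i
  proof -
    show "0 \<le> e i" unfolding sumX[OF i] by (intro sum_nonneg zero_le_square)
    have "0 \<le> 1 - e i" unfolding sumW[OF i] by (intro sum_nonneg zero_le_square)
    then show "e i \<le> 1" by simp
    show "e i \<noteq> 0"
    proof
      assume "e i = 0"
      then have "\<forall>k\<in>{..<q}. ?X $$ (k, i) * ?X $$ (k, i) = 0"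
        unfolding sumX[OF i] by (subst sum_nonneg_eq_0_iff[symmetric]) simp_all
      then have "?X $$ (k, i) = 0" if "k < q" for k using that by (simp del: index_mult_mat(1))
      then have "R \<in> grassmann_cut n q P"
        unfolding PU Z(2) by (rule cut_locus_if_column_zero[OF U Z(1) i])
      then show False using cut by simp
    qed
  qed
  show thesis
  proof (rule that[OF U PU, of "\<lambda>i. sqrt (e i)"])
    show "transpose_mat U * R * U = mat_diag q (\<lambda>i. sqrt (e i) * sqrt (e i))"
      unfolding URU by (rule mat_diag_cong) (simp add: e(1))
    show "\<forall>i<q. 0 < sqrt (e i) \<and> sqrt (e i) \<le> 1"
    proof (intro allI impI conjI)
      fix i assume i: "i < q"
      show "0 < sqrt (e i)" using e(1)[OF i] e(3)[OF i] by simp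
      show "sqrt (e i) \<le> 1" using e(2)[OF i] by simp
    qed
  qed
qed

text \<open>Here P - P R P becomes \<open>U * mat_diag q s * transpose_mat U\<close>; since the
  polynomial has no constant term, the complement of the range of P contributes nothing to the
  trace.\<close>

lemma trace_poly_principal_angles:
  fixes U R :: "real mat"
  assumes U: "U \<in> stiefel n q" and R: "R \<in> carrier_mat n n"
    and URU: "transpose_mat U * R * U = mat_diag q (\<lambda>i. c i * c i)"
    and s: "\<And>i. i < q \<Longrightarrow> s i = 1 - c i * c i"
  defines "P \<equiv> U * transpose_mat U"
  shows "trace_poly (P - P * R * P) (arcsin_sq_poly N) = (\<Sum>i<q. poly (arcsin_sq_poly N) (s i))"
proof -
  note d = stiefelD(2,3)[OF U] carrier_matD[OF R]
  have URU': "transpose_mat U * (R * U) = mat_diag q (\<lambda>i. c i * c i)"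
    using URU d by (simp add: mat_mult_assoc)
  have URUX: "transpose_mat U * (R * (U * X)) = mat_diag q (\<lambda>i. c i * c i) * X" if "dim_row X = q" for X
    using arg_cong[OF URU', of "\<lambda>Y. Y * X"] that d by (simp add: mat_mult_assoc)
  have "P - P * R * P = U * (1\<^sub>m q - mat_diag q (\<lambda>i. c i * c i)) * transpose_mat U"
    unfolding P_def using d by (simp add: mat_mult_assoc URUX mult_minus_left mult_minus_right mult_one_left)
  also have "1\<^sub>m q - mat_diag q (\<lambda>i. c i * c i) = mat_diag q s"
    by (rule eq_matI) (auto simp: mat_diag_def s)
  finally have A: "P - P * R * P = U * mat_diag q s * transpose_mat U" .
  have "mat_trace ((P - P * R * P) ^\<^sub>m Suc k) = (\<Sum>i<q. s i ^ Suc k)" for k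
  proof -
    have "mat_trace (U * (mat_diag q (\<lambda>i. s i ^ Suc k) * transpose_mat U))
        = mat_trace (mat_diag q (\<lambda>i. s i ^ Suc k) * transpose_mat U * U)"
      using d by (intro mat_trace_comm) simp_all
    also have "\<dots> = (\<Sum>i<q. s i ^ Suc k)"
      using d by (simp add: mat_mult_assoc stiefelD(4)[OF U] mult_one_right mat_trace_mat_diag del: power_Suc)
    finally show ?thesis unfolding A frame_diag_pow[OF U] using d by (simp add: mat_mult_assoc del: power_Suc)
  qed
  then have "trace_poly (P - P * R * P) (arcsin_sq_poly N) = (\<Sum>k\<le>N. arcsin_sq_coeff k * (\<Sum>i<q. s i ^ Suc k))"
    unfolding trace_poly_arcsin_sq by (simp only:)
  also have "\<dots> = (\<Sum>i<q. \<Sum>k\<le>N. arcsin_sq_coeff k * s i ^ Suc k)"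
    unfolding sum_distrib_left by (rule sum.swap)
  also have "\<dots> = (\<Sum>i<q. poly (arcsin_sq_poly N) (s i))"
    by (intro sum.cong refl) (simp add: arcsin_sq_poly_def poly_sum poly_monom)
  finally show ?thesis .
qed

text \<open>Principal vectors of P are turned by the principal angles into those of R. The length of
  this curve bounds the distance from above, and the polynomial lower bounds converge to the same
  number; so its initial velocity meets all three conditions on a logarithm.\<close>

lemma grassmann_log_exists:
  assumes P: "P \<in> grassmann n q" and R: "R \<in> grassmann n q" and cut: "R \<notin> grassmann_cut n q P"
  shows "\<exists>v. v \<in> tangent_space n n (grassmann n q) P \<and> riem_exp n n (grassmann n q) grassmann_metric P v = R \<and>
    ennreal (sqrt (grassmann_metric v v)) = geodesic_dist n n (grassmann n q) grassmann_metric P R"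
proof -
  obtain U c where U: "U \<in> stiefel n q" "P = U * transpose_mat U"
    and URU: "transpose_mat U * R * U = mat_diag q (\<lambda>i. c i * c i)"
    and c': "\<forall>i<q. 0 < c i \<and> c i \<le> 1"
    using principal_frames[OF P R cut] .
  have c: "0 < c i" "c i \<le> 1" if "i < q" for i using c' that by simp_all
  have Rd: "dim_row R = n" "dim_col R = n" "transpose_mat R = R" "R * R = R" and Rc: "R \<in> carrier_mat n n"
    using R by (auto simp: grassmann_def)
  obtain Z where Z: "Z \<in> stiefel n q" "R = Z * transpose_mat Z" using grassmann_frame[OF R] .
  note d = stiefelD(2,3)[OF U(1)] Rd(1,2)
  have URU': "transpose_mat U * (R * U) = mat_diag q (\<lambda>i. c i * c i)"
    using URU d by (simp add: mat_mult_assoc)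
  have URUX: "transpose_mat U * (R * (U * X)) = mat_diag q (\<lambda>i. c i * c i) * X" if "dim_row X = q" for X
    using arg_cong[OF URU', of "\<lambda>Y. Y * X"] that d by (simp add: mat_mult_assoc)
  have RRX: "R * (R * X) = R * X" if "dim_row X = n" for X
    using mult_left_eq[OF Rd(4)] that d by simp
  define \<theta> where "\<theta> i = arccos (c i)" for i
  have \<theta>: "0 \<le> \<theta> i" "\<theta> i < pi / 2" "cos (\<theta> i) = c i" "(sin (\<theta> i))\<^sup>2 = 1 - c i * c i" "0 \<le> sin (\<theta> i)"
    "sin (\<theta> i) = 0 \<longleftrightarrow> \<theta> i = 0" if i: "i < q" for i
  proof -
    have b: "- 1 \<le> c i" "c i \<le> 1" using c[OF i] by simp_all
    show 0: "0 \<le> \<theta> i" unfolding \<theta>_def by (rule arccos_lbound[OF b])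
    show cs: "cos (\<theta> i) = c i" unfolding \<theta>_def by (rule cos_arccos[OF b])
    show lt: "\<theta> i < pi / 2"
    proof (rule ccontr)
      assume "\<not> \<theta> i < pi / 2"
      moreover have "\<theta> i \<le> pi" unfolding \<theta>_def by (rule arccos_ubound[OF b])
      ultimately have "cos (\<theta> i) \<le> cos (pi / 2)" by (intro cos_monotone_0_pi_le) simp_all
      then show False using c(1)[OF i] cs by simp
    qed
    show "(sin (\<theta> i))\<^sup>2 = 1 - c i * c i" unfolding sin_squared_eq cs by (simp add: power2_eq_square)
    show "0 \<le> sin (\<theta> i)" using 0 lt by (intro sin_ge_zero) simp_all
    show "sin (\<theta> i) = 0 \<longleftrightarrow> \<theta> i = 0"
    proof
      assume z: "sin (\<theta> i) = 0"
      show "\<theta> i = 0"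
      proof (rule ccontr)
        assume "\<theta> i \<noteq> 0"
        then have "0 < sin (\<theta> i)" using 0 lt by (intro sin_gt_zero) simp_all
        then show False using z by simp
      qed
    qed simp
  qed
  \<comment> \<open>The principal vectors of R are the projections of those of P, normalized by
    their lengths c i. They form the frame of R for which \<open>U\<^sup>T Y\<close> is diagonal
    with positive entries.\<close>
  define Y where "Y = R * U * mat_diag q (\<lambda>i. 1 / c i)"
  have Yd: "dim_row Y = n" "dim_col Y = q" by (simp_all add: Y_def d)
  have UY: "transpose_mat U * Y = mat_diag q c"
  proof -
    have "transpose_mat U * Y = mat_diag q (\<lambda>i. c i * c i * (1 / c i))"
      unfolding Y_def using d by (simp add: mat_mult_assoc URUX)
    also have "\<dots> = mat_diag q c" using c(1) by (intro mat_diag_cong) simp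
    finally show ?thesis .
  qed
  have YU: "transpose_mat Y * U = mat_diag q c"
    using arg_cong[OF UY, of transpose_mat] d Yd by (simp add: transpose_mult')
  have YY: "transpose_mat Y * Y = 1\<^sub>m q"
  proof -
    have "transpose_mat Y * Y = mat_diag q (\<lambda>i. 1 / c i * (c i * c i * (1 / c i)))"
      unfolding Y_def using d by (simp add: mat_mult_assoc transpose_mult' Rd(3) RRX URUX)
    also have "\<dots> = mat_diag q (\<lambda>i. 1)" using c(1) by (intro mat_diag_cong) force
    finally show ?thesis by simp
  qed
  have Y: "Y \<in> stiefel n q" by (rule stiefelI[OF Yd YY])
  have RY: "R * Y = Y" unfolding Y_def using d by (simp add: mat_mult_assoc RRX)
  have YR: "Y * transpose_mat Y = R"
    unfolding Z(2) by (rule frame_change_orthogonal[OF Z(1) Y]) (use RY Z(2) in simp)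
  \<comment> \<open>The part of Y orthogonal to the range of P: its columns have lengths sin
    (\<theta> i), and normalizing them gives the directions of rotation.\<close>
  define L where "L = Y - U * mat_diag q c"
  have L: "L \<in> carrier_mat n q" by (rule carrier_matI) (simp_all add: L_def d Yd)
  have UL: "transpose_mat U * L = 0\<^sub>m q q"
    unfolding L_def using d Yd
    by (simp add: mult_minus_right UY mult_left_eq[OF stiefelD(4)[OF U(1)]] mult_one_left)
  have LL: "transpose_mat L * L = mat_diag q (\<lambda>i. sin (\<theta> i) * sin (\<theta> i))"
  proof -
    have "transpose_mat L * L = (1\<^sub>m q - mat_diag q (\<lambda>i. c i * c i)) - (mat_diag q (\<lambda>i. c i * c i) - mat_diag q (\<lambda>i. c i * c i))"
      unfolding L_def using d Yd
      by (simp add: transpose_minus' transpose_mult' mult_minus_right mult_minus_left mat_mult_assoc YY UY mult_left_eq[OF YU]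
        mult_left_eq[OF stiefelD(4)[OF U(1)]] mult_one_left)
    also have "\<dots> = mat_diag q (\<lambda>i. sin (\<theta> i) * sin (\<theta> i))"
      by (rule eq_matI) (auto simp: mat_diag_def \<theta>(4)[unfolded power2_eq_square])
    finally show ?thesis .
  qed
  define H where "H = L * mat_diag q (\<lambda>i. 1 / sin (\<theta> i))"
  note H = normalize_columns[OF L LL, folded H_def]
  have HH: "transpose_mat H * H = mat_diag q (\<lambda>i. if \<theta> i = 0 then 0 else 1)"
    unfolding H(2) by (rule mat_diag_cong) (simp add: \<theta>(6))
  have UH: "transpose_mat U * H = 0\<^sub>m q q"
    unfolding H_def using d carrier_matD[OF L] by (simp add: mult_left_eq[OF UL] mult_zero_left)
  define S where "S = transpose_mat (1\<^sub>m q) * mat_diag q (\<lambda>i. \<theta> i * \<theta> i) * 1\<^sub>m q"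
  define f where "f t = (U * mat_diag q (\<lambda>i. cos (\<theta> i * t)) + H * mat_diag q (\<lambda>i. sin (\<theta> i * t))) * 1\<^sub>m q" for t
  define f' where "f' t = (H * mat_diag q (\<lambda>i. \<theta> i * cos (\<theta> i * t)) - U * mat_diag q (\<lambda>i. \<theta> i * sin (\<theta> i * t))) * 1\<^sub>m q" for t
  interpret horizontal_geodesic n q f f' "\<lambda>t. - (f t * S)" S
    using horizontal_geodesic_explicit[OF U(1) H(1) UH HH, of "1\<^sub>m q"] unfolding f_def f'_def S_def by simp
  have zero: "mat_diag q (\<lambda>i. 0) = (0\<^sub>m q q :: real mat)" by (rule eq_matI) (auto simp: mat_diag_def)
  have f0: "f 0 = U"
    unfolding f_def using d carrier_matD[OF H(1)] by (simp add: zero mult_zero_right add_zero_right mult_one_right)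
  have f1: "f 1 = Y"
  proof -
    have "mat_diag q (\<lambda>i. cos (\<theta> i * 1)) = mat_diag q c" by (rule mat_diag_cong) (simp add: \<theta>(3))
    then have "f 1 = U * mat_diag q c + L"
      unfolding f_def using d carrier_matD[OF H(1)] carrier_matD[OF L] H(3) by (simp add: mult_one_right)
    also have "\<dots> = Y"
      unfolding L_def by (rule eq_matI) (simp_all add: d Yd del: index_mult_mat(1))
    finally show ?thesis .
  qed
  have p0: "proj 0 = P" and p1: "proj 1 = R" by (simp_all add: proj_def f0 f1 U(2) YR)
  have trS: "mat_trace S = (\<Sum>i<q. (\<theta> i)\<^sup>2)"
    unfolding S_def by (simp add: mult_one_left mult_one_right mat_trace_mat_diag power2_eq_square)
  let ?dist = "geodesic_dist n n (grassmann n q) grassmann_metric P R"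
  have "?dist \<le> ennreal (sqrt (mat_trace S))" using grassmann_dist_le unfolding p0 p1 .
  moreover have "ennreal (sqrt (mat_trace S)) \<le> ?dist"
  \<comment> \<open>Each N gives a bound valid for all curves, hence for the infimum; the limit over
    N uses \<open>\<theta> i < pi / 2\<close>.\<close>
  proof (rule LIMSEQ_le_const2)
    let ?a = "\<lambda>N. \<Sum>i<q. poly (arcsin_sq_poly N) ((sin (\<theta> i))\<^sup>2)"
    show "(\<lambda>N. ennreal (sqrt (?a N))) \<longlonglongrightarrow> ennreal (sqrt (mat_trace S))"
      unfolding trS by (intro tendsto_ennrealI tendsto_real_sqrt tendsto_sum arcsin_sq_poly_tendsto \<theta>(1,2)) simp_all
    have "ennreal (sqrt (?a N)) \<le> ?dist" for N
    proof -
      have "trace_poly (P - P * R * P) (arcsin_sq_poly N) = ?a N"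
        unfolding U(2) by (rule trace_poly_principal_angles[OF U(1) Rc URU \<theta>(4)])
      then show ?thesis unfolding geodesic_dist_def
        using grassmann_curve_lower_bound[of n q P R _ N] by (intro INF_greatest) simp
    qed
    then show "\<exists>N. \<forall>k\<ge>N. ennreal (sqrt (?a k)) \<le> ?dist" by simp
  qed
  ultimately have dist: "ennreal (sqrt (mat_trace S)) = ?dist" by (rule antisym[rotated])
  show ?thesis
  proof (intro exI conjI)
    show "proj' 0 \<in> tangent_space n n (grassmann n q) P" using proj_tangent[of 0] unfolding p0 .
    show "riem_exp n n (grassmann n q) grassmann_metric P (proj' 0) = R" using grassmann_exp_eq unfolding p0 p1 .
    show "ennreal (sqrt (grassmann_metric (proj' 0) (proj' 0))) = ?dist" unfolding grassmann_norm_proj' dist ..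
  qed
qed

text \<open>The chain is dist (U, W0) \<le> |K| = |v| = dist (P, R) \<le> dist (U, W), where K = v U
  is the horizontal lift of the chosen logarithm v. What is known of v are the three properties
  guaranteed by the choice; uniqueness of geodesics identifies \<open>holonomy\<close> with the
  endpoint of the explicit curve and the endpoint of its projection with R.\<close>

theorem holonomy_minimizes:
  assumes U: "U \<in> stiefel n q" and R: "R \<in> grassmann n q" and cut: "R \<notin> grassmann_cut n q (U * transpose_mat U)"
  defines "W0 \<equiv> holonomy n q (U * transpose_mat U) R U"
  shows "W0 \<in> stiefel n q" "W0 * transpose_mat W0 = R"
    "\<And>W. W * transpose_mat W = R \<Longrightarrow> stiefel_dist n q U W0 \<le> stiefel_dist n q U W"
proof -
  let ?P = "U * transpose_mat U"
  note Ud = stiefelD[OF U]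
  have P: "?P \<in> grassmann n q" by (rule frame_projector_in_grassmann[OF U])
  define v where "v = grassmann_log n q ?P R"
  have v: "v \<in> tangent_space n n (grassmann n q) ?P" "riem_exp n n (grassmann n q) grassmann_metric ?P v = R"
    "ennreal (sqrt (grassmann_metric v v)) = geodesic_dist n n (grassmann n q) grassmann_metric ?P R"
  proof -
    have "v \<in> tangent_space n n (grassmann n q) ?P \<and> riem_exp n n (grassmann n q) grassmann_metric ?P v = R \<and>
      ennreal (sqrt (grassmann_metric v v)) = geodesic_dist n n (grassmann n q) grassmann_metric ?P R"
      unfolding v_def grassmann_log_def riem_log_def by (rule someI_ex[OF grassmann_log_exists[OF P R cut]])
    then show "v \<in> tangent_space n n (grassmann n q) ?P" "riem_exp n n (grassmann n q) grassmann_metric ?P v = R"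
      "ennreal (sqrt (grassmann_metric v v)) = geodesic_dist n n (grassmann n q) grassmann_metric ?P R"
      by (iprover, iprover, iprover)
  qed
  note vt = grassmann_tangent[OF v(1)]
  note d = Ud(2,3) carrier_matD[OF vt(1)]
  define K where "K = v * U"
  have K: "K \<in> carrier_mat n q" by (rule carrier_matI) (simp_all add: K_def d)
  \<comment> \<open>Compressing v P + P v = v to the range of P gives twice a matrix on the left and
    the same matrix on the right, so it is zero and K is horizontal.\<close>
  have e: "transpose_mat U * (v * U) + transpose_mat U * (v * U) = transpose_mat U * (v * U)"
    using arg_cong[OF vt(3), of "\<lambda>X. transpose_mat U * X * U"] d
    by (simp add: mat_mult_assoc mult_add_left mult_add_right Ud(4) mult_left_eq[OF Ud(4)] mult_one_left mult_one_right)
  have UK: "transpose_mat U * K = 0\<^sub>m q q"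
    unfolding K_def
  proof (rule eq_matI)
    fix i j assume "i < dim_row (0\<^sub>m q q :: real mat)" "j < dim_col (0\<^sub>m q q :: real mat)"
    then show "(transpose_mat U * (v * U)) $$ (i, j) = 0\<^sub>m q q $$ (i, j)"
      using arg_cong[OF e, of "\<lambda>M. M $$ (i, j)"] d by (simp del: index_mult_mat(1))
  qed (simp_all add: d)
  obtain f f' f'' where hg: "horizontal_geodesic n q f f' f'' (transpose_mat K * K)" and f: "f 0 = U" "f' 0 = K"
    using horizontal_geodesic_exists[OF U K UK] by (elim exE conjE)
  interpret horizontal_geodesic n q f f' f'' "transpose_mat K * K" by (rule hg)
  have p0: "proj 0 = ?P" by (simp add: proj_def f)
  have p0': "proj' 0 = v"
  proof -
    have "transpose_mat K = transpose_mat U * v" using d by (simp add: K_def transpose_mult' vt(2))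
    then have "proj' 0 = v * ?P + ?P * v" using d by (simp add: proj'_def f K_def mat_mult_assoc)
    then show ?thesis by (simp only: vt(3))
  qed
  have W0: "W0 = f 1"
    using stiefel_exp_eq unfolding f W0_def holonomy_def horizontal_lift_def v_def[symmetric] K_def[symmetric] by (rule sym[THEN sym])
  show "W0 \<in> stiefel n q" unfolding W0 by (rule stiefel)
  have "proj 1 = R" using grassmann_exp_eq v(2) unfolding p0 p0' by simp
  then show "W0 * transpose_mat W0 = R" unfolding W0 proj_def .
  fix W assume W: "W * transpose_mat W = R"
  have "stiefel_dist n q U W0 \<le> ennreal (sqrt (mat_trace (transpose_mat K * K)))"
    using stiefel_dist_le unfolding f W0 .
  also have "\<dots> = geodesic_dist n n (grassmann n q) grassmann_metric ?P R"
    using grassmann_norm_proj'[of 0] v(3) unfolding p0' by simp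
  also have "\<dots> \<le> stiefel_dist n q U W"
    using grassmann_dist_le_stiefel_dist[of n q U W] unfolding W .
  finally show "stiefel_dist n q U W0 \<le> stiefel_dist n q U W" .
qed

section \<open>Flags\<close>

lemma sum_list_take_Suc: "i < length qs \<Longrightarrow> sum_list (take (Suc i) qs) = sum_list (take i qs) + qs ! i" for qs :: "nat list"
  by (simp add: take_Suc_conv_app_nth)

lemma sum_list_take_mono:
  fixes qs :: "nat list"
  assumes "i \<le> j"
  shows "sum_list (take i qs) \<le> sum_list (take j qs)"
proof -
  have "take j qs = take i qs @ take (j - i) (drop i qs)"
    using take_add[of i "j - i" qs] assms by simp
  then show ?thesis by simp
qed

lemma block_end_le:
  fixes qs :: "nat list"
  assumes "i < length qs"
  shows "sum_list (take i qs) + qs ! i \<le> sum_list qs"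
  using sum_list_take_mono[of "Suc i" "length qs" qs] sum_list_take_Suc[OF assms] assms by simp

lemma block_of_column:
  fixes qs :: "nat list"
  assumes "c < sum_list qs"
  shows "\<exists>i<length qs. sum_list (take i qs) \<le> c \<and> c < sum_list (take i qs) + qs ! i"
  using assms
proof (induction qs rule: rev_induct)
  case (snoc q qs)
  show ?case
  proof (cases "c < sum_list qs")
    case True
    then obtain i where i: "i < length qs" "sum_list (take i qs) \<le> c" "c < sum_list (take i qs) + qs ! i"
      using snoc.IH[OF True] by (elim exE conjE)
    then show ?thesis by (intro exI[of _ i]) (simp add: nth_append)
  next
    case False
    then show ?thesis using snoc.prems by (intro exI[of _ "length qs"]) simp
  qed
qed simp

lemma block_of_column_unique:
  fixes qs :: "nat list"
  assumes "i < length qs" "j < length qs"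
    and "sum_list (take i qs) \<le> c" "c < sum_list (take i qs) + qs ! i"
    and "sum_list (take j qs) \<le> c" "c < sum_list (take j qs) + qs ! j"
  shows "i = j"
proof (rule ccontr)
  assume "i \<noteq> j"
  then have "Suc i \<le> j \<or> Suc j \<le> i" by linarith
  then show False
    using sum_list_take_mono[of "Suc i" j qs] sum_list_take_mono[of "Suc j" i qs] assms
      sum_list_take_Suc[OF assms(1)] sum_list_take_Suc[OF assms(2)] by linarith
qed

section \<open>Coordinates of the standard projectors\<close>

lemma standard_projector_dim:
  "dim_row (standard_projector qs i) = sum_list qs" "dim_col (standard_projector qs i) = sum_list qs"
proof -
  have "map (dim_row \<circ> (\<lambda>k. if k = i then 1\<^sub>m (qs ! k) else 0\<^sub>m (qs ! k) (qs ! k) :: real mat)) [0..<length qs] = qs"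
    "map (dim_col \<circ> (\<lambda>k. if k = i then 1\<^sub>m (qs ! k) else 0\<^sub>m (qs ! k) (qs ! k) :: real mat)) [0..<length qs] = qs"
    by (rule nth_equalityI; simp)+
  then show "dim_row (standard_projector qs i) = sum_list qs" "dim_col (standard_projector qs i) = sum_list qs"
    unfolding standard_projector_def dim_diag_block_mat by (simp_all only: map_map)
qed

text \<open>Splitting off the last block, not the first, leaves the offsets of the other blocks and
  the index i unchanged.\<close>

lemma standard_projector_snoc:
  "standard_projector (qs @ [q]) i = four_block_mat (standard_projector qs i) (0\<^sub>m (sum_list qs) q) (0\<^sub>m q (sum_list qs))
     (if i = length qs then 1\<^sub>m q else 0\<^sub>m q q)"
proof -
  let ?f = "\<lambda>qs k. if k = i then 1\<^sub>m (qs ! k) else 0\<^sub>m (qs ! k) (qs ! k) :: real mat"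
  have "map (?f (qs @ [q])) [0..<length (qs @ [q])] = map (?f qs) [0..<length qs] @ [?f (qs @ [q]) (length qs)]"
    by (simp add: nth_append)
  then have "standard_projector (qs @ [q]) i = (let A = standard_projector qs i; B = ?f (qs @ [q]) (length qs) in
      four_block_mat A (0\<^sub>m (dim_row A) (dim_col B)) (0\<^sub>m (dim_row B) (dim_col A)) B)"
    unfolding standard_projector_def by (simp only: diag_block_mat_last Let_def)
  then show ?thesis by (auto simp: standard_projector_dim Let_def)
qed

lemma standard_projector_index:
  assumes "a < sum_list qs" "b < sum_list qs"
  shows "standard_projector qs i $$ (a, b) =
    (if a = b \<and> sum_list (take i qs) \<le> a \<and> a < sum_list (take (Suc i) qs) then 1 else 0)"
  using assms
proof (induction qs arbitrary: a b rule: rev_induct)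
  case (snoc q qs)
  let ?n = "sum_list qs"
  have take: "sum_list (take j (qs @ [q])) = (if j \<le> length qs then sum_list (take j qs) else ?n + q)" for j
    by simp
  have le: "sum_list (take j qs) \<le> ?n" for j
    using sum_list_take_mono[of j "max j (length qs)" qs] by simp
  have big: "take j qs = qs" if "length qs \<le> j" for j using that by simp
  have ab: "a < ?n + q" "b < ?n + q" using snoc.prems by simp_all
  show ?case
  proof (cases "a < ?n \<and> b < ?n")
    case True
    then have "standard_projector (qs @ [q]) i $$ (a, b) = standard_projector qs i $$ (a, b)"
      unfolding standard_projector_snoc by (subst index_mat_four_block) (simp_all add: standard_projector_dim)
    also have "\<dots> = (if a = b \<and> sum_list (take i qs) \<le> a \<and> a < sum_list (take (Suc i) qs) then 1 else 0)"
      using True by (intro snoc.IH) simp_all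
    finally show ?thesis unfolding take using True le big[of i] big[of "Suc i"]
      by (cases "Suc i \<le> length qs"; cases "i = length qs"; simp)
  next
    case False
    then have "standard_projector (qs @ [q]) i $$ (a, b) = (if i = length qs \<and> a = b then 1 else 0)"
      unfolding standard_projector_snoc using ab
      by (subst index_mat_four_block) (auto simp: standard_projector_dim)
    then show ?thesis unfolding take using False le[of i] le[of "Suc i"] ab
      by (cases "Suc i \<le> length qs"; cases "i = length qs"; auto)
  qed
qed simp

lemma sum_block:
  fixes g :: "nat \<Rightarrow> real"
  assumes "l + m \<le> n"
  shows "(\<Sum>c<n. if l \<le> c \<and> c < l + m then g c else 0) = (\<Sum>k<m. g (l + k))"
proof -
  have "(\<Sum>c<n. if l \<le> c \<and> c < l + m then g c else 0) = (\<Sum>c\<in>{l..<l + m}. g c)"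
    using assms by (intro sum.mono_neutral_cong_right) auto
  also have "\<dots> = (\<Sum>k<m. g (l + k))"
    by (rule sum.reindex_bij_witness[of _ "\<lambda>k. l + k" "\<lambda>c. c - l"]) auto
  finally show ?thesis .
qed

section \<open>Column blocks of orthogonal matrices\<close>

lemma col_block_dim [simp]: "dim_row (col_block qs Q i) = dim_row Q" "dim_col (col_block qs Q i) = qs ! i"
  by (simp_all add: col_block_def)

lemma col_block_stiefel:
  assumes Q: "Q \<in> orthogonal_group n" and qs: "sum_list qs = n" and i: "i < length qs"
  shows "col_block qs Q i \<in> stiefel n (qs ! i)"
proof -
  have Qc: "Q \<in> carrier_mat n n" and QQ: "transpose_mat Q * Q = 1\<^sub>m n" using Q by (auto simp: orthogonal_group_def)
  note d = carrier_matD[OF Qc]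
  let ?o = "sum_list (take i qs)"
  have "transpose_mat (col_block qs Q i) * col_block qs Q i = 1\<^sub>m (qs ! i)"
  proof (rule eq_matI)
    fix a b assume "a < dim_row (1\<^sub>m (qs ! i) :: real mat)" "b < dim_col (1\<^sub>m (qs ! i) :: real mat)"
    then have ab: "a < qs ! i" "b < qs ! i" by simp_all
    then have oab: "?o + a < n" "?o + b < n" using block_end_le[OF i] qs by simp_all
    have "(transpose_mat (col_block qs Q i) * col_block qs Q i) $$ (a, b) = (transpose_mat Q * Q) $$ (?o + a, ?o + b)"
      using ab oab d by (simp add: mat_mult_index col_block_def del: index_mult_mat(1))
    then show "(transpose_mat (col_block qs Q i) * col_block qs Q i) $$ (a, b) = 1\<^sub>m (qs ! i) $$ (a, b)"
      unfolding QQ using ab oab by simp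
  qed simp_all
  then show ?thesis by (intro stiefelI) (simp_all add: d)
qed

lemma flag_of_nth:
  assumes Q: "Q \<in> orthogonal_group n" and qs: "sum_list qs = n" and i: "i < length qs"
  shows "flag_of qs Q ! i = col_block qs Q i * transpose_mat (col_block qs Q i)"
proof -
  have Qc: "Q \<in> carrier_mat n n" using Q by (auto simp: orthogonal_group_def)
  note d = carrier_matD[OF Qc]
  let ?o = "sum_list (take i qs)"
  let ?e = "\<lambda>c. if ?o \<le> c \<and> c < ?o + qs ! i then 1 else 0 :: real"
  have E: "standard_projector qs i = mat_diag n ?e"
  proof (rule eq_matI)
    fix a b assume "a < dim_row (mat_diag n ?e)" "b < dim_col (mat_diag n ?e)"
    then have ab: "a < n" "b < n" by simp_all
    then show "standard_projector qs i $$ (a, b) = mat_diag n ?e $$ (a, b)"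
      using standard_projector_index[of a qs b i] qs unfolding sum_list_take_Suc[OF i] by (auto simp: mat_diag_def)
  qed (simp_all add: standard_projector_dim qs)
  have "flag_of qs Q ! i = Q * standard_projector qs i * transpose_mat Q" using i by (simp add: flag_of_def)
  also have "\<dots> = col_block qs Q i * transpose_mat (col_block qs Q i)"
    unfolding E mat_diag_mult_right[OF Qc]
  proof (rule eq_matI)
    fix a b assume "a < dim_row (col_block qs Q i * transpose_mat (col_block qs Q i))"
      "b < dim_col (col_block qs Q i * transpose_mat (col_block qs Q i))"
    then have ab: "a < n" "b < n" using d by simp_all
    have "(mat n n (\<lambda>(i, j). Q $$ (i, j) * ?e j) * transpose_mat Q) $$ (a, b)
        = (\<Sum>c<n. Q $$ (a, c) * ?e c * Q $$ (b, c))"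
      using ab d by (simp add: mat_mult_index del: index_mult_mat(1))
    also have "\<dots> = (\<Sum>c<n. if ?o \<le> c \<and> c < ?o + qs ! i then Q $$ (a, c) * Q $$ (b, c) else 0)"
      by (intro sum.cong) auto
    also have "\<dots> = (\<Sum>k<qs ! i. Q $$ (a, ?o + k) * Q $$ (b, ?o + k))"
      by (rule sum_block) (use block_end_le[OF i] qs in simp)
    also have "\<dots> = (col_block qs Q i * transpose_mat (col_block qs Q i)) $$ (a, b)"
      using ab d by (simp add: mat_mult_index col_block_def del: index_mult_mat(1))
    finally show "(mat n n (\<lambda>(i, j). Q $$ (i, j) * ?e j) * transpose_mat Q) $$ (a, b)
        = (col_block qs Q i * transpose_mat (col_block qs Q i)) $$ (a, b)" .
  qed (simp_all add: d)
  finally show ?thesis .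
qed

text \<open>This justifies the definite description in \<open>holonomy_matrix\<close>. The function
  I locates a column in its block; columns from different blocks are orthogonal because the
  projectors of the blocks annihilate each other.\<close>

lemma ex1_orthogonal_of_blocks:
  assumes qs: "sum_list qs = n"
    and W: "\<And>i. i < length qs \<Longrightarrow> W i \<in> stiefel n (qs ! i)"
    and orth: "\<And>i j. i < length qs \<Longrightarrow> j < length qs \<Longrightarrow> i \<noteq> j \<Longrightarrow>
      (W i * transpose_mat (W i)) * (W j * transpose_mat (W j)) = 0\<^sub>m n n"
  shows "\<exists>!Q. Q \<in> orthogonal_group n \<and> (\<forall>i<length qs. col_block qs Q i = W i)"
proof -
  let ?o = "\<lambda>i. sum_list (take i qs)"
  have "\<forall>c\<in>{..<n}. \<exists>i. i < length qs \<and> ?o i \<le> c \<and> c < ?o i + qs ! i"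
    using block_of_column[of _ qs] qs by simp
  from bchoice[OF this] obtain I where I0: "\<forall>c\<in>{..<n}. I c < length qs \<and> ?o (I c) \<le> c \<and> c < ?o (I c) + qs ! I c" ..
  have I: "I c < length qs" "?o (I c) \<le> c" "c < ?o (I c) + qs ! I c" if "c < n" for c
    using bspec[OF I0, of c] that by simp_all
  have I_eq: "I (?o i + b) = i" if "i < length qs" "b < qs ! i" for i b
  proof -
    have c: "?o i + b < n" using block_end_le[OF that(1)] that(2) qs by simp
    show ?thesis
      by (rule block_of_column_unique[OF I(1)[OF c] that(1) I(2,3)[OF c]]) (use that(2) in simp_all)
  qed
  note Wd = stiefelD[OF W]
  define Q where "Q = mat n n (\<lambda>(a, c). W (I c) $$ (a, c - ?o (I c)))"
  have Qd: "dim_row Q = n" "dim_col Q = n" by (simp_all add: Q_def)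
  have blocks: "col_block qs Q i = W i" if i: "i < length qs" for i
  proof (rule eq_matI)
    fix a b assume "a < dim_row (W i)" "b < dim_col (W i)"
    then have ab: "a < n" "b < qs ! i" using Wd(2,3)[OF i] by simp_all
    moreover have "?o i + b < n" using block_end_le[OF i] ab(2) qs by simp
    ultimately show "col_block qs Q i $$ (a, b) = W i $$ (a, b)"
      by (simp add: col_block_def Qd) (simp add: Q_def I_eq[OF i ab(2)])
  qed (simp_all add: Qd Wd(2,3)[OF i])
  \<comment> \<open>Sandwiching the product of the two projectors between
    \<open>(W i)\<^sup>T\<close> and \<open>W j\<close> cancels the outer frames.\<close>
  have cross: "transpose_mat (W i) * W j = 0\<^sub>m (qs ! i) (qs ! j)" if ij: "i < length qs" "j < length qs" "i \<noteq> j" for i j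
  proof -
    note d = Wd(2,3)[OF ij(1)] Wd(2,3)[OF ij(2)]
    have "transpose_mat (W i) * ((W i * transpose_mat (W i)) * (W j * transpose_mat (W j))) * W j = transpose_mat (W i) * W j"
      using d by (simp add: mat_mult_assoc mult_left_eq[OF Wd(4)[OF ij(1)]] Wd(4)[OF ij(2)] mult_one_left mult_one_right)
    then show ?thesis unfolding orth[OF ij] using d by (simp add: mult_zero_left mult_zero_right)
  qed
  have QQ: "transpose_mat Q * Q = 1\<^sub>m n"
  proof (rule eq_matI)
    fix c c' assume "c < dim_row (1\<^sub>m n :: real mat)" "c' < dim_col (1\<^sub>m n :: real mat)"
    then have cc: "c < n" "c' < n" by simp_all
    let ?b = "c - ?o (I c)" and ?b' = "c' - ?o (I c')"
    have b: "?b < qs ! I c" "?b' < qs ! I c'" using I(2,3)[OF cc(1)] I(2,3)[OF cc(2)] by simp_all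
    have "(transpose_mat Q * Q) $$ (c, c') = (\<Sum>a<n. W (I c) $$ (a, ?b) * W (I c') $$ (a, ?b'))"
      using cc by (subst mat_mult_index) (simp_all add: Qd, simp add: Q_def)
    also have "\<dots> = (transpose_mat (W (I c)) * W (I c')) $$ (?b, ?b')"
      using b Wd(2,3)[OF I(1)[OF cc(1)]] Wd(2,3)[OF I(1)[OF cc(2)]] by (subst mat_mult_index) simp_all
    also have "\<dots> = 1\<^sub>m n $$ (c, c')"
    proof (cases "I c = I c'")
      case True
      then show ?thesis
        using b cc I(2)[OF cc(1)] I(2)[OF cc(2)] Wd(4)[OF I(1)[OF cc(2)]] by auto
    next
      case False
      then show ?thesis using cross[OF I(1)[OF cc(1)] I(1)[OF cc(2)] False] b cc by auto
    qed
    finally show "(transpose_mat Q * Q) $$ (c, c') = 1\<^sub>m n $$ (c, c')" .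
  qed (simp_all add: Qd)
  show ?thesis
  proof (rule ex1I[of _ Q])
    show "Q \<in> orthogonal_group n \<and> (\<forall>i<length qs. col_block qs Q i = W i)"
      using QQ carrier_matI[OF Qd] blocks by (simp add: orthogonal_group_def)
    fix Q' assume Q': "Q' \<in> orthogonal_group n \<and> (\<forall>i<length qs. col_block qs Q' i = W i)"
    then have Qd': "dim_row Q' = n" "dim_col Q' = n" by (auto simp: orthogonal_group_def)
    show "Q' = Q"
    proof (rule eq_matI)
      fix a c assume "a < dim_row Q" "c < dim_col Q"
      then have ac: "a < n" "c < n" by (simp_all add: Qd)
      have "col_block qs Q' (I c) $$ (a, c - ?o (I c)) = Q' $$ (a, c)"
        unfolding col_block_def using ac I(2,3)[OF ac(2)] Qd' by simp
      moreover have "col_block qs Q' (I c) = W (I c)" using Q' I(1)[OF ac(2)] by simp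
      ultimately show "Q' $$ (a, c) = Q $$ (a, c)" using ac by (simp add: Q_def)
    qed (simp_all add: Qd Qd')
  qed
qed

section \<open>Constancy of the flag type\<close>

lemma continuous_nat_valued_constant:
  fixes f :: "real \<Rightarrow> real"
  assumes "connected J" "continuous_on J f" "\<And>y. y \<in> J \<Longrightarrow> \<exists>k::nat. f y = real k" "x \<in> J" "y \<in> J"
  shows "f x = f y"
proof -
  have "f constant_on J"
  proof (rule continuous_discrete_range_constant[OF assms(1,2)])
    fix x assume x: "x \<in> J"
    show "\<exists>e>0. \<forall>y. y \<in> J \<and> f y \<noteq> f x \<longrightarrow> e \<le> norm (f y - f x)"
    proof (intro exI[of _ 1] conjI allI impI)
      fix y assume y: "y \<in> J \<and> f y \<noteq> f x"
      obtain k :: nat where k: "f x = real k" using assms(3)[OF x] ..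
      obtain l :: nat where l: "f y = real l" using assms(3)[OF conjunct1[OF y]] ..
      note kl = k l
      have "int l \<noteq> int k" using y kl by simp
      then have "1 \<le> \<bar>int l - int k\<bar>" by linarith
      then have "1 \<le> \<bar>real l - real k\<bar>" by linarith
      then show "1 \<le> norm (f y - f x)" by (simp add: kl)
    qed simp
  qed
  then obtain c where "\<forall>y\<in>J. f y = c" unfolding constant_on_def ..
  then show ?thesis using assms(4,5) by simp
qed

text \<open>The trace of each component equals its rank, hence is a natural number, and is
  continuous in x; on an interval it cannot jump. So the types at x and \<open>x0\<close> agree
  entry by entry.\<close>

lemma flag_type_constant:
  assumes J: "is_interval (J :: real set)"
    and flags: "\<And>x. x \<in> J \<Longrightarrow> \<exists>qs. is_flag n qs (P x)" and len: "\<And>x. x \<in> J \<Longrightarrow> length (P x) = r"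
    and cont: "\<And>i a b. i < r \<Longrightarrow> a < n \<Longrightarrow> b < n \<Longrightarrow> continuous_on J (\<lambda>x. (P x ! i) $$ (a, b))"
    and x0: "x0 \<in> J" and flag0: "is_flag n qs (P x0)" and x: "x \<in> J"
  shows "is_flag n qs (P x)"
proof -
  obtain qs' where flag: "is_flag n qs' (P x)" using flags[OF x] ..
  have comp: "P y ! i \<in> grassmann n (ps ! i)" "length ps = r" if "y \<in> J" "is_flag n ps (P y)" "i < r" for y ps i
    using that(2,3) len[OF that(1)] unfolding is_flag_def by auto
  have "qs' = qs"
  proof (rule nth_equalityI)
    show "length qs' = length qs"
      using flag flag0 len[OF x] len[OF x0] unfolding is_flag_def by simp
    fix i assume "i < length qs'"
    then have i: "i < r" using flag len[OF x] unfolding is_flag_def by simp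
    have g: "\<exists>k. P y ! i \<in> grassmann n k" if y: "y \<in> J" for y
    proof -
      obtain ps where "is_flag n ps (P y)" using flags[OF y] ..
      then show ?thesis using comp(1)[OF y _ i] by (intro exI)
    qed
    have "mat_trace (P x ! i) = mat_trace (P x0 ! i)"
    proof (rule continuous_nat_valued_constant[of J "\<lambda>y. mat_trace (P y ! i)", OF _ _ _ x x0])
      show "connected J" using J by (rule is_interval_connected)
      show "continuous_on J (\<lambda>y. mat_trace (P y ! i))"
      proof (rule continuous_on_mat_trace[of n])
        show "P y ! i \<in> carrier_mat n n" if y: "y \<in> J" for y
        proof -
          obtain k where "P y ! i \<in> grassmann n k" using g[OF y] ..
          then show ?thesis by (simp add: grassmann_def)
        qed
      qed (rule cont[OF i])
      show "\<exists>k::nat. mat_trace (P y ! i) = real k" if y: "y \<in> J" for y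
      proof -
        obtain k where "P y ! i \<in> grassmann n k" using g[OF y] ..
        then show ?thesis using grassmann_trace by (intro exI)
      qed
    qed
    then show "qs' ! i = qs ! i"
      using grassmann_trace[OF comp(1)[OF x flag i]] grassmann_trace[OF comp(1)[OF x0 flag0 i]] by simp
  qed
  then show ?thesis using flag by simp
qed

theorem lemma17:
  fixes J :: "real set" and P :: "real \<Rightarrow> real mat list" and n r i :: nat
    and x0 x :: real and qs :: "nat list" and Q0 :: "real mat"
  assumes "open J" and "is_interval J"
    and "\<And>x. x \<in> J \<Longrightarrow> \<exists>qs'. is_flag n qs' (P x)"
    and "\<And>x. x \<in> J \<Longrightarrow> length (P x) = r"
    and "\<And>i a b. i < r \<Longrightarrow> a < n \<Longrightarrow> b < n \<Longrightarrow> continuous_on J (\<lambda>x. (P x ! i) $$ (a, b))"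
    and "x0 \<in> J"
    and "is_flag n qs (P x0)"
    and "Q0 \<in> orthogonal_group n" and "flag_of qs Q0 = P x0"
    and "x \<in> holonomy_interval n qs J P x0" and "i < r"
  shows "is_arg_min
           (\<lambda>W. stiefel_dist n (qs ! i) (col_block qs Q0 i) W)
           (\<lambda>W. W \<in> stiefel n (qs ! i) \<and> W * transpose_mat W = P x ! i)
           (col_block qs (holonomy_matrix n qs P x0 Q0 x) i)"
proof -
  have len: "length qs = r" and n: "sum_list qs = n"
    using assms(4)[OF assms(6)] assms(7) by (simp_all add: is_flag_def)
  have x: "x \<in> J" and cut: "\<And>j. j < length qs \<Longrightarrow> P x ! j \<notin> grassmann_cut n (qs ! j) (P x0 ! j)"
    using assms(10) connected_component_subset unfolding holonomy_interval_def by auto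
  have flag: "is_flag n qs (P x)"
    by (rule flag_type_constant[OF assms(2,3,4,5,6,7) x])
  have R: "P x ! j \<in> grassmann n (qs ! j)" if "j < length qs" for j
    using flag that unfolding is_flag_def by simp
  have R_orth: "P x ! j * P x ! k = 0\<^sub>m n n" if "j < length qs" "k < length qs" "j \<noteq> k" for j k
    using flag that unfolding is_flag_def by simp
  let ?U = "\<lambda>j. col_block qs Q0 j"
  have U: "?U j \<in> stiefel n (qs ! j)" "?U j * transpose_mat (?U j) = P x0 ! j" if "j < length qs" for j
    using col_block_stiefel[OF assms(8) n that] flag_of_nth[OF assms(8) n that] assms(9) by simp_all
  let ?W = "\<lambda>j. holonomy n (qs ! j) (P x0 ! j) (P x ! j) (?U j)"
  have W: "?W j \<in> stiefel n (qs ! j)" "?W j * transpose_mat (?W j) = P x ! j"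
    "\<And>W. W * transpose_mat W = P x ! j \<Longrightarrow> stiefel_dist n (qs ! j) (?U j) (?W j) \<le> stiefel_dist n (qs ! j) (?U j) W"
    if j: "j < length qs" for j
    using holonomy_minimizes[OF U(1)[OF j] R[OF j]] cut[OF j] unfolding U(2)[OF j] by simp_all
  \<comment> \<open>The frames \<open>?W j\<close> belong to mutually orthogonal projectors, so
    exactly one orthogonal matrix has them as blocks, and \<open>holonomy_matrix\<close> is that
    matrix.\<close>
  have "\<exists>!Q. Q \<in> orthogonal_group n \<and> (\<forall>j<length qs. col_block qs Q j = ?W j)"
    by (rule ex1_orthogonal_of_blocks[OF n W(1)]) (simp_all add: W(2) R_orth)
  from theI'[OF this] have "\<forall>j<length qs. col_block qs (holonomy_matrix n qs P x0 Q0 x) j = ?W j"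
    unfolding holonomy_matrix_def by (rule conjunct2)
  then have block: "col_block qs (holonomy_matrix n qs P x0 Q0 x) i = ?W i" using assms(11) len by simp
  have i: "i < length qs" using assms(11) len by simp
  show ?thesis
    unfolding is_arg_min_def block
  proof (intro conjI notI)
    show "?W i \<in> stiefel n (qs ! i)" "?W i * transpose_mat (?W i) = P x ! i" using W(1,2)[OF i] .
    assume "\<exists>y. (y \<in> stiefel n (qs ! i) \<and> y * transpose_mat y = P x ! i) \<and>
      stiefel_dist n (qs ! i) (?U i) y < stiefel_dist n (qs ! i) (?U i) (?W i)"
    then obtain y where "y * transpose_mat y = P x ! i"
      "stiefel_dist n (qs ! i) (?U i) y < stiefel_dist n (qs ! i) (?U i) (?W i)" by (elim exE conjE)
    then show False using W(3)[OF i, of y] by simp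
  qed
qed

end
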